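(* Let $n\ge 2$, let $\Omega\subset\mathbb{R}^n$ be an open set with non-empty complement, let $p>1$, let $\alpha\in[1,n)$, and let $f\in L^p(\Omega)$. Suppose that any one of the following holds: (1) $\alpha>1$ and $\Omega$ is bounded; (2) $\alpha=1$ and $\Omega^c=\mathbb{R}^n\setminus\Omega$ is convex; (3) $\alpha=1$, $\Omega$ is bounded and $\Omega$ satisfies a uniform curvature bound; (4) $\alpha=1$ and $p>1+\frac1n$. Then the local fractional maximal function $M^{\Omega}_\alpha f$ is weakly differentiable in $\Omega$ and $$\|\nabla M^{\Omega}_\alpha f\|_{L^p(\Omega)}\le C\,\|f\|_{L^p(\Omega)},$$ where $C$ depends only on $n$ and $p$ in cases (2) and (4), and only on $n$, $p$, $\alpha$ and $\Omega$ in cases (1) and (3).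
   Context: For $x\in\Omega$ let $\delta(x)=\operatorname{dist}(x,\Omega^c)$. The local fractional maximal function relative to $\Omega$ is $$M^{\Omega}_\alpha f(x)=\sup_{0<r<\delta(x)}\frac{r^\alpha}{|B(x,r)|}\int_{B(x,r)}|f(y)|\,dy,\qquad x\in\Omega .$$ For $x\in\Omega$, $b_x$ denotes a point of $\Omega^c$ with $|x-b_x|=\delta(x)$ (it exists but need not be unique). $\Omega$ satisfies a uniform curvature bound if there is $R>0$ such that for every $x\in\Omega$ $$B\Bigl(b_x+R\,\frac{x-b_x}{\delta(x)},\,R\Bigr)\subset\Omega .$$ Weak derivatives are defined with test functions in $C_c^\infty(\Omega)$. *)

theory Defs
  imports "HOL-Analysis.Analysis"
begin

definition Lp_space :: "real \<Rightarrow> 'a::euclidean_space set \<Rightarrow> ('a \<Rightarrow> 'b::real_normed_vector) set" where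
  "Lp_space p \<Omega> = {f. f \<in> borel_measurable (lebesgue_on \<Omega>) \<and>
                      integrable (lebesgue_on \<Omega>) (\<lambda>x. norm (f x) powr p)}"

text \<open>Only meaningful for functions in \<open>Lp_space p \<Omega>\<close>: the Bochner integral of a
  non-integrable function is 0.\<close>

definition Lp_norm :: "real \<Rightarrow> 'a::euclidean_space set \<Rightarrow> ('a \<Rightarrow> 'b::real_normed_vector) \<Rightarrow> real" where
  "Lp_norm p \<Omega> f = (LINT x|lebesgue_on \<Omega>. norm (f x) powr p) powr (1 / p)"

text \<open>The supremum may be infinite on a null set of points \<open>x\<close>, so it is taken in \<open>[0, \<infinity>]\<close>.
  All the balls involved lie inside \<open>\<Omega>\<close>, so the values of \<open>f\<close> outside \<open>\<Omega>\<close> are irrelevant.\<close>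

definition local_frac_max ::
  "real \<Rightarrow> (real^'n) set \<Rightarrow> (real^'n \<Rightarrow> real) \<Rightarrow> real^'n \<Rightarrow> ennreal" where
  "local_frac_max \<alpha> \<Omega> f x =
     (SUP r\<in>{0<..<infdist x (- \<Omega>)}.
        ennreal (r powr \<alpha> / measure lebesgue (ball x r)) *
        (\<integral>\<^sup>+y\<in>ball x r. ennreal \<bar>f y\<bar> \<partial>lebesgue))"

text \<open>The nearest point \<open>b\<close> of the complement need not be unique. Requiring the inclusion for one
  nearest point of each \<open>x\<close> is equivalent to requiring it for all of them: if \<open>b\<close> is nearest
  to \<open>x\<close>, it is the only nearest point of every point strictly between \<open>b\<close> and \<open>x\<close>, and such a
  point determines the same ball.\<close>

definition uniform_curvature_bound :: "(real^'n) set \<Rightarrow> bool" where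
  "uniform_curvature_bound \<Omega> \<longleftrightarrow>
     (\<exists>R>0. \<forall>x\<in>\<Omega>. \<exists>b\<in>- \<Omega>. dist x b = infdist x (- \<Omega>) \<and>
        ball (b + (R / infdist x (- \<Omega>)) *\<^sub>R (x - b)) R \<subseteq> \<Omega>)"

definition partial_deriv :: "'n \<Rightarrow> (real^'n \<Rightarrow> real) \<Rightarrow> real^'n \<Rightarrow> real" where
  "partial_deriv i \<phi> x = frechet_derivative \<phi> (at x) (axis i 1)"

primrec Ck :: "nat \<Rightarrow> (real^'n \<Rightarrow> real) \<Rightarrow> bool" where
  "Ck 0 \<phi> \<longleftrightarrow> continuous_on UNIV \<phi>"
| "Ck (Suc k) \<phi> \<longleftrightarrow> (\<forall>x. \<phi> differentiable (at x)) \<and> (\<forall>i. Ck k (partial_deriv i \<phi>))"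

text \<open>The space \<open>C\<^sub>c\<^sup>\<infinity>(\<Omega>)\<close>, its elements being extended by zero to the whole space.\<close>

definition test_functions :: "(real^'n) set \<Rightarrow> (real^'n \<Rightarrow> real) set" where
  "test_functions \<Omega> = {\<phi>. (\<forall>k. Ck k \<phi>) \<and>
     compact (closure {x. \<phi> x \<noteq> 0}) \<and> closure {x. \<phi> x \<noteq> 0} \<subseteq> \<Omega>}"

definition locally_integrable ::
  "'a::euclidean_space set \<Rightarrow> ('a \<Rightarrow> 'b::euclidean_space) \<Rightarrow> bool" where
  "locally_integrable \<Omega> u \<longleftrightarrow> (\<forall>K. compact K \<and> K \<subseteq> \<Omega> \<longrightarrow> u absolutely_integrable_on K)"

definition has_weak_gradient ::
  "(real^'n) set \<Rightarrow> (real^'n \<Rightarrow> real) \<Rightarrow> (real^'n \<Rightarrow> real^'n) \<Rightarrow> bool" where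
  "has_weak_gradient \<Omega> u g \<longleftrightarrow>
     locally_integrable \<Omega> u \<and> locally_integrable \<Omega> g \<and>
     (\<forall>\<phi>\<in>test_functions \<Omega>. \<forall>i.
        (LINT x:\<Omega>|lebesgue. u x * partial_deriv i \<phi> x) = - (LINT x:\<Omega>|lebesgue. g x $ i * \<phi> x))"

text \<open>\<open>u\<close> is weakly differentiable in \<open>\<Omega>\<close> and the \<open>L\<^sup>p(\<Omega>)\<close> norm of its weak gradient is
  finite and at most \<open>c\<close>. A \<open>[0, \<infinity>]\<close>-valued \<open>u\<close> has to be finite almost everywhere in \<open>\<Omega>\<close> to
  be identified with the real function \<open>enn2real \<circ> u\<close>, since \<open>enn2real \<infinity> = 0\<close>.
  The weak gradient is unique up to null sets, so the choice of \<open>g\<close> does not matter.\<close>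

definition weakly_differentiable_with_bound ::
  "real \<Rightarrow> (real^'n) set \<Rightarrow> (real^'n \<Rightarrow> ennreal) \<Rightarrow> real \<Rightarrow> bool" where
  "weakly_differentiable_with_bound p \<Omega> u c \<longleftrightarrow>
     (AE x in lebesgue_on \<Omega>. u x < \<infinity>) \<and>
     (\<exists>g. has_weak_gradient \<Omega> (\<lambda>x. enn2real (u x)) g \<and>
          g \<in> Lp_space p \<Omega> \<and> Lp_norm p \<Omega> g \<le> c)"

end

(*
  Let d be the distance to the complement.  If |x' - x| = h and B(x',r) is a ball competing for the
  maximal function at x', then either B(x,r+h) still competes at x, which costs O(h M f) with the
  Hardy-Littlewood maximal function M f, or the part of B(x',r) outside B(x,d(x)) lies in the
  crescent B(x',d(x')) \ B(x,d(x)).  So the theorem reduces to an L^p bound, linear in h, for the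
  positive operator T f(x) = d(x)^(alpha-n) * (integral of |f| over the crescent at x), uniformly in
  the direction of x' - x; a weak gradient is then a weak limit of difference quotients.

  T is treated by Schur's test with weights that are powers of |y - b| / d(x), where b is a nearest
  point of the complement to x.  The crescent has thickness about h |y - b| / d(x), which controls
  the integrals in y.  For the integrals in x, fix y: the x whose crescent contains y lie in
  (K - e) \ K for the convex set K of the points closer to y than to the complement, and the
  translates of this layer by multiples of e are disjoint.  This suffices for alpha > 1.  For
  alpha = 1 the sum over scales diverges logarithmically; it is rescued by |y - b|^2 <= C d(x) (d(y) + h)
  when the complement is convex or satisfies a curvature bound, and otherwise, if p > 1 + 1/n, by
  an angular weight |y - b| / |y - x| to a power greater than 1, integrated along rays from y.
*)

theory Submission
  imports Defs
begin

section \<open>The Hardy--Littlewood maximal function\<close>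

text \<open>The threshold 1 + 1/n is where the two halves of Schur's test cease to be compatible.
  With weight \<open>(|y - b| / d x) powr (- \<gamma>)\<close> and p' = p / (p - 1), the integral in
  y asks for \<open>\<gamma> p' < n\<close>, since the part of the crescent within r of b has
  measure about \<open>|e| r^n / d x\<close>; the argument along rays asks for
  \<open>\<gamma> p > 1\<close>. Both can be met exactly if n (p - 1) > 1. For tangential nearest
  points any \<gamma> > 0 serves in x, and a small one works for every p > 1.

  For fixed y, the x at distance about \<rho> from y fill a layer of measure about
  \<open>|e| \<rho>^(n-1)\<close>, against a kernel of size \<open>\<rho>^(\<alpha>-n)\<close>. At
  \<alpha> = 1 each dyadic scale contributes |e|, hence the logarithm; at \<alpha> > 1 the
  contributions are geometric and summed up to the diameter, hence the boundedness of \<Omega>.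

  Points within a fixed multiple of |e| of the complement are cut off, so that |e| is small against
  \<open>d x\<close> throughout; test functions have compact support in \<Omega>, so the cutoff is
  invisible in the limit.\<close>

definition hl_max :: "('a::euclidean_space \<Rightarrow> ennreal) \<Rightarrow> 'a \<Rightarrow> ennreal" where
  "hl_max g x = (SUP r\<in>{0<..}. (\<integral>\<^sup>+y\<in>ball x r. g y \<partial>lborel) / emeasure lborel (ball x r))"

lemma less_divide_iff_ennreal:
  fixes a b c :: ennreal
  assumes "b \<noteq> 0" "b < top"
  shows "c < a / b \<longleftrightarrow> c * b < a"
proof -
  have "a / b * b = a"
    using assms by (metis ennreal_mult_divide_eq ennreal_times_divide mult.commute order_less_irrefl)
  moreover have "c * b / b = c"
    using assms by (simp add: ennreal_mult_divide_eq)
  ultimately show ?thesis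
    by (metis divide_right_mono_ennreal linorder_not_less mult_right_mono zero_le)
qed

lemma sets_ball [measurable]: "ball x r \<in> sets (borel :: 'a::metric_space measure)"
  by simp

lemma sets_cball [measurable]: "cball x r \<in> sets (borel :: 'a::metric_space measure)"
  by simp

lemma emeasure_ball_pos:
  fixes x :: "'a::euclidean_space"
  assumes "r > 0"
  shows "emeasure lborel (ball x r) \<noteq> 0" "emeasure lborel (ball x r) < top"
proof -
  have "unit_ball_vol (real DIM('a)) * r ^ DIM('a) > 0" using assms by simp
  then show "emeasure lborel (ball x r) \<noteq> 0" "emeasure lborel (ball x r) < top"
    using assms by (simp_all only: emeasure_ball less_imp_le ennreal_eq_0_iff not_le ennreal_less_top)
qed

lemma less_hl_max_iff:
  fixes x :: "'a::euclidean_space"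
  shows "c < hl_max g x \<longleftrightarrow>
    (\<exists>r>0. c * emeasure lborel (ball x r) < (\<integral>\<^sup>+y\<in>ball x r. g y \<partial>lborel))"
  unfolding hl_max_def less_SUP_iff
  by (auto simp: less_divide_iff_ennreal emeasure_ball_pos)

text \<open>The inequality at x is strict, hence survives a slight enlargement of the radius, and
  the enlarged ball about a nearby centre contains the original one. This lower semicontinuity
  yields Borel measurability.\<close>

lemma open_less_hl_max:
  fixes g :: "'a::euclidean_space \<Rightarrow> ennreal"
  shows "open {x. c < hl_max g x}"
proof (subst open_dist, clarify)
  fix x :: 'a assume "c < hl_max g x"
  then obtain r where r: "r > 0" "c * emeasure lborel (ball x r) < (\<integral>\<^sup>+y\<in>ball x r. g y \<partial>lborel)"
    unfolding less_hl_max_iff by auto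
  have "c < top" using \<open>c < hl_max g x\<close> by (metis linorder_not_le top.extremum order_le_less_trans)
  then obtain c' where c': "c = ennreal c'" "c' \<ge> 0" by (metis ennreal_cases order_less_irrefl infinity_ennreal_def)
  let ?V = "\<lambda>s::real. c' * (unit_ball_vol (DIM('a)) * s ^ DIM('a))"
  have eq: "c * emeasure lborel (ball y s) = ennreal (?V s)" if "s > 0" for y :: 'a and s
    using that c' by (simp add: emeasure_ball ennreal_mult)
  have "((\<lambda>s. ennreal (?V s)) \<longlongrightarrow> ennreal (?V r)) (at_right r)"
    by (intro tendsto_intros tendsto_ennrealI)
  then have "\<forall>\<^sub>F s in at_right r. ennreal (?V s) < (\<integral>\<^sup>+y\<in>ball x r. g y \<partial>lborel)"
    by (rule order_tendstoD) (use r eq in simp)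
  then obtain b where b: "b > r" "\<And>s. r < s \<Longrightarrow> s < b \<Longrightarrow> ennreal (?V s) < (\<integral>\<^sup>+y\<in>ball x r. g y \<partial>lborel)"
    unfolding eventually_at_right_field by blast
  show "\<exists>e>0. \<forall>y. dist y x < e \<longrightarrow> y \<in> {x. c < hl_max g x}"
  proof (intro exI[of _ "(b - r) / 2"] conjI allI impI)
    fix y assume y: "dist y x < (b - r) / 2"
    let ?s = "r + (b - r) / 2"
    have "ball x r \<subseteq> ball y ?s" using y by (intro ball_subset_ball_iff[THEN iffD2]) (auto simp: dist_commute)
    then have "(\<integral>\<^sup>+y\<in>ball x r. g y \<partial>lborel) \<le> (\<integral>\<^sup>+y\<in>ball y ?s. g y \<partial>lborel)"
      by (intro nn_integral_mono) (auto simp: indicator_def)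
    moreover have "ennreal (?V ?s) < (\<integral>\<^sup>+y\<in>ball x r. g y \<partial>lborel)"
      using b by (intro b(2)) (auto simp: field_simps)
    moreover have s: "?s > 0" using r(1) b(1) by (simp add: field_simps)
    ultimately have "c * emeasure lborel (ball y ?s) < (\<integral>\<^sup>+y\<in>ball y ?s. g y \<partial>lborel)"
      unfolding eq[OF s] by (meson order_less_le_trans)
    then show "y \<in> {x. c < hl_max g x}"
      unfolding less_hl_max_iff using s by blast
  qed (use b in auto)
qed

lemma borel_measurable_hl_max [measurable]: "hl_max g \<in> borel_measurable borel"
  by (rule borel_measurableI_greater) (auto intro: borel_open open_less_hl_max)

text \<open>Continuity from below along an enumeration: the estimate after Vitali's selection then
  needs only finite sums of integrals.\<close>

lemma emeasure_UN_le_finite_subfamilies: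
  assumes "countable C" "\<And>i. i \<in> C \<Longrightarrow> A i \<in> sets M"
    and le: "\<And>F. finite F \<Longrightarrow> F \<subseteq> C \<Longrightarrow> emeasure M (\<Union>i\<in>F. A i) \<le> c"
  shows "emeasure M (\<Union>i\<in>C. A i) \<le> c"
proof (cases "C = {}")
  case False
  define B where "B k = (\<Union>i\<in>from_nat_into C ` {..k}. A i)" for k :: nat
  have sub: "from_nat_into C ` {..k} \<subseteq> C" for k
    using from_nat_into[OF False] by blast
  have "(\<Union>i\<in>C. A i) = (\<Union>i\<in>range (from_nat_into C). A i)"
    using range_from_nat_into[OF False assms(1)] by simp
  also have "\<dots> = (\<Union>k. B k)" unfolding B_def by blast
  finally have "emeasure M (\<Union>i\<in>C. A i) = (SUP k. emeasure M (B k))"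
    using sub assms(2)
  proof (subst SUP_emeasure_incseq)
    show "range B \<subseteq> sets M" unfolding B_def using sub assms(2) by (auto intro!: sets.finite_UN)
    show "incseq B" unfolding B_def incseq_def by (intro allI impI UN_mono image_mono) auto
  qed simp
  also have "\<dots> \<le> c" unfolding B_def using sub by (intro SUP_least le) auto
  finally show ?thesis .
qed simp

text \<open>Vitali's covering argument: the disjoint selected balls each carry more than t times
  their volume, and their fivefold enlargements cover the level set; hence
  \<open>5 ^ DIM('a)\<close>. If the integral of g is infinite the right-hand side is infinite, and
  if it is finite the radii are bounded, as the selection requires.\<close>

lemma hl_max_weak_type:
  fixes g :: "'a::euclidean_space \<Rightarrow> ennreal"
  assumes [measurable]: "g \<in> borel_measurable borel" and "t > 0"
  shows "ennreal t * emeasure lborel {x. ennreal t < hl_max g x} \<le> 5 ^ DIM('a) * (\<integral>\<^sup>+x. g x \<partial>lborel)"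
proof (cases "(\<integral>\<^sup>+x. g x \<partial>lborel) = top")
  case True
  then show ?thesis by (simp add: ennreal_mult_top)
next
  case False
  then obtain G where G: "(\<integral>\<^sup>+x. g x \<partial>lborel) = ennreal G" "G \<ge> 0"
    by (metis ennreal_cases infinity_ennreal_def)
  define K where "K = {(x::'a, r). r > 0 \<and> ennreal t * emeasure lborel (ball x r) < (\<integral>\<^sup>+y\<in>ball x r. g y \<partial>lborel)}"
  define w where "w = unit_ball_vol (real (DIM('a)))"
  have w: "w > 0" unfolding w_def by simp
  have cover: "{x. ennreal t < hl_max g x} \<subseteq> (\<Union>i\<in>K. ball (fst i) (snd i))"
    unfolding less_hl_max_iff K_def by force
  \<comment> \<open>A ball in \<open>K\<close> has volume less than G / t, and
    \<open>r \<le> r ^ DIM('a)\<close> as soon as r > 1.\<close>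
  have rad: "0 < snd i \<and> snd i \<le> max 1 (G / (t * w))" if iK: "i \<in> K" for i
  proof -
    obtain x r where i: "i = (x, r)" "r > 0" and
      I: "ennreal t * emeasure lborel (ball x r) < (\<integral>\<^sup>+y\<in>ball x r. g y \<partial>lborel)"
      using iK unfolding K_def by auto
    have "ennreal (t * (w * r ^ DIM('a))) < (\<integral>\<^sup>+y\<in>ball x r. g y \<partial>lborel)"
      using I \<open>t > 0\<close> i by (simp add: emeasure_ball w_def ennreal_mult)
    also have "\<dots> \<le> ennreal G"
      unfolding G(1)[symmetric] by (intro nn_integral_mono) (auto simp: indicator_def)
    finally have l: "t * (w * r ^ DIM('a)) < G" using G \<open>t > 0\<close> w i by (simp add: ennreal_less_iff)
    have "r \<le> max 1 (G / (t * w))"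
    proof (cases "r \<le> 1")
      case False
      then have "r \<le> r ^ DIM('a)" using self_le_power[of r "DIM('a)"] by simp
      also have "\<dots> \<le> G / (t * w)" using l \<open>t > 0\<close> w by (simp add: field_simps)
      finally show ?thesis by simp
    qed simp
    then show ?thesis using i by simp
  qed
  obtain C where C: "countable C" "C \<subseteq> K"
     "pairwise (\<lambda>i j. disjnt (ball (fst i) (snd i)) (ball (fst j) (snd j))) C"
     "{x. ennreal t < hl_max g x} \<subseteq> (\<Union>i\<in>C. ball (fst i) (5 * snd i))"
    by (rule Vitali_covering_lemma_balls[OF cover rad]) (assumption | rule that)+
  have "emeasure lborel (\<Union>i\<in>C. ball (fst i) (5 * snd i)) \<le> 5 ^ DIM('a) * (\<integral>\<^sup>+x. g x \<partial>lborel) / ennreal t"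
  proof (rule emeasure_UN_le_finite_subfamilies[OF C(1)])
    fix F assume F: "finite F" "F \<subseteq> C"
    have "ennreal t * emeasure lborel (\<Union>i\<in>F. ball (fst i) (5 * snd i)) \<le>
          ennreal t * (\<Sum>i\<in>F. emeasure lborel (ball (fst i) (5 * snd i)))"
      by (intro mult_left_mono emeasure_subadditive_finite F) auto
    also have "\<dots> = (\<Sum>i\<in>F. ennreal t * emeasure lborel (ball (fst i) (5 * snd i)))"
      by (simp add: sum_distrib_left)
    also have "\<dots> \<le> (\<Sum>i\<in>F. 5 ^ DIM('a) * (\<integral>\<^sup>+y\<in>ball (fst i) (snd i). g y \<partial>lborel))"
    proof (rule sum_mono)
      fix i assume "i \<in> F"
      then have i: "i \<in> K" using F C by auto
      then have pos: "snd i > 0" using rad by auto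
      have "ennreal t * emeasure lborel (ball (fst i) (5 * snd i)) =
            5 ^ DIM('a) * (ennreal t * emeasure lborel (ball (fst i) (snd i)))"
        using pos by (simp add: emeasure_ball power_mult_distrib ennreal_mult ennreal_power mult_ac
            flip: ennreal_numeral)
      also have "\<dots> \<le> 5 ^ DIM('a) * (\<integral>\<^sup>+y\<in>ball (fst i) (snd i). g y \<partial>lborel)"
        using i unfolding K_def by (intro mult_left_mono) (auto simp: less_imp_le)
      finally show "ennreal t * emeasure lborel (ball (fst i) (5 * snd i)) \<le> \<dots>" .
    qed
    also have "\<dots> = 5 ^ DIM('a) * (\<integral>\<^sup>+y. (\<Sum>i\<in>F. g y * indicator (ball (fst i) (snd i)) y) \<partial>lborel)"
    proof (subst nn_integral_sum)
      show "(\<lambda>y. g y * indicator (ball (fst i) (snd i)) y) \<in> borel_measurable lborel" for i :: "'a \<times> real"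
        by measurable
    qed (simp add: sum_distrib_left)
    also have "\<dots> \<le> 5 ^ DIM('a) * (\<integral>\<^sup>+y. g y \<partial>lborel)"
    proof (intro mult_left_mono nn_integral_mono)
      fix y
      have "(\<Sum>i\<in>F. indicator (ball (fst i) (snd i)) y :: ennreal) =
            indicator (\<Union>i\<in>F. ball (fst i) (snd i)) y"
      proof (intro indicator_UN_disjoint[symmetric] F(1))
        show "disjoint_family_on (\<lambda>i. ball (fst i) (snd i)) F"
          using F(2) C(3) unfolding disjoint_family_on_def pairwise_def disjnt_def by blast
      qed
      then have "(\<Sum>i\<in>F. g y * indicator (ball (fst i) (snd i)) y) =
            g y * indicator (\<Union>i\<in>F. ball (fst i) (snd i)) y"
        by (simp flip: sum_distrib_left)
      then show "(\<Sum>i\<in>F. g y * indicator (ball (fst i) (snd i)) y) \<le> g y"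
        by (auto simp: indicator_def)
    qed simp
    finally show "emeasure lborel (\<Union>i\<in>F. ball (fst i) (5 * snd i)) \<le> 5 ^ DIM('a) * (\<integral>\<^sup>+x. g x \<partial>lborel) / ennreal t"
      using less_divide_iff_ennreal[of "ennreal t"] \<open>t > 0\<close>
      by (metis ennreal_eq_0_iff ennreal_less_top linorder_not_le mult.commute ennreal_mult_divide_eq 
          divide_right_mono_ennreal less_irrefl order_less_imp_le)
  qed auto
  then have "emeasure lborel {x. ennreal t < hl_max g x} \<le> 5 ^ DIM('a) * (\<integral>\<^sup>+x. g x \<partial>lborel) / ennreal t"
    by (intro order_trans[OF emeasure_mono[OF C(4)]]) (simp_all add: borel_open open_UN)
  then have "ennreal t * emeasure lborel {x. ennreal t < hl_max g x} \<le>
      ennreal t * (5 ^ DIM('a) * (\<integral>\<^sup>+x. g x \<partial>lborel) / ennreal t)"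
    by (intro mult_left_mono) auto
  also have "\<dots> = 5 ^ DIM('a) * (\<integral>\<^sup>+x. g x \<partial>lborel)"
    using \<open>t > 0\<close> by (metis ennreal_mult_divide_eq ennreal_times_divide mult.commute ennreal_eq_0_iff ennreal_neq_top not_le)
  finally show ?thesis .
qed

text \<open>The part of g below t raises no average by more than t, so where \<open>hl_max g\<close>
  exceeds 2 t the maximal function of the part above t exceeds t. Only large values of g remain on
  the right, which makes the later integration over the levels t converge.\<close>

lemma hl_max_weak_type_truncated:
  fixes g :: "'a::euclidean_space \<Rightarrow> ennreal"
  assumes [measurable]: "g \<in> borel_measurable borel" and t: "t > 0"
  shows "ennreal t * emeasure lborel {x. ennreal (2 * t) < hl_max g x}
    \<le> 5 ^ DIM('a) * (\<integral>\<^sup>+x\<in>{x. ennreal t < g x}. g x \<partial>lborel)"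
proof -
  let ?g = "\<lambda>x. g x * indicator {x. ennreal t < g x} x"
  have "hl_max g x \<le> hl_max ?g x + ennreal t" for x
    unfolding hl_max_def
  proof (rule SUP_least)
    fix r :: real assume "r \<in> {0<..}"
    then have r: "r > 0" by simp
    note b = emeasure_ball_pos[OF r, of x]
    have "(\<integral>\<^sup>+y\<in>ball x r. g y \<partial>lborel) \<le> (\<integral>\<^sup>+y. ?g y * indicator (ball x r) y + ennreal t * indicator (ball x r) y \<partial>lborel)"
      by (intro nn_integral_mono) (auto simp: indicator_def)
    also have "\<dots> = (\<integral>\<^sup>+y\<in>ball x r. ?g y \<partial>lborel) + ennreal t * emeasure lborel (ball x r)"
    proof (subst nn_integral_add)

      have "(\<lambda>y. ?g y * indicator (ball x r) y) \<in> borel_measurable borel" by measurable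
      then show "(\<lambda>y. ?g y * indicator (ball x r) y) \<in> borel_measurable lborel" by simp
      show "(\<lambda>y. ennreal t * indicator (ball x r) y) \<in> borel_measurable lborel" by measurable
    qed (subst nn_integral_cmult_indicator, simp_all)
    finally have "(\<integral>\<^sup>+y\<in>ball x r. g y \<partial>lborel) / emeasure lborel (ball x r)
      \<le> ((\<integral>\<^sup>+y\<in>ball x r. ?g y \<partial>lborel) + ennreal t * emeasure lborel (ball x r)) / emeasure lborel (ball x r)"
      by (rule divide_right_mono_ennreal)
    also have "\<dots> = (\<integral>\<^sup>+y\<in>ball x r. ?g y \<partial>lborel) / emeasure lborel (ball x r) + ennreal t"
      using b by (simp add: add_divide_distrib_ennreal ennreal_mult_divide_eq)
    also have "\<dots> \<le> (SUP r\<in>{0<..}. (\<integral>\<^sup>+y\<in>ball x r. ?g y \<partial>lborel) / emeasure lborel (ball x r)) + ennreal t"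
      using r by (intro add_right_mono SUP_upper) auto
    finally show "(\<integral>\<^sup>+y\<in>ball x r. g y \<partial>lborel) / emeasure lborel (ball x r) \<le> \<dots>" .
  qed
  then have "{x. ennreal (2 * t) < hl_max g x} \<subseteq> {x. ennreal t < hl_max ?g x}"
  proof safe
    fix x assume *: "hl_max g x \<le> hl_max ?g x + ennreal t" for x
    assume "ennreal (2 * t) < hl_max g x"
    then have "ennreal t + ennreal t < hl_max ?g x + ennreal t"
      using *[of x] t by (metis ennreal_plus less_le_trans mult_2 less_imp_le)
    then show "ennreal t < hl_max ?g x" by (metis add_right_mono linorder_not_less)
  qed
  then have "ennreal t * emeasure lborel {x. ennreal (2 * t) < hl_max g x} \<le>
     ennreal t * emeasure lborel {x. ennreal t < hl_max ?g x}"
    by (intro mult_left_mono emeasure_mono) auto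
  also have "\<dots> \<le> 5 ^ DIM('a) * (\<integral>\<^sup>+x. ?g x \<partial>lborel)"
    by (rule hl_max_weak_type) (use t in auto)
  finally show ?thesis .
qed

lemma nn_integral_powr_from_0:
  assumes "a > -1" "c \<ge> 0"
  shows "(\<integral>\<^sup>+t. ennreal (t powr a * indicator {0..c} t) \<partial>lborel) = ennreal (c powr (a + 1) / (a + 1))"
proof (rule nn_integral_has_integral_lborel)
  have "((\<lambda>t. if t \<in> {0..c} then t powr a else 0) has_integral (c powr (a + 1) / (a + 1))) UNIV"
    using has_integral_powr_from_0[OF assms] by (subst has_integral_restrict_UNIV)
  then show "((\<lambda>t. t powr a * indicator {0..c} t) has_integral (c powr (a + 1) / (a + 1))) UNIV"
    by (rule has_integral_eq[rotated]) (auto simp: indicator_def)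
qed auto

text \<open>Marcinkiewicz interpolation by hand: p-th powers are written as integrals over levels t,
  the truncated weak estimate is inserted at each level, and Tonelli's theorem exchanges the
  integrals. The factor 1 / (p - 1) comes from integrating \<open>t powr (p - 2)\<close> over
  \<open>{0..4 * F x}\<close>.\<close>

lemma hl_max_strong_type:
  fixes F :: "'a::euclidean_space \<Rightarrow> real"
  assumes [measurable]: "F \<in> borel_measurable borel" and F: "\<And>x. F x \<ge> 0" and p: "p > 1"
    and fin: "(\<integral>\<^sup>+x. ennreal (F x powr p) \<partial>lborel) < \<infinity>"
  shows "AE x in lborel. hl_max (\<lambda>x. ennreal (F x)) x < \<infinity>"
    and "(\<integral>\<^sup>+x. ennreal (enn2real (hl_max (\<lambda>x. ennreal (F x)) x) powr p) \<partial>lborel) \<le>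
      ennreal (5 ^ DIM('a) * 4 powr p * p / (p - 1)) * (\<integral>\<^sup>+x. ennreal (F x powr p) \<partial>lborel)"
proof -
  let ?H = "hl_max (\<lambda>x. ennreal (F x))" let ?I = "\<integral>\<^sup>+x. ennreal (F x powr p) \<partial>lborel"
  define h where "h x = enn2real (?H x)" for x
  have [measurable]: "h \<in> borel_measurable borel" unfolding h_def by measurable
  have weak: "ennreal t * emeasure lborel {x. ennreal (2 * t) < ?H x}
    \<le> 5 ^ DIM('a) * (\<integral>\<^sup>+x. ennreal (F x * indicator {x. t < F x} x) \<partial>lborel)" if "t > 0" for t
  proof -
    have "ennreal (F x) * indicator {x. ennreal t < ennreal (F x)} x = ennreal (F x * indicator {x. t < F x} x)" for x
      using that by (auto simp: indicator_def ennreal_less_iff)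
    then show ?thesis using hl_max_weak_type_truncated[of "\<lambda>x. ennreal (F x)" t] that by simp
  qed
  show "AE x in lborel. ?H x < \<infinity>"
  proof -
    obtain I where I: "?I = ennreal I" "I \<ge> 0"
      using fin by (metis ennreal_cases infinity_ennreal_def order_less_irrefl)
    let ?N = "{x. ?H x = \<infinity>}"
    \<comment> \<open>A Chebyshev bound with p-th powers: where \<open>t < F x\<close> one has
      \<open>F x \<le> t powr (1 - p) * F x powr p\<close>. As t tends to infinity the bound tends
      to 0.\<close>
    have le: "emeasure lborel ?N \<le> ennreal (5 ^ DIM('a) * (I * t powr (- p)))" if t: "t > 0" for t
    proof -
      have "ennreal t * emeasure lborel ?N \<le> ennreal t * emeasure lborel {x. ennreal (2 * t) < ?H x}"
        by (intro mult_left_mono emeasure_mono) (auto simp: less_top[symmetric])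
      also have "\<dots> \<le> 5 ^ DIM('a) * (\<integral>\<^sup>+x. ennreal (F x * indicator {x. t < F x} x) \<partial>lborel)"
        by (rule weak[OF t])
      also have "\<dots> \<le> 5 ^ DIM('a) * (\<integral>\<^sup>+x. ennreal (t powr (1 - p)) * ennreal (F x powr p) \<partial>lborel)"
      proof (intro mult_left_mono nn_integral_mono)
        fix x
        have "F x \<le> t powr (1 - p) * F x powr p" if "t < F x"
        proof -
          have "F x = F x powr (1 - p) * F x powr p" using that t by (simp flip: powr_add)
          also have "\<dots> \<le> t powr (1 - p) * F x powr p"
            using that t p by (intro mult_right_mono powr_mono2') auto
          finally show ?thesis .
        qed
        then show "ennreal (F x * indicator {x. t < F x} x) \<le> ennreal (t powr (1 - p)) * ennreal (F x powr p)"
          by (auto simp: indicator_def ennreal_mult[symmetric] intro!: ennreal_leI)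
      qed simp
      also have "\<dots> = 5 ^ DIM('a) * (ennreal (t powr (1 - p)) * ennreal I)"
        by (simp add: nn_integral_cmult I)
      also have "\<dots> = ennreal t * ennreal (5 ^ DIM('a) * (I * t powr (- p)))"
      proof -
        have "t powr (1 - p) = t * t powr (- p)" using t by (simp add: powr_diff powr_minus_divide)
        then show ?thesis using t I
          by (simp add: ennreal_mult ennreal_power mult_ac flip: ennreal_numeral)
      qed
      finally show ?thesis using t by (subst (asm) ennreal_mult_le_mult_iff) auto
    qed
    have "((\<lambda>t. 5 ^ DIM('a) * (I * t powr (- p))) \<longlongrightarrow> 5 ^ DIM('a) * (I * 0)) at_top"
      using p by (intro tendsto_intros tendsto_neg_powr filterlim_ident) auto
    then have "((\<lambda>t. ennreal (5 ^ DIM('a) * (I * t powr (- p)))) \<longlongrightarrow> 0) at_top"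
      using tendsto_ennrealI by fastforce
    then have "emeasure lborel ?N \<le> 0"
      by (rule tendsto_lowerbound)
         (rule eventually_mono[OF eventually_gt_at_top[of 0]], rule le, simp_all)
    then have "?N \<in> null_sets lborel" by (auto simp: null_sets_def)
    then have "AE x in lborel. x \<notin> ?N" by (rule AE_not_in)
    then show ?thesis by eventually_elim (auto simp: less_top[symmetric])
  qed
  have pt: "ennreal (h x powr p) = (\<integral>\<^sup>+t. ennreal p * ennreal (t powr (p - 1) * indicator {0..h x} t) \<partial>lborel)" for x
    using p nn_integral_powr_from_0[of "p - 1" "h x"]
    by (subst nn_integral_cmult) (auto simp: h_def ennreal_mult[symmetric])
  have lev: "ennreal (t powr (p - 1)) * emeasure lborel {x. t \<le> h x} \<le>
     ennreal (4 * 5 ^ DIM('a)) * (\<integral>\<^sup>+x. ennreal (t powr (p - 2) * F x * indicator {0..4 * F x} t) \<partial>lborel)" if t: "t > 0" for t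
  proof -
    \<comment> \<open>The level t / 4 instead of t / 2 leaves room to pass from
      \<open>t \<le> h x\<close> to a strict inequality.\<close>
    have "ennreal (t / 4) * emeasure lborel {x. t \<le> h x} \<le> ennreal (t / 4) * emeasure lborel {x. ennreal (2 * (t / 4)) < ?H x}"
    proof (intro mult_left_mono emeasure_mono subsetI)
      fix x assume "x \<in> {x. t \<le> h x}"
      then have "t \<le> h x" by simp
      then have "ennreal (2 * (t / 4)) < ennreal (h x)" using t by (subst ennreal_less_iff) auto
      also have "\<dots> \<le> ?H x" unfolding h_def by (simp add: enn2real_le ennreal_enn2real_if)
      finally show "x \<in> {x. ennreal (2 * (t / 4)) < ?H x}" by simp
    qed auto
    also have "\<dots> \<le> 5 ^ DIM('a) * (\<integral>\<^sup>+x. ennreal (F x * indicator {x. t / 4 < F x} x) \<partial>lborel)"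
      using t by (intro weak) auto
    finally have 1: "ennreal (t / 4) * emeasure lborel {x. t \<le> h x} \<le> \<dots>" .
    have "ennreal (t powr (p - 1)) * emeasure lborel {x. t \<le> h x} =
       ennreal (4 * t powr (p - 2)) * (ennreal (t / 4) * emeasure lborel {x. t \<le> h x})"
    proof -
      have "t powr (p - 1) = 4 * t powr (p - 2) * (t / 4)"
        using t powr_add[of t "p - 2" 1] by simp
      then have "ennreal (t powr (p - 1)) = ennreal (4 * t powr (p - 2)) * ennreal (t / 4)"
        using t by (subst ennreal_mult[symmetric]) auto
      then show ?thesis by (simp only: mult.assoc)
    qed
    also have "\<dots> \<le> ennreal (4 * t powr (p - 2)) * (5 ^ DIM('a) * (\<integral>\<^sup>+x. ennreal (F x * indicator {x. t / 4 < F x} x) \<partial>lborel))"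
      by (rule mult_left_mono[OF 1]) simp
    also have "\<dots> = ennreal (4 * 5 ^ DIM('a)) * (\<integral>\<^sup>+x. ennreal (t powr (p - 2)) * ennreal (F x * indicator {x. t / 4 < F x} x) \<partial>lborel)"
      by (subst nn_integral_cmult) (auto simp: ennreal_mult ennreal_power mult_ac simp flip: ennreal_numeral)
    also have "\<dots> \<le> ennreal (4 * 5 ^ DIM('a)) * (\<integral>\<^sup>+x. ennreal (t powr (p - 2) * F x * indicator {0..4 * F x} t) \<partial>lborel)"
      using t F by (intro mult_left_mono nn_integral_mono)
        (auto simp: indicator_def ennreal_mult[symmetric])
    finally show ?thesis .
  qed
  have "(\<integral>\<^sup>+x. ennreal (h x powr p) \<partial>lborel) =
     (\<integral>\<^sup>+x. (\<integral>\<^sup>+t. ennreal p * ennreal (t powr (p - 1) * indicator {0..h x} t) \<partial>lborel) \<partial>lborel)"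
    unfolding pt ..
  also have "\<dots> = (\<integral>\<^sup>+t. (\<integral>\<^sup>+x. ennreal p * ennreal (t powr (p - 1) * indicator {0..h x} t) \<partial>lborel) \<partial>lborel)"
    by (subst lborel_pair.Fubini') (auto simp: indicator_def case_prod_unfold)
  also have "\<dots> \<le> (\<integral>\<^sup>+t. ennreal p * (ennreal (4 * 5 ^ DIM('a)) * (\<integral>\<^sup>+x. ennreal (t powr (p - 2) * F x * indicator {0..4 * F x} t) \<partial>lborel)) \<partial>lborel)"
  proof (rule nn_integral_mono)
    fix t :: real
    show "(\<integral>\<^sup>+x. ennreal p * ennreal (t powr (p - 1) * indicator {0..h x} t) \<partial>lborel) \<le>
      ennreal p * (ennreal (4 * 5 ^ DIM('a)) * (\<integral>\<^sup>+x. ennreal (t powr (p - 2) * F x * indicator {0..4 * F x} t) \<partial>lborel))"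
    proof (cases "t > 0")
      case True
      have "(\<integral>\<^sup>+x. ennreal p * ennreal (t powr (p - 1) * indicator {0..h x} t) \<partial>lborel) =
        (\<integral>\<^sup>+x. ennreal p * (ennreal (t powr (p - 1)) * indicator {x. t \<le> h x} x) \<partial>lborel)"
        using True by (intro nn_integral_cong) (auto simp: indicator_def)
      also have "\<dots> = ennreal p * (ennreal (t powr (p - 1)) * emeasure lborel {x. t \<le> h x})"
        by (simp add: nn_integral_cmult)
      also have "\<dots> \<le> ennreal p * (ennreal (4 * 5 ^ DIM('a)) * (\<integral>\<^sup>+x. ennreal (t powr (p - 2) * F x * indicator {0..4 * F x} t) \<partial>lborel))"
        by (intro mult_left_mono lev True) simp
      finally show ?thesis .
    next
      case False
      then have "t powr (p - 1) * indicator {0..h x} t = 0" for x using p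
        by (cases "t = 0") (auto simp: indicator_def)
      then show ?thesis by (simp only: ennreal_0 mult_zero_right nn_integral_const mult_zero_left zero_le)
    qed
  qed
  also have "\<dots> = ennreal p * (ennreal (4 * 5 ^ DIM('a)) * (\<integral>\<^sup>+t. (\<integral>\<^sup>+x. ennreal (t powr (p - 2) * F x * indicator {0..4 * F x} t) \<partial>lborel) \<partial>lborel))"
    by (subst nn_integral_cmult, (auto intro!: lborel.borel_measurable_nn_integral simp: indicator_def case_prod_unfold)[])+ simp
  also have "(\<integral>\<^sup>+t. (\<integral>\<^sup>+x. ennreal (t powr (p - 2) * F x * indicator {0..4 * F x} t) \<partial>lborel) \<partial>lborel) =
     (\<integral>\<^sup>+x. (\<integral>\<^sup>+t. ennreal (t powr (p - 2) * F x * indicator {0..4 * F x} t) \<partial>lborel) \<partial>lborel)"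
    by (subst lborel_pair.Fubini') (auto simp: indicator_def case_prod_unfold)
  also have "\<dots> = (\<integral>\<^sup>+x. ennreal (4 powr (p - 1) / (p - 1)) * ennreal (F x powr p) \<partial>lborel)"
  proof (rule nn_integral_cong)
    fix x
    have "(\<integral>\<^sup>+t. ennreal (t powr (p - 2) * F x * indicator {0..4 * F x} t) \<partial>lborel) =
       (\<integral>\<^sup>+t. ennreal (F x) * ennreal (t powr (p - 2) * indicator {0..4 * F x} t) \<partial>lborel)"
      using F by (intro nn_integral_cong) (auto simp: ennreal_mult[symmetric] indicator_def mult_ac)
    also have "\<dots> = ennreal (F x) * ennreal ((4 * F x) powr (p - 1) / (p - 1))"
      using p F nn_integral_powr_from_0[of "p - 2" "4 * F x"] by (subst nn_integral_cmult) auto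
    also have "\<dots> = ennreal (4 powr (p - 1) / (p - 1)) * ennreal (F x powr p)"
    proof -
      have "F x * (4 * F x) powr (p - 1) = 4 powr (p - 1) * F x powr p"
        using F[of x] p powr_add[of "F x" "p - 1" 1] by (auto simp: powr_mult)
      then show ?thesis using p F by (simp add: ennreal_mult[symmetric] divide_simps)
    qed
    finally show "(\<integral>\<^sup>+t. ennreal (t powr (p - 2) * F x * indicator {0..4 * F x} t) \<partial>lborel) = \<dots>" .
  qed
  also have "\<dots> = ennreal (4 powr (p - 1) / (p - 1)) * ?I"
    by (simp add: nn_integral_cmult)
  also have "ennreal p * (ennreal (4 * 5 ^ DIM('a)) * (ennreal (4 powr (p - 1) / (p - 1)) * ?I)) =
     ennreal (5 ^ DIM('a) * 4 powr p * p / (p - 1)) * ?I"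
  proof -
    have *: "p * ((4 * 5 ^ DIM('a)) * (4 powr (p - 1) / (p - 1))) = 5 ^ DIM('a) * 4 powr p * p / (p - 1)"
      using p by (simp add: powr_diff divide_simps)
    have "ennreal a * (ennreal b * (ennreal c * I)) = ennreal (a * (b * c)) * I"
      if "a \<ge> 0" "b \<ge> 0" "c \<ge> 0" for a b c I
      using that by (simp add: ennreal_mult mult.assoc)
    then show ?thesis using p by (subst *[symmetric]) simp
  qed
  finally show "(\<integral>\<^sup>+x. ennreal (enn2real (?H x) powr p) \<partial>lborel) \<le>
      ennreal (5 ^ DIM('a) * 4 powr p * p / (p - 1)) * ?I"
    unfolding h_def .
qed

section \<open>Weak compactness in Lebesgue spaces\<close>

text \<open>The growth of this convex function is slower than that of every power \<open>p > 1\<close>, while its second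
  derivative \<open>1 / sqrt (t\<^sup>2 + 1)\<close> decays so slowly that the midpoint defect controls the
  \<open>L\<^sup>1\<close> distance of functions bounded in \<open>L\<^sup>p\<close>. Minimising its integral over midpoint-closed sets
  therefore gives strongly convergent sequences for all \<open>p > 1\<close> at once.\<close>

definition llog :: "real \<Rightarrow> real" where
  "llog t = t * arsinh t - sqrt (t\<^sup>2 + 1)"

lemma sqrt_square_add_1_le: "sqrt (t\<^sup>2 + 1) \<le> 1 + \<bar>t\<bar>" for t :: real
  by (rule real_le_lsqrt) (auto simp: power2_eq_square algebra_simps)

text \<open>\<open>llog\<close> has second derivative \<open>1 / sqrt (t\<^sup>2 + 1)\<close>, which
  is at least 1 / (1 + N) on [-N, N]. So \<open>llog\<close> minus the parabola
  \<open>t\<^sup>2 / (2 * (1 + N))\<close> is still convex there, and the midpoint defect of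
  \<open>llog\<close> is at least that of the parabola.\<close>

lemma llog_midpoint:
  "(a - b)\<^sup>2 / (8 * (1 + \<bar>a\<bar> + \<bar>b\<bar>)) \<le> (llog a + llog b) / 2 - llog ((a + b) / 2)"
proof -
  define N where "N = \<bar>a\<bar> + \<bar>b\<bar>"
  define \<psi> where "\<psi> t = llog t - t\<^sup>2 / (2 * (1 + N))" for t
  have N: "N \<ge> 0" unfolding N_def by simp
  have pos: "t\<^sup>2 + 1 > 0" for t :: real by (simp add: add_nonneg_pos)
  have "convex_on {-N..N} \<psi>"
  proof (rule f''_ge0_imp_convex)
    show "DERIV \<psi> t :> arsinh t - t / (1 + N)" for t
      unfolding \<psi>_def llog_def using pos[of t] N
      by (auto intro!: derivative_eq_intros simp: divide_simps power2_eq_square) (simp add: algebra_simps)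
    show "DERIV (\<lambda>t. arsinh t - t / (1 + N)) t :> 1 / sqrt (t\<^sup>2 + 1) - 1 / (1 + N)" for t
      using N by (auto intro!: derivative_eq_intros)
    show "1 / sqrt (t\<^sup>2 + 1) - 1 / (1 + N) \<ge> 0" if "t \<in> {-N..N}" for t
    proof -
      have "sqrt (t\<^sup>2 + 1) \<le> 1 + N" using sqrt_square_add_1_le[of t] that by auto
      then show ?thesis using pos[of t] N by (simp add: frac_le)
    qed
  qed simp
  then have "\<psi> ((1 - 1/2) *\<^sub>R a + (1/2) *\<^sub>R b) \<le> (1 - 1/2) * \<psi> a + (1/2) * \<psi> b"
    by (rule convex_onD) (auto simp: N_def)
  then have "\<psi> ((a + b) / 2) \<le> (\<psi> a + \<psi> b) / 2" by (simp add: field_simps)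
  moreover have "a\<^sup>2 / (2 * (1 + N)) + b\<^sup>2 / (2 * (1 + N)) - 2 * (((a + b) / 2)\<^sup>2 / (2 * (1 + N))) = 2 * ((a - b)\<^sup>2 / (8 * (1 + N)))"
  proof -
    define c where "c = 1 / (1 + N)"
    have *: "u / (2 * (1 + N)) = c * u / 2" "u / (8 * (1 + N)) = c * u / 8" for u
      using N unfolding c_def by (simp_all add: field_simps)
    show ?thesis unfolding * by (simp add: power2_eq_square field_simps)
  qed
  ultimately have "(a - b)\<^sup>2 / (8 * (1 + N)) \<le> (llog a + llog b) / 2 - llog ((a + b) / 2)"
    unfolding \<psi>_def by argo
  then show ?thesis unfolding N_def by (simp add: add.assoc)
qed

text \<open>The quadratic quotient of \<open>llog_midpoint\<close> is linearised by the
  arithmetic-geometric mean inequality. On bounded sequences the first term is made small by \<eta>;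
  the second is a midpoint defect, small along minimising sequences.\<close>

lemma abs_diff_le_llog_midpoint:
  assumes "\<eta> > 0"
  shows "\<bar>a - b\<bar> \<le> \<eta> * (1 + \<bar>a\<bar> + \<bar>b\<bar>) + 2 / \<eta> * ((llog a + llog b) / 2 - llog ((a + b) / 2))"
proof -
  define D where "D = 1 + \<bar>a\<bar> + \<bar>b\<bar>"
  have D: "D > 0" unfolding D_def by simp
  have "0 \<le> (\<bar>a - b\<bar> - 2 * \<eta> * D)\<^sup>2" by simp
  then have "4 * \<eta> * D * \<bar>a - b\<bar> \<le> (a - b)\<^sup>2 + 4 * \<eta>\<^sup>2 * D\<^sup>2"
    by (simp add: power2_eq_square algebra_simps abs_mult_self_eq flip: abs_mult)
  then have "\<bar>a - b\<bar> \<le> \<eta> * D + 2 / \<eta> * ((a - b)\<^sup>2 / (8 * D))"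
    using D assms by (simp add: field_simps power2_eq_square)
  also have "\<dots> \<le> \<eta> * D + 2 / \<eta> * ((llog a + llog b) / 2 - llog ((a + b) / 2))"
    using llog_midpoint[of a b] assms unfolding D_def by (intro add_left_mono mult_left_mono) auto
  finally show ?thesis unfolding D_def .
qed

text \<open>A logarithm is dominated by every positive power, here the power p - 1. On a finite
  measure space an L^p bound therefore controls the integral of \<open>llog\<close>, for each p >
  1.\<close>

lemma abs_llog_le:
  assumes "p > 1"
  shows "\<bar>llog t\<bar> \<le> 3 powr p * (1 / (p - 1) + 1) * (1 + \<bar>t\<bar> powr p)"
proof -
  have ars: "\<bar>arsinh t\<bar> \<le> (1 + 2 * \<bar>t\<bar>) powr (p - 1) / (p - 1)"
  proof -
    have "\<bar>arsinh t\<bar> = arsinh \<bar>t\<bar>"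
      using arsinh_less_iff_real[of t 0] unfolding arsinh_0 by (cases "t < 0") (auto simp: abs_if)
    also have "\<dots> = ln (\<bar>t\<bar> + sqrt (t\<^sup>2 + 1))" by (simp add: arsinh_real_def)
    also have "\<dots> \<le> ln (1 + 2 * \<bar>t\<bar>)"
      using sqrt_square_add_1_le[of t] arsinh_real_aux[of "\<bar>t\<bar>"] by (intro ln_mono) auto
    also have "\<dots> \<le> (1 + 2 * \<bar>t\<bar>) powr (p - 1) / (p - 1)"
      using assms by (intro ln_powr_bound) auto
    finally show ?thesis .
  qed
  have "\<bar>llog t\<bar> \<le> \<bar>t\<bar> * \<bar>arsinh t\<bar> + sqrt (t\<^sup>2 + 1)"
    unfolding llog_def using abs_triangle_ineq4[of "t * arsinh t" "sqrt (t\<^sup>2 + 1)"] by (simp add: abs_mult)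
  also have "\<dots> \<le> (1 + 2 * \<bar>t\<bar>) * ((1 + 2 * \<bar>t\<bar>) powr (p - 1) / (p - 1)) + (1 + 2 * \<bar>t\<bar>) powr 1"
    using sqrt_square_add_1_le[of t] ars assms by (intro add_mono mult_mono) auto
  also have "\<dots> \<le> (1 + 2 * \<bar>t\<bar>) powr p / (p - 1) + (1 + 2 * \<bar>t\<bar>) powr p"
    using assms powr_add[of "1 + 2 * \<bar>t\<bar>" 1 "p - 1"] by (intro add_mono powr_mono) auto
  also have "\<dots> = (1 / (p - 1) + 1) * (1 + 2 * \<bar>t\<bar>) powr p" by (simp add: field_simps)
  also have "\<dots> \<le> (1 / (p - 1) + 1) * (3 powr p * (1 + \<bar>t\<bar> powr p))"
  proof (rule mult_left_mono)
    have "(1 + 2 * \<bar>t\<bar>) powr p \<le> (3 * max 1 \<bar>t\<bar>) powr p"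
      using assms by (intro powr_mono2) auto
    also have "\<dots> = 3 powr p * max 1 \<bar>t\<bar> powr p" by (simp add: powr_mult)
    also have "max 1 \<bar>t\<bar> powr p \<le> 1 + \<bar>t\<bar> powr p" by (auto simp: max_def)
    finally show "(1 + 2 * \<bar>t\<bar>) powr p \<le> 3 powr p * (1 + \<bar>t\<bar> powr p)" by simp
  qed (use assms in simp)
  finally show ?thesis by (simp add: mult_ac)
qed

lemma abs_le_1_plus_powr: "\<bar>t\<bar> \<le> 1 + \<bar>t\<bar> powr p" if "p > 1" for t p :: real
proof (cases "\<bar>t\<bar> \<le> 1")
  case False
  then have "\<bar>t\<bar> powr 1 \<le> \<bar>t\<bar> powr p" using that by (intro powr_mono) auto
  then show ?thesis using False by simp
qed (use powr_ge_zero[of "\<bar>t\<bar>" p] in linarith)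

text \<open>The projection argument of Hilbert space with \<open>llog\<close> in place of the
  square: the infima of its integral over the decreasing sets \<open>H k\<close> increase to a
  finite limit, and near-minimisers form a Cauchy sequence in L^1, because the midpoint of two of
  them cannot fall below the infimum. The limit h comes from an almost everywhere convergent
  subsequence, and Fatou's lemma gives the convergence in L^1.\<close>

lemma midpoint_closed_L1_convergent:
  fixes H :: "nat \<Rightarrow> ('a \<Rightarrow> real) set"
  assumes "finite_measure N" and p: "p > 1"
    and dec: "\<And>k m. k \<le> m \<Longrightarrow> H m \<subseteq> H k" and ne: "\<And>k. H k \<noteq> {}"
    and mid: "\<And>k a b. a \<in> H k \<Longrightarrow> b \<in> H k \<Longrightarrow> (\<lambda>x. (a x + b x) / 2) \<in> H k"
    and meas: "\<And>k a. a \<in> H k \<Longrightarrow> a \<in> borel_measurable N"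
    and bd: "\<And>k a. a \<in> H k \<Longrightarrow> (\<integral>\<^sup>+x. ennreal (\<bar>a x\<bar> powr p) \<partial>N) \<le> ennreal B" and "B \<ge> 0"
  obtains a h where "\<And>k. a k \<in> H k" "h \<in> borel_measurable N" "AE x in N. (\<lambda>k. a k x) \<longlonglongrightarrow> h x"
    "(\<lambda>k. \<integral>\<^sup>+x. ennreal \<bar>a k x - h x\<bar> \<partial>N) \<longlonglongrightarrow> 0"
proof -
  interpret finite_measure N by fact
  define \<mu> where "\<mu> = measure N (space N)"
  define C where "C = 3 powr p * (1 / (p - 1) + 1)"
  have C: "C \<ge> 0" unfolding C_def using p by simp
  have \<mu>: "\<mu> \<ge> 0" unfolding \<mu>_def by simp
  have pint: "integrable N (\<lambda>x. \<bar>a x\<bar> powr p)" "(LINT x|N. \<bar>a x\<bar> powr p) \<le> B" if "a \<in> H k" for a k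
  proof -
    have [measurable]: "a \<in> borel_measurable N" by (rule meas[OF that])
    show 1: "integrable N (\<lambda>x. \<bar>a x\<bar> powr p)"
      using bd[OF that] by (intro integrableI_bounded) (auto simp: le_less_trans)
    have "ennreal (LINT x|N. \<bar>a x\<bar> powr p) \<le> ennreal B"
      using bd[OF that] by (subst nn_integral_eq_integral[symmetric, OF 1]) auto
    then show "(LINT x|N. \<bar>a x\<bar> powr p) \<le> B" using \<open>B \<ge> 0\<close> by simp
  qed
  have lint: "integrable N (\<lambda>x. llog (a x))" "\<bar>LINT x|N. llog (a x)\<bar> \<le> C * (\<mu> + B)"
     and aint: "integrable N a" "(LINT x|N. \<bar>a x\<bar>) \<le> \<mu> + B" if "a \<in> H k" for a k
  proof -
    have [measurable]: "a \<in> borel_measurable N" by (rule meas[OF that])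
    have [measurable]: "llog \<in> borel_measurable borel"
      unfolding llog_def[abs_def] arsinh_real_def by measurable
    have i: "integrable N (\<lambda>x. C * (1 + \<bar>a x\<bar> powr p))" "integrable N (\<lambda>x. 1 + \<bar>a x\<bar> powr p)"
      using pint(1)[OF that] by auto
    have e: "(LINT x|N. 1 + \<bar>a x\<bar> powr p) = \<mu> + (LINT x|N. \<bar>a x\<bar> powr p)"
      using pint(1)[OF that] by (simp add: \<mu>_def)
    show l: "integrable N (\<lambda>x. llog (a x))"
      by (rule Bochner_Integration.integrable_bound[OF i(1)])
         (use abs_llog_le[OF p] C in \<open>auto simp: C_def[symmetric] abs_mult\<close>)
    have "\<bar>LINT x|N. llog (a x)\<bar> \<le> (LINT x|N. \<bar>llog (a x)\<bar>)" by simp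
    also have "\<dots> \<le> (LINT x|N. C * (1 + \<bar>a x\<bar> powr p))"
      using l i abs_llog_le[OF p] by (intro integral_mono) (auto simp: C_def)
    also have "\<dots> \<le> C * (\<mu> + B)" using e pint(2)[OF that] C by (simp add: mult_left_mono)
    finally show "\<bar>LINT x|N. llog (a x)\<bar> \<le> C * (\<mu> + B)" .
    show a: "integrable N a"
      by (rule Bochner_Integration.integrable_bound[OF i(2)]) (use abs_le_1_plus_powr[OF p] in auto)
    have "(LINT x|N. \<bar>a x\<bar>) \<le> (LINT x|N. 1 + \<bar>a x\<bar> powr p)"
      using a i abs_le_1_plus_powr[OF p] by (intro integral_mono) auto
    then show "(LINT x|N. \<bar>a x\<bar>) \<le> \<mu> + B" using e pint(2)[OF that] by simp
  qed
  define I where "I a = (LINT x|N. llog (a x))" for a :: "'a \<Rightarrow> real"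
  define d where "d k = (INF a\<in>H k. I a)" for k
  have bb: "bdd_below (I ` H k)" for k
    using lint(2) unfolding I_def by (intro bdd_belowI2[of _ "- (C * (\<mu> + B))"]) (force dest: abs_le_D2)
  have dle: "d k \<le> I a" if "a \<in> H k" for k a
    unfolding d_def by (rule cINF_lower[OF bb that])
  have "incseq d" unfolding incseq_def d_def
    by (intro allI impI cINF_superset_mono ne bb dec) auto
  moreover have "d k \<le> C * (\<mu> + B)" for k
  proof -
    obtain a where "a \<in> H k" using ne by auto
    then show ?thesis using dle[of a k] lint(2)[of a k] unfolding I_def by linarith
  qed
  ultimately obtain L where "d \<longlonglongrightarrow> L" by (metis incseq_convergent)
  then have cd: "Cauchy d" by (intro LIMSEQ_imp_Cauchy)
  have "\<exists>a. a \<in> H k \<and> I a < d k + 1 / real (Suc k)" for k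
    using cINF_less_iff[OF ne bb, of k "d k + 1 / real (Suc k)"] unfolding d_def[symmetric] by auto
  then obtain a where a: "\<And>k. a k \<in> H k" "\<And>k. I (a k) < d k + 1 / real (Suc k)" by metis
  define A where "A = \<mu> + 2 * (\<mu> + B) + 1"
  have A: "A > 0" unfolding A_def using \<mu> \<open>B \<ge> 0\<close> by simp
  \<comment> \<open>Since \<open>H m\<close> lies in \<open>H k\<close>, the two functions and their
    midpoint all belong to \<open>H k\<close>, where the integral is at least \<open>d k\<close>.
    The midpoint defect is thus controlled by \<open>d m - d k\<close> and the tolerances of the
    near-minimisers.\<close>
  have key: "(LINT x|N. \<bar>a k x - a m x\<bar>) \<le> \<eta> * A + 2 / \<eta> * ((d m - d k) / 2 + 1 / real (Suc k))"
    if "k \<le> m" "\<eta> > 0" for k m \<eta>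
  proof -
    let ?m = "\<lambda>x. (a k x + a m x) / 2"
    have am: "a m \<in> H k" using a(1) dec that by blast
    have mid': "?m \<in> H k" by (rule mid[OF a(1) am])
    note ii = lint(1)[OF a(1)[of k]] lint(1)[OF am] lint(1)[OF mid'] aint(1)[OF a(1)[of k]] aint(1)[OF am]
    have "(LINT x|N. \<bar>a k x - a m x\<bar>) \<le> (LINT x|N. \<eta> * (1 + \<bar>a k x\<bar> + \<bar>a m x\<bar>) + 2 / \<eta> * ((llog (a k x) + llog (a m x)) / 2 - llog (?m x)))"
      using ii abs_diff_le_llog_midpoint[OF \<open>\<eta> > 0\<close>] by (intro integral_mono) auto
    also have "\<dots> = \<eta> * (\<mu> + (LINT x|N. \<bar>a k x\<bar>) + (LINT x|N. \<bar>a m x\<bar>)) + 2 / \<eta> * ((I (a k) + I (a m)) / 2 - I ?m)"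
      using ii by (simp add: I_def \<mu>_def)
    also have "\<dots> \<le> \<eta> * A + 2 / \<eta> * ((d m - d k) / 2 + 1 / real (Suc k))"
    proof (intro add_mono mult_left_mono)
      show "\<mu> + (LINT x|N. \<bar>a k x\<bar>) + (LINT x|N. \<bar>a m x\<bar>) \<le> A"
        unfolding A_def using aint(2)[OF a(1)[of k]] aint(2)[OF am] by simp
      have "1 / real (Suc m) \<le> 1 / real (Suc k)" using that by (simp add: frac_le)
      then show "(I (a k) + I (a m)) / 2 - I ?m \<le> (d m - d k) / 2 + 1 / real (Suc k)"
        using a(2)[of k] a(2)[of m] dle[OF mid'] by argo
    qed (use that in auto)
    finally show ?thesis .
  qed
  have cauchy: "\<exists>M. \<forall>i\<ge>M. \<forall>j\<ge>M. (LINT x|N. norm (a i x - a j x)) < e" if "e > 0" for e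
  proof -
    define \<eta> where "\<eta> = e / (2 * A)"
    have \<eta>: "\<eta> > 0" "\<eta> * A = e / 2" using that A unfolding \<eta>_def by (auto simp: field_simps)
    define r where "r = e * \<eta> / 8"
    have r: "r > 0" unfolding r_def using that \<eta> by simp
    obtain M1 where M1: "\<And>i j. i \<ge> M1 \<Longrightarrow> j \<ge> M1 \<Longrightarrow> \<bar>d i - d j\<bar> < r"
      using cd r unfolding Cauchy_def dist_real_def by metis
    obtain M2 where M2: "1 / real (Suc M2) < r"
      using r nat_approx_posE by metis
    have le: "(LINT x|N. \<bar>a i x - a j x\<bar>) < e" if "i \<ge> max M1 M2" "i \<le> j" for i j
    proof -
      have "1 / real (Suc i) \<le> 1 / real (Suc M2)" using that by (simp add: frac_le)
      moreover have "\<bar>d j - d i\<bar> < r" using that by (intro M1) auto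
      then have "d j - d i < r" by simp
      ultimately have "(d j - d i) / 2 + 1 / real (Suc i) < 2 * r" using M2 r by argo
      then have "2 / \<eta> * ((d j - d i) / 2 + 1 / real (Suc i)) < 2 / \<eta> * (2 * r)"
        using \<eta> by (intro mult_strict_left_mono) auto
      also have "\<dots> = e / 2" unfolding r_def using \<eta> by (simp add: field_simps)
      finally show ?thesis using key[OF that(2) \<eta>(1)] \<eta>(2) by linarith
    qed
    show ?thesis
    proof (intro exI[of _ "max M1 M2"] allI impI)
      fix i j assume "i \<ge> max M1 M2" "j \<ge> max M1 M2"
      then show "(LINT x|N. norm (a i x - a j x)) < e"
        using le[of i j] le[of j i] by (cases "i \<le> j") (auto simp: abs_minus_commute)
    qed
  qed
  obtain r where r: "strict_mono r" "AE x in N. Cauchy (\<lambda>i. a (r i) x)"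
    by (rule cauchy_L1_AE_cauchy_subseq[of N a, OF aint(1)[OF a(1)] cauchy])
  define h where "h x = lim (\<lambda>i. a (r i) x)" for x
  have [measurable]: "a k \<in> borel_measurable N" for k by (rule meas[OF a(1)])
  have hm [measurable]: "h \<in> borel_measurable N" unfolding h_def by measurable
  have conv: "AE x in N. (\<lambda>i. a (r i) x) \<longlonglongrightarrow> h x"
    using r(2) by eventually_elim (auto simp: h_def Cauchy_convergent_iff convergent_LIMSEQ_iff)
  have "(\<lambda>k. \<integral>\<^sup>+x. ennreal \<bar>a (r k) x - h x\<bar> \<partial>N) \<longlonglongrightarrow> 0"
  proof (rule order_tendstoI)
    fix e :: ennreal assume "0 < e"
    then obtain d where d: "0 < d" "d < e" using dense by blast
    then have "d < top" using order_less_le_trans top_greatest by blast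
    define e' where "e' = enn2real d"
    have e': "e' > 0" "ennreal e' < e"
      using d \<open>d < top\<close> unfolding e'_def by (auto simp: enn2real_positive_iff)
    obtain M where M: "\<And>i j. i \<ge> M \<Longrightarrow> j \<ge> M \<Longrightarrow> (LINT x|N. norm (a i x - a j x)) < e'"
      using cauchy[OF e'(1)] by blast
    have "(\<integral>\<^sup>+x. ennreal \<bar>a (r k) x - h x\<bar> \<partial>N) < e" if "k \<ge> M" for k
    proof -
      have rk: "r j \<ge> M" if "j \<ge> M" for j using seq_suble[OF r(1), of j] that by simp
      have "(\<integral>\<^sup>+x. ennreal \<bar>a (r k) x - h x\<bar> \<partial>N) = (\<integral>\<^sup>+x. liminf (\<lambda>j. ennreal \<bar>a (r k) x - a (r j) x\<bar>) \<partial>N)"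
      proof (rule nn_integral_cong_AE, use conv in eventually_elim)
        case (elim x)
        then have "(\<lambda>j. ennreal \<bar>a (r k) x - a (r j) x\<bar>) \<longlonglongrightarrow> ennreal \<bar>a (r k) x - h x\<bar>"
          by (intro tendsto_intros tendsto_ennrealI)
        then show ?case by (rule lim_imp_Liminf[OF trivial_limit_sequentially, symmetric])
      qed
      also have "\<dots> \<le> liminf (\<lambda>j. \<integral>\<^sup>+x. ennreal \<bar>a (r k) x - a (r j) x\<bar> \<partial>N)"
        by (rule nn_integral_liminf) measurable
      also have "\<dots> \<le> ennreal e'"
      proof (rule Liminf_le)
        show "\<forall>\<^sub>F j in sequentially. (\<integral>\<^sup>+x. ennreal \<bar>a (r k) x - a (r j) x\<bar> \<partial>N) \<le> ennreal e'"
          unfolding eventually_sequentially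
        proof (intro exI[of _ M] allI impI)
          fix j assume "j \<ge> M"
          have "integrable N (\<lambda>x. \<bar>a (r k) x - a (r j) x\<bar>)"
            using aint(1)[OF a(1)] by auto
          then have "(\<integral>\<^sup>+x. ennreal \<bar>a (r k) x - a (r j) x\<bar> \<partial>N) = ennreal (LINT x|N. \<bar>a (r k) x - a (r j) x\<bar>)"
            by (intro nn_integral_eq_integral) auto
          also have "\<dots> \<le> ennreal e'" using M[OF rk rk, OF \<open>k \<ge> M\<close> \<open>j \<ge> M\<close>] by (intro ennreal_leI) auto
          finally show "(\<integral>\<^sup>+x. ennreal \<bar>a (r k) x - a (r j) x\<bar> \<partial>N) \<le> ennreal e'" .
        qed
      qed simp
      also have "\<dots> < e" by fact
      finally show ?thesis .
    qed
    then show "\<forall>\<^sub>F k in sequentially. (\<integral>\<^sup>+x. ennreal \<bar>a (r k) x - h x\<bar> \<partial>N) < e"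
      unfolding eventually_sequentially by blast
  qed simp
  moreover have "a (r k) \<in> H k" for k using a(1)[of "r k"] dec[of k "r k"] seq_suble[OF r(1), of k] by auto
  ultimately show ?thesis using that[of "\<lambda>k. a (r k)" h] hm conv by blast
qed

text \<open>Dyadic convex combinations of the tail from k on, as in Mazur's lemma. One binary rule
  is all that the minimisation needs, and convex bounds on the sequence pass to the hull by
  induction.\<close>

inductive_set mid_hull :: "(nat \<Rightarrow> 'a \<Rightarrow> real) \<Rightarrow> nat \<Rightarrow> ('a \<Rightarrow> real) set" for g k where
  base: "j \<ge> k \<Longrightarrow> g j \<in> mid_hull g k"
| mid: "a \<in> mid_hull g k \<Longrightarrow> b \<in> mid_hull g k \<Longrightarrow> (\<lambda>x. (a x + b x) / 2) \<in> mid_hull g k"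

lemma mid_hull_antimono: "k \<le> m \<Longrightarrow> mid_hull g m \<subseteq> mid_hull g k"
proof
  fix a assume "k \<le> m" "a \<in> mid_hull g m"
  from this(2,1) show "a \<in> mid_hull g k"
    by induction (auto intro: mid_hull.intros)
qed

lemma convex_on_powr_nonneg:
  assumes "p \<ge> 1"
  shows "convex_on {0..} (\<lambda>t::real. t powr p)"
proof (rule convex_onI)
  fix t x y :: real assume t: "0 < t" "t < 1" and xy: "x \<in> {0..}" "y \<in> {0..}"
  have 1: "(s * z) powr p \<le> s * z powr p" if "0 < s" "s < 1" "z \<ge> 0" for s z :: real
  proof -
    have "s powr p \<le> s powr 1" using that assms by (intro powr_mono') auto
    then show ?thesis using that by (simp add: powr_mult mult_right_mono)
  qed
  show "((1 - t) *\<^sub>R x + t *\<^sub>R y) powr p \<le> (1 - t) * x powr p + t * y powr p"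
  proof (cases "x = 0 \<or> y = 0")
    case True
    then show ?thesis using 1[of t y] 1[of "1 - t" x] t xy assms by auto
  next
    case False
    from convex_onD[OF powr_convex[OF assms], of t x y] show ?thesis using False xy t by auto
  qed
qed simp

lemma powr_abs_midpoint:
  fixes a b p :: real
  assumes "p \<ge> 1"
  shows "\<bar>(a + b) / 2\<bar> powr p \<le> (\<bar>a\<bar> powr p + \<bar>b\<bar> powr p) / 2"
proof -
  have "\<bar>(a + b) / 2\<bar> powr p \<le> ((1 - 1/2) *\<^sub>R \<bar>a\<bar> + (1/2) *\<^sub>R \<bar>b\<bar>) powr p"
    using assms by (intro powr_mono2) auto
  also have "\<dots> \<le> (1 - 1/2) * \<bar>a\<bar> powr p + (1/2) * \<bar>b\<bar> powr p"
    by (rule convex_onD[OF convex_on_powr_nonneg[OF assms]]) auto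
  finally show ?thesis by simp
qed

text \<open>No duality is used: repeated midpoints of the sequence converge almost everywhere and in
  L^1 of the finite measure w dx. Fatou's lemma preserves the bound B, and integration against a
  test function dominated by a multiple of w is continuous for that convergence. No subsequence has
  to be chosen either: the convergence of the integrals is presupposed for each test function and
  passes to the midpoints.\<close>

lemma Lp_weak_compactness:
  fixes g :: "nat \<Rightarrow> 'a::euclidean_space \<Rightarrow> real" and w :: "'a \<Rightarrow> real"
  assumes p: "p > 1" and [measurable]: "\<And>k. g k \<in> borel_measurable borel" and B: "B \<ge> 0"
    and bd: "\<And>k. (\<integral>\<^sup>+x. ennreal (\<bar>g k x\<bar> powr p) \<partial>lborel) \<le> ennreal B"
    and w: "integrable lborel w" "\<And>x. w x > 0" "\<And>x. w x \<le> 1"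
  obtains h where "h \<in> borel_measurable borel" "(\<integral>\<^sup>+x. ennreal (\<bar>h x\<bar> powr p) \<partial>lborel) \<le> ennreal B"
    "\<And>\<phi> c l. \<phi> \<in> borel_measurable borel \<Longrightarrow> (\<And>x. \<bar>\<phi> x\<bar> \<le> c * w x) \<Longrightarrow>
       (\<lambda>k. LINT x|lborel. g k x * \<phi> x) \<longlonglongrightarrow> l \<Longrightarrow> (LINT x|lborel. h x * \<phi> x) = l"
proof -
  have [measurable]: "w \<in> borel_measurable borel" using w(1) by auto
  define N where "N = density lborel (\<lambda>x. ennreal (w x))"
  have nnN: "(\<integral>\<^sup>+x. f x \<partial>N) = (\<integral>\<^sup>+x. ennreal (w x) * f x \<partial>lborel)" if "f \<in> borel_measurable borel" for f
    unfolding N_def using that by (subst nn_integral_density) auto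
  have fin: "finite_measure N"
  proof
    have "(\<integral>\<^sup>+x. ennreal (w x) \<partial>lborel) < top" using w by (simp add: integrable_iff_bounded less_imp_le)
    then show "emeasure N (space N) \<noteq> \<infinity>" unfolding N_def by (simp add: emeasure_density)
  qed
  have AEN: "(AE x in N. P x) \<longleftrightarrow> (AE x in lborel. P x)" for P
    unfolding N_def by (subst AE_density) (auto simp: w)
  have H: "a \<in> borel_measurable borel \<and> (\<integral>\<^sup>+x. ennreal (\<bar>a x\<bar> powr p) \<partial>lborel) \<le> ennreal B"
    if "a \<in> mid_hull g k" for a k
    using that
  proof induction
    case (mid a b)
    then have [measurable]: "a \<in> borel_measurable borel" "b \<in> borel_measurable borel" by auto
    have "(\<integral>\<^sup>+x. ennreal (\<bar>(a x + b x) / 2\<bar> powr p) \<partial>lborel) \<le>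
       (\<integral>\<^sup>+x. ennreal (1/2) * ennreal (\<bar>a x\<bar> powr p) + ennreal (1/2) * ennreal (\<bar>b x\<bar> powr p) \<partial>lborel)"
    proof (rule nn_integral_mono)
      fix x
      have "ennreal (\<bar>(a x + b x) / 2\<bar> powr p) \<le> ennreal (1/2 * \<bar>a x\<bar> powr p + 1/2 * \<bar>b x\<bar> powr p)"
        using p powr_abs_midpoint[of p "a x" "b x"] by (intro ennreal_leI) auto
      then show "ennreal (\<bar>(a x + b x) / 2\<bar> powr p) \<le> ennreal (1/2) * ennreal (\<bar>a x\<bar> powr p) + ennreal (1/2) * ennreal (\<bar>b x\<bar> powr p)"
        by (subst (asm) ennreal_plus, simp, simp, subst (asm) ennreal_mult, simp, simp, subst (asm) ennreal_mult) auto
    qed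
    also have "\<dots> = ennreal (1/2) * (\<integral>\<^sup>+x. ennreal (\<bar>a x\<bar> powr p) \<partial>lborel) + ennreal (1/2) * (\<integral>\<^sup>+x. ennreal (\<bar>b x\<bar> powr p) \<partial>lborel)"
      by (subst nn_integral_add) (auto simp: nn_integral_cmult)
    also have "\<dots> \<le> ennreal (1/2) * ennreal B + ennreal (1/2) * ennreal B"
      using mid by (intro add_mono mult_left_mono) auto
    also have "ennreal (1/2) * ennreal B = ennreal (1/2 * B)" using B by (intro ennreal_mult[symmetric]) auto
    also have "ennreal (1/2 * B) + ennreal (1/2 * B) = ennreal B"
      using B by (subst ennreal_plus[symmetric]) auto
    finally have "(\<integral>\<^sup>+x. ennreal (\<bar>(a x + b x) / 2\<bar> powr p) \<partial>lborel) \<le> ennreal B" .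
    moreover have "(\<lambda>x. (a x + b x) / 2) \<in> borel_measurable borel" by measurable
    ultimately show ?case by blast
  qed (use bd in auto)
  obtain a h where a: "\<And>k. a k \<in> mid_hull g k" and h: "h \<in> borel_measurable N" and
     conv: "AE x in N. (\<lambda>k. a k x) \<longlonglongrightarrow> h x" and L1: "(\<lambda>k. \<integral>\<^sup>+x. ennreal \<bar>a k x - h x\<bar> \<partial>N) \<longlonglongrightarrow> 0"
  proof (rule midpoint_closed_L1_convergent[OF fin p, of "mid_hull g" B])
    show "(\<integral>\<^sup>+x. ennreal (\<bar>a x\<bar> powr p) \<partial>N) \<le> ennreal B" if "a \<in> mid_hull g k" for a k
    proof -
      have [measurable]: "a \<in> borel_measurable borel" using H[OF that] by simp
      have "(\<integral>\<^sup>+x. ennreal (\<bar>a x\<bar> powr p) \<partial>N) = (\<integral>\<^sup>+x. ennreal (w x) * ennreal (\<bar>a x\<bar> powr p) \<partial>lborel)"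
        by (rule nnN) measurable
      also have "\<dots> \<le> (\<integral>\<^sup>+x. ennreal (\<bar>a x\<bar> powr p) \<partial>lborel)"
        using w by (intro nn_integral_mono) (auto simp: ennreal_mult[symmetric] less_imp_le intro!: ennreal_leI mult_left_le_one_le)
      finally show ?thesis using H[OF that] by auto
    qed
    show "a \<in> borel_measurable N" if "a \<in> mid_hull g k" for a k
      using H[OF that] by (simp add: N_def)
  qed (use B mid_hull_antimono in \<open>auto intro: mid_hull.intros\<close>, blast)
  have [measurable]: "h \<in> borel_measurable borel" using h by (simp add: N_def)
  have [measurable]: "a k \<in> borel_measurable borel" for k using H[OF a] by simp
  have hp: "(\<integral>\<^sup>+x. ennreal (\<bar>h x\<bar> powr p) \<partial>lborel) \<le> ennreal B"
  proof -
    have "(\<integral>\<^sup>+x. ennreal (\<bar>h x\<bar> powr p) \<partial>lborel) = (\<integral>\<^sup>+x. liminf (\<lambda>k. ennreal (\<bar>a k x\<bar> powr p)) \<partial>lborel)"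
    proof (rule nn_integral_cong_AE, use conv[unfolded AEN] in eventually_elim)
      case (elim x)
      then have "(\<lambda>k. ennreal (\<bar>a k x\<bar> powr p)) \<longlonglongrightarrow> ennreal (\<bar>h x\<bar> powr p)"
        using p by (intro tendsto_ennrealI tendsto_powr' tendsto_intros) auto
      then show ?case by (rule lim_imp_Liminf[OF trivial_limit_sequentially, symmetric])
    qed
    also have "\<dots> \<le> liminf (\<lambda>k. \<integral>\<^sup>+x. ennreal (\<bar>a k x\<bar> powr p) \<partial>lborel)"
      by (rule nn_integral_liminf) measurable
    also have "\<dots> \<le> ennreal B" using H[OF a] by (intro Liminf_le) auto
    finally show ?thesis .
  qed
  show ?thesis
  proof (rule that[of h])
    fix \<phi> :: "'a \<Rightarrow> real" and c l
    assume [measurable]: "\<phi> \<in> borel_measurable borel" and \<phi>: "\<And>x. \<bar>\<phi> x\<bar> \<le> c * w x"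
      and lim: "(\<lambda>k. LINT x|lborel. g k x * \<phi> x) \<longlonglongrightarrow> l"
    have "c \<ge> 0" using \<phi>[of 0] w(2)[of 0] by (smt (verit) mult_neg_pos)
    have int: "integrable lborel (\<lambda>x. f x * \<phi> x)"
      if [measurable]: "f \<in> borel_measurable borel" and "(\<integral>\<^sup>+x. ennreal (\<bar>f x\<bar> powr p) \<partial>lborel) \<le> ennreal B" for f
    proof (rule Bochner_Integration.integrable_bound)
      have "integrable lborel (\<lambda>x. \<bar>f x\<bar> powr p)"
        using that by (intro integrableI_bounded) (auto simp: le_less_trans)
      then show "integrable lborel (\<lambda>x. c * (w x + \<bar>f x\<bar> powr p))" using w by auto
      show "AE x in lborel. norm (f x * \<phi> x) \<le> norm (c * (w x + \<bar>f x\<bar> powr p))"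
      proof (rule AE_I2)
        fix x
        have "\<bar>f x * \<phi> x\<bar> \<le> (1 + \<bar>f x\<bar> powr p) * (c * w x)"
          unfolding abs_mult using abs_le_1_plus_powr[OF p] \<phi> by (intro mult_mono) auto
        also have "\<dots> = c * (w x + w x * \<bar>f x\<bar> powr p)" by (simp add: algebra_simps)
        also have "\<dots> \<le> c * (w x + 1 * \<bar>f x\<bar> powr p)"
          using \<open>c \<ge> 0\<close> w by (intro mult_left_mono add_left_mono mult_right_mono) auto
        finally show "norm (f x * \<phi> x) \<le> norm (c * (w x + \<bar>f x\<bar> powr p))" by simp
      qed
    qed measurable
    have intg: "integrable lborel (\<lambda>x. a x * \<phi> x)" if "a \<in> mid_hull g k" for a k
      using H[OF that] by (intro int) auto
    have "(\<lambda>k. LINT x|lborel. a k x * \<phi> x) \<longlonglongrightarrow> l"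
    proof (rule LIMSEQ_I)
      fix e :: real assume "e > 0"
      then obtain K where K: "\<And>k. k \<ge> K \<Longrightarrow> \<bar>(LINT x|lborel. g k x * \<phi> x) - l\<bar> < e"
        using LIMSEQ_D[OF lim] by auto
      \<comment> \<open>The functions whose integral against \<open>\<phi>\<close> lies within e of
        l are closed under midpoints, so a property of the tail of g holds on the whole hull of that
        tail.\<close>
      have hull: "\<bar>(LINT x|lborel. b x * \<phi> x) - l\<bar> < e" if "b \<in> mid_hull g K" for b
        using that
      proof induction
        case (mid a b)
        have "(LINT x|lborel. (a x + b x) / 2 * \<phi> x) = (LINT x|lborel. (a x * \<phi> x + b x * \<phi> x) / 2)"
          by (simp add: algebra_simps)
        also have "\<dots> = ((LINT x|lborel. a x * \<phi> x) + (LINT x|lborel. b x * \<phi> x)) / 2"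
          using intg[OF mid(1)] intg[OF mid(2)] by simp
        finally show ?case using mid by simp argo
      qed (rule K)
      then show "\<exists>K. \<forall>k\<ge>K. norm ((LINT x|lborel. a k x * \<phi> x) - l) < e"
        using a mid_hull_antimono by (metis real_norm_def subsetD)
    qed
    moreover have "(\<lambda>k. LINT x|lborel. a k x * \<phi> x) \<longlonglongrightarrow> (LINT x|lborel. h x * \<phi> x)"
    proof (rule Lim_null_comparison[THEN LIM_zero_cancel])
      have *: "ennreal (norm ((LINT x|lborel. a k x * \<phi> x) - (LINT x|lborel. h x * \<phi> x))) \<le>
         ennreal c * (\<integral>\<^sup>+x. ennreal \<bar>a k x - h x\<bar> \<partial>N)" for k
      proof -
        have i: "integrable lborel (\<lambda>x. a k x * \<phi> x)" "integrable lborel (\<lambda>x. h x * \<phi> x)"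
          using intg[OF a] hp by (auto intro!: int)
        then have "(LINT x|lborel. a k x * \<phi> x) - (LINT x|lborel. h x * \<phi> x) = (LINT x|lborel. a k x * \<phi> x - h x * \<phi> x)"
          by simp
        also have "ennreal (norm \<dots>) \<le> (\<integral>\<^sup>+x. ennreal (norm (a k x * \<phi> x - h x * \<phi> x)) \<partial>lborel)"
          using i by (intro integral_norm_bound_ennreal) auto
        also have "\<dots> \<le> (\<integral>\<^sup>+x. ennreal c * (ennreal (w x) * ennreal \<bar>a k x - h x\<bar>) \<partial>lborel)"
        proof (rule nn_integral_mono)
          fix x
          have "norm (a k x * \<phi> x - h x * \<phi> x) = \<bar>a k x - h x\<bar> * \<bar>\<phi> x\<bar>"
            by (simp add: abs_mult[symmetric] algebra_simps)
          also have "\<dots> \<le> \<bar>a k x - h x\<bar> * (c * w x)" by (intro mult_left_mono \<phi>) auto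
          finally show "ennreal (norm (a k x * \<phi> x - h x * \<phi> x)) \<le> ennreal c * (ennreal (w x) * ennreal \<bar>a k x - h x\<bar>)"
            using \<open>c \<ge> 0\<close> w by (simp add: ennreal_mult[symmetric] less_imp_le mult_ac ennreal_leI)
        qed
        also have "\<dots> = ennreal c * (\<integral>\<^sup>+x. ennreal \<bar>a k x - h x\<bar> \<partial>N)"
          by (subst nnN) (auto simp: nn_integral_cmult)
        finally show ?thesis .
      qed
      have "(\<lambda>k. ennreal c * (\<integral>\<^sup>+x. ennreal \<bar>a k x - h x\<bar> \<partial>N)) \<longlonglongrightarrow> ennreal c * 0"
        by (intro ennreal_tendsto_cmult L1) auto
      then have c0: "(\<lambda>k. ennreal c * (\<integral>\<^sup>+x. ennreal \<bar>a k x - h x\<bar> \<partial>N)) \<longlonglongrightarrow> ennreal 0" by simp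
      have "(\<lambda>k. ennreal (norm ((LINT x|lborel. a k x * \<phi> x) - (LINT x|lborel. h x * \<phi> x)))) \<longlonglongrightarrow> ennreal 0"
        by (rule tendsto_sandwich[OF always_eventually always_eventually tendsto_const c0]) (simp, intro allI *)
      then show "(\<lambda>k. norm ((LINT x|lborel. a k x * \<phi> x) - (LINT x|lborel. h x * \<phi> x))) \<longlonglongrightarrow> 0"
        by (subst (asm) tendsto_ennreal_iff) simp_all
    qed (rule always_eventually, simp)
    ultimately show "(LINT x|lborel. h x * \<phi> x) = l" by (rule LIMSEQ_unique[THEN sym])
  qed (fact+)
qed

section \<open>Packing and dyadic estimates\<close>

lemma emeasure_packing:
  assumes "\<And>k. k < m \<Longrightarrow> A k \<in> sets M" "\<And>k. k < m \<Longrightarrow> A k \<subseteq> V" "V \<in> sets M"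
    and "disjoint_family_on A {..<m}" "\<And>k. k < m \<Longrightarrow> c \<le> emeasure M (A k)"
  shows "of_nat m * c \<le> emeasure M V"
proof -
  have "of_nat m * c = (\<Sum>k<m. c)" by simp
  also have "\<dots> \<le> (\<Sum>k<m. emeasure M (A k))" by (intro sum_mono assms(5)) auto
  also have "\<dots> = emeasure M (\<Union>k<m. A k)"
    using assms by (intro sum_emeasure) auto
  also have "\<dots> \<le> emeasure M V" using assms by (intro emeasure_mono) auto
  finally show ?thesis .
qed

lemma emeasure_le_of_packing:
  fixes E :: "'a::euclidean_space set" and y :: 'a
  assumes "of_nat m * emeasure lborel E \<le> emeasure lborel (ball y (2 * \<rho>))" "\<rho> > 0" "real m \<ge> \<rho> / s" "s > 0"
  shows "emeasure lborel E \<le> ennreal (unit_ball_vol DIM('a) * 2 ^ DIM('a) * s * \<rho> powr (real DIM('a) - 1))"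
proof -
  have m: "real m > 0" using assms(2-4) by (meson divide_pos_pos less_le_trans)
  have "ennreal (\<rho> / s) * emeasure lborel E \<le> of_nat m * emeasure lborel E"
    using assms(3) by (intro mult_right_mono) (auto simp: ennreal_of_nat_eq_real_of_nat intro!: ennreal_leI)
  also have "\<dots> \<le> ennreal (unit_ball_vol DIM('a) * (2 * \<rho>) ^ DIM('a))"
    using assms by (simp add: emeasure_ball)
  finally have "ennreal (s / \<rho>) * (ennreal (\<rho> / s) * emeasure lborel E) \<le> ennreal (s / \<rho>) * ennreal (unit_ball_vol DIM('a) * (2 * \<rho>) ^ DIM('a))"
    by (rule mult_left_mono) simp
  moreover have "ennreal (s / \<rho>) * (ennreal (\<rho> / s) * emeasure lborel E) = emeasure lborel E"
    using assms by (simp add: mult.assoc[symmetric] ennreal_mult[symmetric])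
  moreover have "ennreal (s / \<rho>) * ennreal (unit_ball_vol DIM('a) * (2 * \<rho>) ^ DIM('a)) =
     ennreal (unit_ball_vol DIM('a) * 2 ^ DIM('a) * s * \<rho> powr (real DIM('a) - 1))"
    using assms by (simp add: ennreal_mult[symmetric] powr_diff powr_realpow power_mult_distrib field_simps)
  ultimately show ?thesis by simp
qed

lemma emeasure_lborel_translate:
  fixes E :: "'a::euclidean_space set"
  assumes "E \<in> sets borel"
  shows "emeasure lborel {x. c + x \<in> E} = emeasure lborel E"
proof -
  have "emeasure lborel E = emeasure (distr lborel borel ((+) c)) E" by (simp add: lborel_distr_plus)
  also have "\<dots> = emeasure lborel {x. c + x \<in> E}"
    using assms by (subst emeasure_distr) (auto simp: vimage_def)
  finally show ?thesis ..
qed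

lemma emeasure_lborel_dilate_ge:
  fixes E :: "'a::euclidean_space set"
  assumes "E \<in> sets borel" "\<mu> \<ge> 1"
  shows "emeasure lborel E \<le> emeasure lborel {z. t + (1 / \<mu>) *\<^sub>R z \<in> E}"
proof -
  have m [measurable]: "E \<in> sets borel" by fact
  have "emeasure lborel E = emeasure (density (distr lborel borel (\<lambda>x. t + (1 / \<mu>) *\<^sub>R x)) (\<lambda>_. \<bar>1 / \<mu>\<bar> ^ DIM('a))) E"
    using assms by (subst lborel_affine[of "1 / \<mu>" t]) auto
  also have "\<dots> = ennreal (\<bar>1 / \<mu>\<bar> ^ DIM('a)) * emeasure lborel {z. t + (1 / \<mu>) *\<^sub>R z \<in> E}"
    by (subst emeasure_density) (auto simp: nn_integral_cmult emeasure_distr vimage_def)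
  also have "\<dots> \<le> 1 * emeasure lborel {z. t + (1 / \<mu>) *\<^sub>R z \<in> E}"
    using assms by (intro mult_right_mono) (auto simp: power_le_one)
  finally show ?thesis by simp
qed

text \<open>The translates of the layer by multiples of \<open>e\<close> are disjoint, since a line meets a convex
  set in an interval.\<close>

lemma emeasure_convex_layer_le:
  fixes E K :: "'a::euclidean_space set"
  assumes "convex K" and E: "E \<in> sets borel" "E \<subseteq> cball y \<rho>" "\<And>x. x \<in> E \<Longrightarrow> x \<notin> K \<and> x + e \<in> K"
    and e: "norm e > 0" "norm e \<le> \<rho>"
  shows "emeasure lborel E \<le> ennreal (unit_ball_vol DIM('a) * 2 ^ (DIM('a) + 1) * norm e * \<rho> powr (real DIM('a) - 1))"
proof -
  \<comment> \<open>Fewer than m translations by e move a point by less than \<rho>, so all copies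
    stay in the ball of radius 2 \<rho>. Rounding down costs a factor 2, because
    \<open>\<rho> / norm e \<ge> 1\<close>.\<close>
  define m where "m = nat \<lfloor>\<rho> / norm e\<rfloor>"
  define A where "A k = {x. - (real k *\<^sub>R e) + x \<in> E}" for k :: nat
  have q: "\<rho> / norm e \<ge> 1" using e by simp
  then have m: "real m \<le> \<rho> / norm e" "real m \<ge> \<rho> / norm e - 1" "m \<ge> 1" unfolding m_def by linarith+
  have disj: False if "x \<in> A i" "x \<in> A j" "i < j" for x i j
  proof -
    define u l where "u = - (real i *\<^sub>R e) + x" and "l = real (j - i)"
    have l: "l \<ge> 1" "real j = real i + l" using that unfolding l_def by auto
    have "u \<in> E" "u - l *\<^sub>R e \<in> E" using that l unfolding A_def u_def by (auto simp: algebra_simps)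
    then have K: "u \<notin> K" "u + e \<in> K" "u - l *\<^sub>R e + e \<in> K" using E by auto
    \<comment> \<open>The point u, which is outside K, would be a convex combination of two points
      of K; \<open>l \<ge> 1\<close> makes 1 / l an admissible weight.\<close>
    have "(1 - 1 / l) *\<^sub>R (u + e) + (1 / l) *\<^sub>R (u - l *\<^sub>R e + e) = u"
      using l by (simp add: algebra_simps scaleR_diff_left)
    moreover have "(1 - 1 / l) *\<^sub>R (u + e) + (1 / l) *\<^sub>R (u - l *\<^sub>R e + e) \<in> K"
      using convexD_alt[OF \<open>convex K\<close> K(2,3), of "1 / l"] l by simp
    ultimately show False using K by simp
  qed
  have "of_nat m * emeasure lborel E \<le> emeasure lborel (ball y (2 * \<rho>))"
  proof (rule emeasure_packing[where A = A])
    show "A k \<in> sets lborel" for k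
      unfolding A_def using E(1) by measurable
    show "emeasure lborel E \<le> emeasure lborel (A k)" for k
      unfolding A_def emeasure_lborel_translate[OF E(1)] ..
    show "disjoint_family_on A {..<m}"
      unfolding disjoint_family_on_def using disj by (metis disjoint_iff linorder_neqE_nat)
    show "A k \<subseteq> ball y (2 * \<rho>)" if "k < m" for k
    proof
      fix x assume "x \<in> A k"
      then have "dist y (x - real k *\<^sub>R e) \<le> \<rho>" using E(2) unfolding A_def by auto
      moreover have "dist (x - real k *\<^sub>R e) x < \<rho>"
      proof -
        have "real k * norm e < real m * norm e" using that e by simp
        also have "\<dots> \<le> \<rho>" using m(1) e by (simp add: field_simps)
        finally show ?thesis by (simp add: dist_norm)
      qed
      ultimately show "x \<in> ball y (2 * \<rho>)" using dist_triangle[of y x "x - real k *\<^sub>R e"] by simp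
    qed
  qed auto
  moreover have "real m \<ge> \<rho> / (2 * norm e)"
    using m q by (simp add: field_simps)
  ultimately have "emeasure lborel E \<le> ennreal (unit_ball_vol DIM('a) * 2 ^ DIM('a) * (2 * norm e) * \<rho> powr (real DIM('a) - 1))"
    using e by (intro emeasure_le_of_packing[of m _ y]) (assumption | linarith)+
  then show ?thesis by (simp add: mult_ac)
qed

text \<open>The same packing argument with dilations about the centre of the shell.\<close>

lemma emeasure_shell_piece_le:
  fixes E :: "'a::euclidean_space set"
  assumes E: "E \<in> sets borel" "E \<subseteq> cball b \<rho>" "\<And>y. y \<in> E \<Longrightarrow> \<delta> \<le> dist y x \<and> dist y x < \<delta> + \<tau>"
    and r: "0 < \<tau>" "\<tau> \<le> \<delta>" "0 < \<rho>" "\<rho> \<le> 3 * \<delta>"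
  shows "emeasure lborel E \<le> ennreal (unit_ball_vol DIM('a) * 2 ^ DIM('a) * (6 * \<tau>) * \<rho> powr (real DIM('a) - 1))"
proof -
  \<comment> \<open>The factor 6 serves twice: together with
    \<open>\<rho> \<le> 3 * \<delta>\<close> it keeps every dilation factor \<open>\<mu> k\<close>
    at most 2, and it keeps the displacement, at most 4 k \<tau>, below \<rho>. The added 1 gives
    \<open>m \<ge> \<rho> / (6 * \<tau>)\<close>, while k < m still implies that k is at most this
    quotient.\<close>
  define m where "m = nat \<lfloor>\<rho> / (6 * \<tau>)\<rfloor> + 1"
  \<comment> \<open>Dilation by a factor at most 2 sends the shell of width \<tau> at radius
    \<delta> into the shell of width 2 \<tau> at radius \<delta> + 2 k \<tau>. These shells are
    disjoint for different k.\<close>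
  define \<mu> where "\<mu> k = 1 + 2 * real k * \<tau> / \<delta>" for k :: nat
  define A where "A k = {z. (x - (1 / \<mu> k) *\<^sub>R x) + (1 / \<mu> k) *\<^sub>R z \<in> E}" for k :: nat
  have \<mu>1: "\<mu> k \<ge> 1" for k unfolding \<mu>_def using r by simp
  have q: "\<rho> / (6 * \<tau>) > 0" using r by simp
  then have m: "real m \<ge> \<rho> / (6 * \<tau>)" and mk: "k < m \<Longrightarrow> real k \<le> \<rho> / (6 * \<tau>)" for k
    unfolding m_def by linarith+
  have Ak: "\<exists>y\<in>E. z - x = \<mu> k *\<^sub>R (y - x)" if "z \<in> A k" for z k
    using that \<mu>1[of k] unfolding A_def by (intro bexI[of _ "(x - (1 / \<mu> k) *\<^sub>R x) + (1 / \<mu> k) *\<^sub>R z"])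
      (auto simp: algebra_simps)
  have rad: "\<delta> + 2 * real k * \<tau> \<le> dist z x \<and> dist z x < \<delta> + 2 * (real k + 1) * \<tau> \<and> dist b z < 2 * \<rho>"
    if k: "k < m" and z: "z \<in> A k" for k z
  proof -
    obtain y where y: "y \<in> E" "z - x = \<mu> k *\<^sub>R (y - x)" using Ak[OF z] by auto
    have dz: "dist z x = \<mu> k * dist y x" using y(2) \<mu>1[of k] by (simp add: dist_norm)
    have kt: "real k * \<tau> \<le> \<rho> / 6" using mk[OF k] r by (simp add: field_simps)
    then have k1: "2 * real k * \<tau> / \<delta> \<le> 1" using r by (simp add: field_simps)
    have b: "\<delta> \<le> dist y x" "dist y x < \<delta> + \<tau>" "dist b y \<le> \<rho>" using E y by auto
    have "\<mu> k * \<delta> = \<delta> + 2 * real k * \<tau>" unfolding \<mu>_def using r by (simp add: field_simps)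
    then have 1: "\<delta> + 2 * real k * \<tau> \<le> dist z x" unfolding dz using b \<mu>1[of k] by (metis mult_left_mono order_trans zero_le_one)
    have "dist z x < \<mu> k * (\<delta> + \<tau>)" unfolding dz using b \<mu>1[of k] by (intro mult_strict_left_mono) auto
    also have "\<dots> = \<delta> + 2 * real k * \<tau> + \<tau> + (2 * real k * \<tau> / \<delta>) * \<tau>"
      unfolding \<mu>_def using r by (simp add: field_simps)
    also have "\<dots> \<le> \<delta> + 2 * real k * \<tau> + \<tau> + 1 * \<tau>" using k1 r by (intro add_left_mono mult_right_mono) auto
    finally have 2: "dist z x < \<delta> + 2 * (real k + 1) * \<tau>" by (simp add: algebra_simps)
    have "z - y = (\<mu> k - 1) *\<^sub>R (y - x)" using y(2) by (simp add: algebra_simps)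
    then have "dist z y = (\<mu> k - 1) * dist y x" using \<mu>1[of k] by (simp add: dist_norm)
    then have "dist y z = (\<mu> k - 1) * dist y x" by (simp add: dist_commute)
    also have "\<dots> \<le> (2 * real k * \<tau> / \<delta>) * (2 * \<delta>)"
      unfolding \<mu>_def using b r by (intro mult_mono) auto
    also have "\<dots> = 4 * (real k * \<tau>)" using r by (simp add: field_simps)
    also have "\<dots> < \<rho>" using kt r by linarith
    finally have "dist b z < 2 * \<rho>" using b(3) dist_triangle[of b z y] by simp
    then show ?thesis using 1 2 by simp
  qed
  have "of_nat m * emeasure lborel E \<le> emeasure lborel (ball b (2 * \<rho>))"
  proof (rule emeasure_packing[where A = A])
    show "A k \<in> sets lborel" for k
      unfolding A_def using E(1) by measurable
    show "emeasure lborel E \<le> emeasure lborel (A k)" for k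
      unfolding A_def by (rule emeasure_lborel_dilate_ge[OF E(1) \<mu>1])
    show "A k \<subseteq> ball b (2 * \<rho>)" if "k < m" for k using rad[OF that] by auto
    have "False" if "i < j" "j < m" "z \<in> A i" "z \<in> A j" for i j z
    proof -
      have "\<delta> + 2 * real j * \<tau> < \<delta> + 2 * (real i + 1) * \<tau>"
        using rad[of i z] rad[of j z] that by fastforce
      moreover have "2 * (real i + 1) * \<tau> \<le> 2 * real j * \<tau>" using that r by (intro mult_right_mono) auto
      ultimately show False by simp
    qed
    then show "disjoint_family_on A {..<m}"
      unfolding disjoint_family_on_def by (metis disjoint_iff linorder_neqE_nat lessThan_iff)
  qed auto
  then show ?thesis using m r by (intro emeasure_le_of_packing[of m]) auto
qed

section \<open>Dyadic sums of power weights\<close>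

lemma suminf_powr_neg:
  assumes "c > 0"
  shows "summable (\<lambda>j. 2 powr (- c * real j))" "(\<Sum>j. 2 powr (- c * real j)) = 1 / (1 - 2 powr (- c))"
proof -
  have e: "2 powr (- c * real j) = (2 powr (- c)) ^ j" for j
    by (simp add: powr_powr flip: powr_realpow)
  have "norm (2 powr (- c)) < 1" using assms powr_less_mono[of "- c" 0 2] by simp
  then show "summable (\<lambda>j. 2 powr (- c * real j))" "(\<Sum>j. 2 powr (- c * real j)) = 1 / (1 - 2 powr (- c))"
    unfolding e by (auto intro: summable_geometric suminf_geometric)
qed

text \<open>The common last step of the dyadic arguments: weight times measure of the j-th set is a
  term of a geometric series.\<close>

lemma nn_integral_le_suminf:
  assumes [measurable]: "\<And>j. E j \<in> sets M"
    and le: "\<And>x. f x \<le> (\<Sum>j. ennreal (c j) * indicator (E j) x)"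
    and c: "\<And>j. c j \<ge> 0" and d: "\<And>j. d j \<ge> 0" "\<And>j. emeasure M (E j) \<le> ennreal (d j)"
    and cd: "\<And>j. c j * d j = A * 2 powr (- s * real j)" "s > 0" "A \<ge> 0"
  shows "(\<integral>\<^sup>+x. f x \<partial>M) \<le> ennreal (A / (1 - 2 powr (- s)))"
proof -
  have "(\<integral>\<^sup>+x. f x \<partial>M) \<le> (\<integral>\<^sup>+x. (\<Sum>j. ennreal (c j) * indicator (E j) x) \<partial>M)"
    by (intro nn_integral_mono le)
  also have "\<dots> = (\<Sum>j. ennreal (c j) * emeasure M (E j))"
    by (subst nn_integral_suminf) (auto simp: nn_integral_cmult)
  also have "\<dots> \<le> (\<Sum>j. ennreal (A * 2 powr (- s * real j)))"
  proof (rule suminf_le)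
    fix j
    have "ennreal (c j) * emeasure M (E j) \<le> ennreal (c j) * ennreal (d j)"
      by (intro mult_left_mono d) auto
    also have "\<dots> = ennreal (A * 2 powr (- s * real j))"
      using c d cd by (simp add: ennreal_mult[symmetric])
    finally show "ennreal (c j) * emeasure M (E j) \<le> ennreal (A * 2 powr (- s * real j))" .
  qed auto
  also have "\<dots> = ennreal (\<Sum>j. A * 2 powr (- s * real j))"
    using cd suminf_powr_neg(1)[OF cd(2)] by (intro suminf_ennreal_eq summable_sums summable_mult) auto
  also have "(\<Sum>j. A * 2 powr (- s * real j)) = A / (1 - 2 powr (- s))"
    using suminf_powr_neg[OF cd(2)] by (subst suminf_mult) auto
  finally show ?thesis .
qed

lemma le_suminf_indicator:
  fixes c :: "nat \<Rightarrow> real"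
  assumes "v \<le> ennreal (c j)" "x \<in> E j"
  shows "v \<le> (\<Sum>j. ennreal (c j) * indicator (E j) x)"
proof -
  have "v \<le> ennreal (c j) * indicator (E j) x" using assms by simp
  also have "\<dots> \<le> (\<Sum>j. ennreal (c j) * indicator (E j) x)"
    using sum_le_suminf[of "\<lambda>j. ennreal (c j) * indicator (E j) x" "{j}"]
    by (simp del: sum_mult_indicator)
  finally show ?thesis .
qed

lemma dyadic_exists:
  fixes t \<rho> :: real
  assumes "0 < \<rho>" "\<rho> \<le> t"
  obtains j :: nat where "2 ^ j * \<rho> \<le> t" "t \<le> 2 ^ Suc j * \<rho>"
proof -
  define j where "j = nat \<lfloor>log 2 (t / \<rho>)\<rfloor>"
  have t: "t / \<rho> \<ge> 1" using assms by simp
  then have l: "log 2 (t / \<rho>) \<ge> 0" by (simp add: zero_le_log_cancel_iff)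
  then have "real j \<le> log 2 (t / \<rho>)" "log 2 (t / \<rho>) \<le> real (Suc j)" unfolding j_def by linarith+
  then have "2 powr real j \<le> t / \<rho>" "t / \<rho> \<le> 2 powr real (Suc j)"
    using t by (simp_all add: le_log_iff log_le_iff)
  then have "2 ^ j * \<rho> \<le> t" "t \<le> 2 ^ Suc j * \<rho>"
    using assms by (simp_all add: powr_realpow field_simps del: power_Suc of_nat_Suc)
  then show thesis by (rule that)
qed

text \<open>The part where \<phi> is about \<open>\<rho> / 2 ^ j\<close> has measure of order
  \<open>(\<rho> / 2 ^ j) powr \<kappa>\<close>, so the sum over scales descending to 0 is geometric
  because s < \<kappa>.\<close>

lemma nn_integral_powr_neg_near_le:
  assumes [measurable]: "E \<in> sets M" "\<phi> \<in> borel_measurable M"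
    and bd: "\<And>r. 0 < r \<Longrightarrow> r \<le> \<rho> \<Longrightarrow> emeasure M {x \<in> E. \<phi> x \<le> r} \<le> ennreal (A * r powr \<kappa>)"
    and "A \<ge> 0" "\<rho> > 0" and s: "0 \<le> s" "s < \<kappa>" and sp: "E \<subseteq> space M" and \<phi>: "\<And>x. x \<in> E \<Longrightarrow> 0 < \<phi> x \<and> \<phi> x \<le> \<rho>"
  shows "(\<integral>\<^sup>+x\<in>E. ennreal (\<phi> x powr (- s)) \<partial>M) \<le> ennreal (A * (2 powr s * \<rho> powr (\<kappa> - s) / (1 - 2 powr (- (\<kappa> - s)))))"
proof -
  define b where "b j = \<rho> / 2 ^ j" for j :: nat
  have b: "b j > 0" "b j \<le> \<rho>" for j unfolding b_def using \<open>\<rho> > 0\<close> by (auto simp: field_simps)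
  have "(\<integral>\<^sup>+x\<in>E. ennreal (\<phi> x powr (- s)) \<partial>M) \<le> ennreal ((A * 2 powr s * \<rho> powr (\<kappa> - s)) / (1 - 2 powr (- (\<kappa> - s))))"
  proof (rule nn_integral_le_suminf[where E = "\<lambda>j. {x \<in> E. \<phi> x \<le> b j}" and c = "\<lambda>j. (b (Suc j)) powr (- s)" and d = "\<lambda>j. A * b j powr \<kappa>"])
    have "{x \<in> E. \<phi> x \<le> b j} = E \<inter> {x \<in> space M. \<phi> x \<le> b j}" for j using sp by auto
    then show "{x \<in> E. \<phi> x \<le> b j} \<in> sets M" for j by simp
    show "emeasure M {x \<in> E. \<phi> x \<le> b j} \<le> ennreal (A * b j powr \<kappa>)" for j using b by (intro bd) auto
    show "b (Suc j) powr - s * (A * b j powr \<kappa>) = A * 2 powr s * \<rho> powr (\<kappa> - s) * 2 powr (- (\<kappa> - s) * real j)" for j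
    proof -
      have b2: "b j = exp (ln \<rho> - real j * ln 2)" for j
        unfolding b_def using \<open>\<rho> > 0\<close> by (simp add: exp_diff exp_of_nat_mult)
      show ?thesis unfolding b2 using \<open>\<rho> > 0\<close>
        by (simp add: powr_def mult_exp_exp algebra_simps)
    qed
    show "ennreal (\<phi> x powr - s) * indicator E x \<le> (\<Sum>j. ennreal (b (Suc j) powr - s) * indicator {x \<in> E. \<phi> x \<le> b j} x)" for x
    proof (cases "x \<in> E")
      case True
      have p: "0 < \<phi> x" "\<phi> x \<le> \<rho>" using \<phi>[OF True] by auto
      obtain j where j: "2 ^ j * \<phi> x \<le> \<rho>" "\<rho> \<le> 2 ^ Suc j * \<phi> x" using dyadic_exists[OF p] by blast
      then have "\<phi> x \<le> b j" "b (Suc j) \<le> \<phi> x" unfolding b_def by (simp_all add: field_simps)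
      then show ?thesis using True b s by (intro le_suminf_indicator[of _ _ j]) (auto intro!: ennreal_leI powr_mono2')
    qed simp
  qed (use \<open>A \<ge> 0\<close> s in auto)
  then show ?thesis by (simp add: mult.assoc)
qed

text \<open>The counterpart for scales ascending from \<rho>, where s > \<kappa> makes the sum
  geometric. It serves the tangential column bound and polynomial decay at infinity.\<close>

lemma nn_integral_powr_neg_far_le:
  assumes [measurable]: "E \<in> sets M" "\<phi> \<in> borel_measurable M"
    and bd: "\<And>r. \<rho> \<le> r \<Longrightarrow> emeasure M {x \<in> E. \<phi> x \<le> r} \<le> ennreal (A * r powr \<kappa>)"
    and "A \<ge> 0" "\<rho> > 0" and s: "0 \<le> s" "\<kappa> < s" and sp: "E \<subseteq> space M" and \<phi>: "\<And>x. x \<in> E \<Longrightarrow> \<rho> \<le> \<phi> x"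
  shows "(\<integral>\<^sup>+x\<in>E. ennreal (\<phi> x powr (- s)) \<partial>M) \<le> ennreal (A * (2 powr \<kappa> * \<rho> powr (\<kappa> - s) / (1 - 2 powr (- (s - \<kappa>)))))"
proof -
  define b where "b j = 2 ^ j * \<rho>" for j :: nat
  have b: "b j > 0" "\<rho> \<le> b j" for j unfolding b_def using \<open>\<rho> > 0\<close> by auto
  have "(\<integral>\<^sup>+x\<in>E. ennreal (\<phi> x powr (- s)) \<partial>M) \<le> ennreal ((A * 2 powr \<kappa> * \<rho> powr (\<kappa> - s)) / (1 - 2 powr (- (s - \<kappa>))))"
  proof (rule nn_integral_le_suminf[where E = "\<lambda>j. {x \<in> E. \<phi> x \<le> b (Suc j)}" and c = "\<lambda>j. (b j) powr (- s)" and d = "\<lambda>j. A * b (Suc j) powr \<kappa>"])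
    have "{x \<in> E. \<phi> x \<le> b (Suc j)} = E \<inter> {x \<in> space M. \<phi> x \<le> b (Suc j)}" for j using sp by auto
    then show "{x \<in> E. \<phi> x \<le> b (Suc j)} \<in> sets M" for j by simp
    show "emeasure M {x \<in> E. \<phi> x \<le> b (Suc j)} \<le> ennreal (A * b (Suc j) powr \<kappa>)" for j using b by (intro bd) auto
    show "b j powr - s * (A * b (Suc j) powr \<kappa>) = A * 2 powr \<kappa> * \<rho> powr (\<kappa> - s) * 2 powr (- (s - \<kappa>) * real j)" for j
    proof -
      have b2: "b j = exp (ln \<rho> + real j * ln 2)" for j
        unfolding b_def using \<open>\<rho> > 0\<close> by (simp add: exp_add exp_of_nat_mult)
      show ?thesis unfolding b2 using \<open>\<rho> > 0\<close>
        by (simp add: powr_def mult_exp_exp algebra_simps)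
    qed
    show "ennreal (\<phi> x powr - s) * indicator E x \<le> (\<Sum>j. ennreal (b j powr - s) * indicator {x \<in> E. \<phi> x \<le> b (Suc j)} x)" for x
    proof (cases "x \<in> E")
      case True
      obtain j where j: "2 ^ j * \<rho> \<le> \<phi> x" "\<phi> x \<le> 2 ^ Suc j * \<rho>" using dyadic_exists[OF \<open>\<rho> > 0\<close> \<phi>[OF True]] by blast
      then show ?thesis using True b s by (intro le_suminf_indicator[of _ _ j]) (auto simp: b_def intro!: ennreal_leI powr_mono2')
    qed simp
  qed (use \<open>A \<ge> 0\<close> s in auto)
  then show ?thesis by (simp add: mult.assoc)
qed

section \<open>Schur's test and integration along rays\<close>

text \<open>Young's inequality with a free scale l, optimised afterwards, takes the place of
  Hoelder's inequality for the splitting of k F into (k^(1/q) a) and (k^(1/p) F / a). The column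
  bound is asked only where F is nonzero, since later F vanishes on the complement of
  \<Omega>.\<close>

lemma schur_test:
  fixes k a :: "'a::euclidean_space \<Rightarrow> 'a \<Rightarrow> real" and F :: "'a \<Rightarrow> real"
  assumes p: "p > 1" and [measurable]: "case_prod k \<in> borel_measurable (borel \<Otimes>\<^sub>M borel)" "case_prod a \<in> borel_measurable (borel \<Otimes>\<^sub>M borel)"
      "F \<in> borel_measurable borel"
    and k: "\<And>x y. k x y \<ge> 0" and F: "\<And>y. F y \<ge> 0" and a: "\<And>x y. k x y \<noteq> 0 \<Longrightarrow> a x y > 0"
    and X: "X > 0" "\<And>x. (\<integral>\<^sup>+y. ennreal (k x y * a x y powr (p / (p - 1))) \<partial>lborel) \<le> ennreal X"
    and Y: "\<And>y. F y \<noteq> 0 \<Longrightarrow> (\<integral>\<^sup>+x. ennreal (k x y * a x y powr (- p)) \<partial>lborel) \<le> ennreal Y"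
  shows "(\<integral>\<^sup>+x. ennreal (enn2real (\<integral>\<^sup>+y. ennreal (k x y * F y) \<partial>lborel) powr p) \<partial>lborel)
     \<le> ennreal (X powr (p - 1)) * (ennreal Y * (\<integral>\<^sup>+y. ennreal (F y powr p) \<partial>lborel))"
proof -
  define q where "q = p / (p - 1)"
  have q: "q > 1" "1 / p + 1 / q = 1" "p * q = p + q" unfolding q_def using p by (auto simp: field_simps)

  define Z where "Z x = (\<integral>\<^sup>+y. ennreal (k x y * a x y powr (- p) * F y powr p) \<partial>lborel)" for x
  have pt: "ennreal (enn2real (\<integral>\<^sup>+y. ennreal (k x y * F y) \<partial>lborel) powr p) \<le> ennreal (X powr (p - 1)) * Z x" for x
  proof (cases "Z x = top")
    case True
    then show ?thesis using X by (simp add: ennreal_mult_top)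
  next
    case False
    then obtain z where z: "Z x = ennreal z" "z \<ge> 0" by (metis ennreal_cases infinity_ennreal_def)
    define I where "I = (\<integral>\<^sup>+y. ennreal (k x y * F y) \<partial>lborel)"
    \<comment> \<open>Working with any w above z keeps w, and with it l, positive even if z =
      0.\<close>
    have le: "enn2real I powr p \<le> X powr (p - 1) * w" if w: "w > z" for w
    proof -
      \<comment> \<open>The scale at which both terms of Young's inequality become multiples of the
        same product \<open>w powr (1 / p) * X powr (1 / q)\<close>.\<close>
      define l where "l = (w / X) powr (1 / (p + q))"
      have wp: "w > 0" using w z by simp
      have l: "l > 0" unfolding l_def using wp X by simp
      have lq: "l powr q * X = w powr (1 / p) * X powr (1 / q)"
      proof -
        have e: "1 / (p + q) * q = 1 / p" using q p by (simp add: q(3)[symmetric])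
        have "l powr q = (w / X) powr (1 / p)" unfolding l_def powr_powr e ..
        then have "l powr q * X powr (1 / p) = w powr (1 / p)" using X(1) wp by (simp add: powr_divide)
        moreover have "X powr (1 / p) * X powr (1 / q) = X" using q X(1) by (simp flip: powr_add)
        ultimately show ?thesis by (metis mult.assoc)
      qed
      have lp: "l powr (- p) * w = w powr (1 / p) * X powr (1 / q)"
      proof -
        have e: "1 / (p + q) * (- p) = - (1 / q)" using q p by (simp add: q(3)[symmetric])
        have "l powr (- p) = (w / X) powr (- (1 / q))" unfolding l_def powr_powr e ..
        then have "l powr (- p) * w powr (1 / q) = X powr (1 / q)"
          using X(1) wp by (simp add: powr_divide powr_minus)
        moreover have "w powr (1 / q) * w powr (1 / p) = w" using q wp by (simp add: add.commute flip: powr_add)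
        ultimately show ?thesis by (metis mult.assoc mult.commute)
      qed
      have "I \<le> (\<integral>\<^sup>+y. ennreal (l powr q / q) * ennreal (k x y * a x y powr q) + ennreal (l powr (- p) / p) * ennreal (k x y * a x y powr (- p) * F y powr p) \<partial>lborel)"
        unfolding I_def
      proof (rule nn_integral_mono)
        fix y
        have "k x y * F y \<le> (l powr q / q) * (k x y * a x y powr q) + (l powr (- p) / p) * (k x y * a x y powr (- p) * F y powr p)"
        proof (cases "k x y = 0")
          case False
          then have ap: "a x y > 0" by (rule a)
          have "F y = (F y / (l * a x y)) * (l * a x y)" using l ap by simp
          also have "\<dots> \<le> (F y / (l * a x y)) powr p / p + (l * a x y) powr q / q"
            using p q l ap F by (intro Youngs_inequality) auto
          also have "\<dots> = (l powr q / q) * a x y powr q + (l powr (- p) / p) * (a x y powr (- p) * F y powr p)"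
            using l ap F[of y] by (simp add: powr_mult powr_divide powr_minus field_simps)
          finally have "k x y * F y \<le> k x y * \<dots>" using k by (intro mult_left_mono) auto
          then show ?thesis by (simp add: algebra_simps)
        qed simp
        then show "ennreal (k x y * F y) \<le> ennreal (l powr q / q) * ennreal (k x y * a x y powr q) + ennreal (l powr (- p) / p) * ennreal (k x y * a x y powr (- p) * F y powr p)"
          using p q k by (simp add: ennreal_mult[symmetric] ennreal_plus[symmetric] ennreal_leI del: ennreal_plus)
      qed
      also have "\<dots> = ennreal (l powr q / q) * (\<integral>\<^sup>+y. ennreal (k x y * a x y powr q) \<partial>lborel) + ennreal (l powr (- p) / p) * Z x"
        unfolding Z_def by (subst nn_integral_add) (auto simp: nn_integral_cmult)
      also have "\<dots> \<le> ennreal (l powr q / q) * ennreal X + ennreal (l powr (- p) / p) * ennreal w"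
        unfolding z(1) using w X(2)[of x] by (intro add_mono mult_left_mono ennreal_leI) (auto simp: q_def)
      also have "\<dots> = ennreal (l powr q * X / q + l powr (- p) * w / p)"
        using p q X wp by (simp add: ennreal_mult[symmetric] ennreal_plus[symmetric] del: ennreal_plus)
      also have "l powr q * X / q + l powr (- p) * w / p = w powr (1 / p) * X powr (1 / q) * (1 / p + 1 / q)"
        unfolding lq lp by (simp add: field_simps)
      finally have "I \<le> ennreal (w powr (1 / p) * X powr (1 / q))" unfolding q(2) by simp
      then have "enn2real I \<le> w powr (1 / p) * X powr (1 / q)" by (intro enn2real_leI) auto
      then have "enn2real I powr p \<le> (w powr (1 / p) * X powr (1 / q)) powr p" using p by (intro powr_mono2) auto
      also have "\<dots> = w * X powr (p / q)" using p wp X by (simp add: powr_mult powr_powr)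
      also have "p / q = p - 1" unfolding q_def using p by simp
      finally show ?thesis by (simp add: mult.commute)
    qed
    have "enn2real I powr p \<le> X powr (p - 1) * z"
    proof (rule field_le_epsilon)
      fix e :: real assume "e > 0"
      have Xp: "X powr (p - 1) > 0" using X by simp
      have "enn2real I powr p \<le> X powr (p - 1) * (z + e / X powr (p - 1))" using \<open>e > 0\<close> Xp by (intro le) simp
      then show "enn2real I powr p \<le> X powr (p - 1) * z + e" using Xp by (simp add: field_simps)
    qed
    then show ?thesis unfolding z(1) I_def using z(2) by (simp add: ennreal_mult[symmetric] ennreal_leI)
  qed
  have "(\<integral>\<^sup>+x. ennreal (enn2real (\<integral>\<^sup>+y. ennreal (k x y * F y) \<partial>lborel) powr p) \<partial>lborel) \<le> (\<integral>\<^sup>+x. ennreal (X powr (p - 1)) * Z x \<partial>lborel)"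
    by (intro nn_integral_mono pt)
  also have "\<dots> = ennreal (X powr (p - 1)) * (\<integral>\<^sup>+x. Z x \<partial>lborel)"
    unfolding Z_def by (intro nn_integral_cmult lborel.borel_measurable_nn_integral) measurable
  also have "(\<integral>\<^sup>+x. Z x \<partial>lborel) = (\<integral>\<^sup>+y. (\<integral>\<^sup>+x. ennreal (k x y * a x y powr (- p) * F y powr p) \<partial>lborel) \<partial>lborel)"
    unfolding Z_def by (rule lborel_pair.Fubini') measurable
  also have "\<dots> \<le> (\<integral>\<^sup>+y. ennreal Y * ennreal (F y powr p) \<partial>lborel)"
  proof (rule nn_integral_mono)
    fix y

    show "(\<integral>\<^sup>+x. ennreal (k x y * a x y powr (- p) * F y powr p) \<partial>lborel) \<le> ennreal Y * ennreal (F y powr p)"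
    proof (cases "F y = 0")
      case False
      have "(\<integral>\<^sup>+x. ennreal (k x y * a x y powr (- p) * F y powr p) \<partial>lborel) = (\<integral>\<^sup>+x. ennreal (k x y * a x y powr (- p)) \<partial>lborel) * ennreal (F y powr p)"
        by (subst nn_integral_multc[symmetric]) (auto simp: ennreal_mult k)
      also have "\<dots> \<le> ennreal Y * ennreal (F y powr p)" by (intro mult_right_mono Y False) auto
      finally show ?thesis .
    qed (use p in simp)
  qed
  also have "\<dots> = ennreal Y * (\<integral>\<^sup>+y. ennreal (F y powr p) \<partial>lborel)" by (simp add: nn_integral_cmult)
  finally show ?thesis by (simp add: mult_left_mono)
qed

text \<open>A substitute for polar coordinates: averaging the radial integrals over the directions in
  the annulus \<open>1 \<le> \<bar>\<theta>\<bar> \<le> 2\<close> needs only Fubini's theorem and scaling.\<close>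

lemma nn_integral_le_rays:
  fixes H :: "'a::euclidean_space \<Rightarrow> ennreal"
  assumes [measurable]: "H \<in> borel_measurable borel"
    and ray: "\<And>\<theta>. 1 \<le> norm \<theta> \<Longrightarrow> (\<integral>\<^sup>+t\<in>{0<..}. H (t *\<^sub>R \<theta>) \<partial>lborel) \<le> ennreal c"
  shows "(\<integral>\<^sup>+x. H x * ennreal (norm x powr (1 - real DIM('a))) \<partial>lborel) \<le> ennreal (2 * c * unit_ball_vol DIM('a) * 2 ^ DIM('a))"
proof -
  define A where "A = {\<theta>::'a. 1 \<le> norm \<theta> \<and> norm \<theta> \<le> 2}"
  define n where "n = DIM('a)"
  have [measurable]: "A \<in> sets borel" unfolding A_def by measurable
  have c0: "ennreal c = ennreal (max 0 c)" by (auto simp: max_def ennreal_neg)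
  have AT: "(1 / t) *\<^sub>R x \<in> A \<longleftrightarrow> t \<le> norm x \<and> norm x \<le> 2 * t" if "t > 0" for t x
    using that unfolding A_def by (auto simp: field_simps)
  have "(\<integral>\<^sup>+x. H x * ennreal (norm x powr (1 - real n)) \<partial>lborel) \<le>
     (\<integral>\<^sup>+x. 2 * (\<integral>\<^sup>+t. (H x * ennreal (t powr (- real n)) * indicator {0<..} t) * indicator A ((1 / t) *\<^sub>R x) \<partial>lborel) \<partial>lborel)"
  proof (rule nn_integral_mono_AE, use AE_lborel_singleton[of 0] in eventually_elim)
    case (elim x)
    let ?r = "norm x"
    have r: "?r > 0" using elim by simp
    \<comment> \<open>For t between |x| / 2 and |x| the point x / t lies in the annulus
      \<open>A\<close>, and \<open>t powr (- n)\<close> is at least \<open>|x| powr (- n)\<close>.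
      The length |x| / 2 of this interval turns the exponent - n into 1 - n and accounts for the
      factor 2.\<close>
    have "ennreal (?r powr (- real n) * (?r / 2)) * H x = (\<integral>\<^sup>+t. (H x * ennreal (?r powr (- real n))) * indicator {?r / 2..?r} t \<partial>lborel)"
    proof (subst nn_integral_cmult_indicator)
      show "ennreal (?r powr (- real n) * (?r / 2)) * H x = H x * ennreal (?r powr (- real n)) * emeasure lborel {?r / 2..?r}"
        using r by (subst ennreal_mult) (auto simp: mult_ac)
    qed simp
    also have "\<dots> \<le> (\<integral>\<^sup>+t. (H x * ennreal (t powr (- real n)) * indicator {0<..} t) * indicator A ((1 / t) *\<^sub>R x) \<partial>lborel)"
    proof (rule nn_integral_mono)
      fix t
      show "(H x * ennreal (?r powr (- real n))) * indicator {?r / 2..?r} t \<le> (H x * ennreal (t powr (- real n)) * indicator {0<..} t) * indicator A ((1 / t) *\<^sub>R x)"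
      proof (cases "t \<in> {?r / 2..?r}")
        case True
        then have "t \<le> ?r" "?r \<le> 2 * t" by auto
        moreover from this have "t > 0" using r by linarith
        ultimately have t: "t > 0" "t \<le> ?r" "?r \<le> 2 * t" by auto
        then have "(1 / t) *\<^sub>R x \<in> A" using AT by blast
        moreover have "?r powr (- real n) \<le> t powr (- real n)" using t by (intro powr_mono2') auto
        ultimately show ?thesis using True t by (auto intro!: mult_left_mono ennreal_leI)
      qed simp
    qed
    finally have *: "ennreal (?r powr (- real n) * (?r / 2)) * H x \<le> \<dots>" .
    have "?r powr (1 - real n) = 2 * (?r powr (- real n) * (?r / 2))"
      using r powr_add[of ?r 1 "- real n"] by simp
    then have "ennreal (?r powr (1 - real n)) = 2 * ennreal (?r powr (- real n) * (?r / 2))"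
      using ennreal_mult'[of 2 "?r powr (- real n) * (?r / 2)"] by simp
    then have "H x * ennreal (?r powr (1 - real n)) = 2 * (ennreal (?r powr (- real n) * (?r / 2)) * H x)"
      by (simp only: mult_ac)
    then show ?case using mult_left_mono[OF *, of 2] by simp
  qed
  also have "\<dots> = 2 * (\<integral>\<^sup>+x. (\<integral>\<^sup>+t. (H x * ennreal (t powr (- real n)) * indicator {0<..} t) * indicator A ((1 / t) *\<^sub>R x) \<partial>lborel) \<partial>lborel)"
    by (intro nn_integral_cmult lborel.borel_measurable_nn_integral) measurable
  also have "(\<integral>\<^sup>+x. (\<integral>\<^sup>+t. (H x * ennreal (t powr (- real n)) * indicator {0<..} t) * indicator A ((1 / t) *\<^sub>R x) \<partial>lborel) \<partial>lborel) =
     (\<integral>\<^sup>+t. (\<integral>\<^sup>+x. (H x * ennreal (t powr (- real n)) * indicator {0<..} t) * indicator A ((1 / t) *\<^sub>R x) \<partial>lborel) \<partial>lborel)"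
    by (rule lborel_pair.Fubini'[symmetric]) measurable
  \<comment> \<open>The substitution x = t \<theta> has Jacobian \<open>t ^ n\<close>, which cancels
    \<open>t powr (- n)\<close>.\<close>
  also have "\<dots> = (\<integral>\<^sup>+t. (\<integral>\<^sup>+\<theta>. H (t *\<^sub>R \<theta>) * indicator {0<..} t * indicator A \<theta> \<partial>lborel) \<partial>lborel)"
  proof (rule nn_integral_cong)
    fix t :: real
    show "(\<integral>\<^sup>+x. (H x * ennreal (t powr (- real n)) * indicator {0<..} t) * indicator A ((1 / t) *\<^sub>R x) \<partial>lborel) =
      (\<integral>\<^sup>+\<theta>. H (t *\<^sub>R \<theta>) * indicator {0<..} t * indicator A \<theta> \<partial>lborel)"
    proof (cases "t > 0")
      case True
      have "(\<integral>\<^sup>+x. (H x * ennreal (t powr (- real n)) * indicator {0<..} t) * indicator A ((1 / t) *\<^sub>R x) \<partial>lborel) =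
        (\<integral>\<^sup>+x. (H x * ennreal (t powr (- real n)) * indicator {0<..} t) * indicator A ((1 / t) *\<^sub>R x) \<partial>density (distr lborel borel (\<lambda>x. 0 + t *\<^sub>R x)) (\<lambda>_. \<bar>t\<bar> ^ n))"
        unfolding n_def using True by (subst (1) lborel_affine[of t 0]) auto
      also have "\<dots> = (\<integral>\<^sup>+\<theta>. ennreal (\<bar>t\<bar> ^ n) * (H (t *\<^sub>R \<theta>) * ennreal (t powr (- real n)) * indicator {0<..} t * indicator A ((1 / t) *\<^sub>R (t *\<^sub>R \<theta>))) \<partial>lborel)"
        by (subst nn_integral_density, measurable, subst nn_integral_distr) auto
      also have "\<dots> = (\<integral>\<^sup>+\<theta>. H (t *\<^sub>R \<theta>) * indicator {0<..} t * indicator A \<theta> \<partial>lborel)"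
      proof (rule nn_integral_cong)
        fix \<theta>
        have "ennreal (\<bar>t\<bar> ^ n) * ennreal (t powr (- real n)) = 1"
          using True by (simp add: ennreal_mult[symmetric] powr_minus powr_realpow)
        then have *: "ennreal (\<bar>t\<bar> ^ n) * (h * ennreal (t powr (- real n)) * i * j) = h * i * j" for h i j
          by (metis (no_types, lifting) mult.assoc mult.commute mult_1)
        show "ennreal (\<bar>t\<bar> ^ n) * (H (t *\<^sub>R \<theta>) * ennreal (t powr (- real n)) * indicator {0<..} t * indicator A ((1 / t) *\<^sub>R (t *\<^sub>R \<theta>))) = H (t *\<^sub>R \<theta>) * indicator {0<..} t * indicator A \<theta>"
          unfolding * using True by simp
      qed
      finally show ?thesis .
    qed simp
  qed
  also have "\<dots> = (\<integral>\<^sup>+\<theta>. (\<integral>\<^sup>+t. H (t *\<^sub>R \<theta>) * indicator {0<..} t * indicator A \<theta> \<partial>lborel) \<partial>lborel)"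
    by (rule lborel_pair.Fubini') measurable
  also have "\<dots> \<le> (\<integral>\<^sup>+\<theta>. ennreal c * indicator A \<theta> \<partial>lborel)"
  proof (rule nn_integral_mono)
    fix \<theta> :: 'a
    show "(\<integral>\<^sup>+t. H (t *\<^sub>R \<theta>) * indicator {0<..} t * indicator A \<theta> \<partial>lborel) \<le> ennreal c * indicator A \<theta>"
      using ray[of \<theta>] by (cases "\<theta> \<in> A") (auto simp: A_def)
  qed
  also have "\<dots> = ennreal c * emeasure lborel A" by (simp add: nn_integral_cmult_indicator)
  also have "\<dots> \<le> ennreal c * emeasure lborel (cball (0::'a) 2)"
    by (intro mult_left_mono emeasure_mono) (auto simp: A_def)
  also have "\<dots> = ennreal (c * unit_ball_vol n * 2 ^ n)"
    unfolding c0 n_def by (simp add: emeasure_cball ennreal_mult[symmetric] mult.assoc) (auto simp: max_def ennreal_neg mult_le_0_iff)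
  finally have "(\<integral>\<^sup>+x. H x * ennreal (norm x powr (1 - real n)) \<partial>lborel) \<le> 2 * ennreal (c * unit_ball_vol n * 2 ^ n)"
    by (simp add: mult_left_mono)
  also have "\<dots> = ennreal (2 * c * unit_ball_vol n * 2 ^ n)"
    using ennreal_mult'[of 2 "c * unit_ball_vol n * 2 ^ n"] by (simp add: mult.assoc)
  finally show ?thesis unfolding n_def .
qed

lemma emeasure_le_of_diameter:
  fixes T :: "real set"
  assumes "\<And>s t. s \<in> T \<Longrightarrow> t \<in> T \<Longrightarrow> s < t \<Longrightarrow> t - s \<le> L" "L \<ge> 0"
  shows "emeasure lborel T \<le> ennreal (2 * L)"
proof (cases "T = {}")
  case False
  then obtain s where s: "s \<in> T" by blast
  have "T \<subseteq> {s - L..s + L}"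
  proof
    fix t assume "t \<in> T"
    then show "t \<in> {s - L..s + L}" using assms(1)[OF s, of t] assms(1)[of t s] s \<open>L \<ge> 0\<close> by (cases s t rule: linorder_cases) auto
  qed
  then have "emeasure lborel T \<le> emeasure lborel {s - L..s + L}" by (intro emeasure_mono) auto
  then show ?thesis using \<open>L \<ge> 0\<close> by simp
qed simp

section \<open>Crescents between neighbouring maximal balls\<close>

locale closed_complement =
  fixes S :: "'a::euclidean_space set"
  assumes closed: "closed S" and ne: "S \<noteq> {}"
begin

abbreviation d :: "'a \<Rightarrow> real" where "d x \<equiv> infdist x S"

definition nearest :: "'a \<Rightarrow> 'a set" where "nearest x = {b \<in> S. dist x b = d x}"

text \<open>Nearest points are not unique. Taking the farthest of them makes \<open>contact_dist\<close> upper
  semicontinuous, hence Borel, without a measurable choice of nearest points, and its negative powers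
  are still dominated by those of the distance to any fixed nearest point.\<close>

definition contact_dist :: "'a \<Rightarrow> 'a \<Rightarrow> real" where "contact_dist x y = (SUP b\<in>nearest x. dist y b)"

definition crescent :: "'a \<Rightarrow> 'a \<Rightarrow> 'a set" where
  "crescent e x = {y. d x \<le> dist y x \<and> dist y (x + e) < d (x + e)}"

lemma nearest_nonempty: "nearest x \<noteq> {}"
proof -
  obtain b where "b \<in> S" "d x = dist x b" by (rule infdist_attains_inf[OF closed ne])
  then have "b \<in> nearest x" unfolding nearest_def by simp
  then show ?thesis by blast
qed

lemma compact_nearest: "compact (nearest x)"
proof -
  have "nearest x = S \<inter> sphere x (d x)" unfolding nearest_def by auto
  then show ?thesis using closed_Int_compact[OF closed compact_sphere] by simp
qed

lemma contact_dist_upper: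
  assumes "b \<in> nearest x"
  shows "dist y b \<le> contact_dist x y"
proof -
  have "continuous_on (nearest x) (dist y)" by (intro continuous_intros)
  then have "bdd_above (dist y ` nearest x)"
    by (intro bounded_imp_bdd_above compact_imp_bounded compact_continuous_image compact_nearest)
  then show ?thesis unfolding contact_dist_def by (intro cSUP_upper assms)
qed

lemma contact_dist_attained: "\<exists>b\<in>nearest x. contact_dist x y = dist y b"
proof -
  have "continuous_on (nearest x) (dist y)" by (intro continuous_intros)
  then obtain b where b: "b \<in> nearest x" "\<forall>b'\<in>nearest x. dist y b' \<le> dist y b"
    using continuous_attains_sup[OF compact_nearest[of x] nearest_nonempty[of x]] by blast
  then have "contact_dist x y \<le> dist y b" unfolding contact_dist_def by (intro cSUP_least nearest_nonempty) auto
  then show ?thesis using b contact_dist_upper[OF b(1), of y] by force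
qed

lemma contact_dist_nonneg: "contact_dist x y \<ge> 0"
proof -
  obtain b where "contact_dist x y = dist y b" using contact_dist_attained by blast
  then show ?thesis by simp
qed

lemma continuous_on_d: "continuous_on A d"
  by (intro continuous_on_infdist continuous_on_id)

lemma borel_measurable_d [measurable]: "d \<in> borel_measurable borel"
  by (intro borel_measurable_continuous_onI continuous_on_d)

text \<open>Nearest points of a sequence tending to x stay bounded, and by closedness of S and
  continuity of the distance every limit of them is a nearest point of x. Hence the superlevel sets
  are closed, jointly in both arguments.\<close>

lemma borel_measurable_contact_dist [measurable]: "case_prod contact_dist \<in> borel_measurable (borel \<Otimes>\<^sub>M borel)"
proof -
  have "case_prod contact_dist \<in> borel_measurable (borel :: ('a \<times> 'a) measure)"
  proof (rule borel_measurableI_ge)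
    fix c
    have "closed {z. c \<le> case_prod contact_dist z}"
      unfolding closed_sequential_limits
    proof safe
      fix z x y assume z: "\<forall>k. z k \<in> {z. c \<le> case_prod contact_dist z}" "z \<longlonglongrightarrow> (x, y)"
      define u v where "u k = fst (z k)" and "v k = snd (z k)" for k :: nat
      have u: "u \<longlonglongrightarrow> x" and v: "v \<longlonglongrightarrow> y"
        unfolding u_def v_def using tendsto_fst[OF z(2)] tendsto_snd[OF z(2)] by auto
      have "\<exists>b. b \<in> nearest (u k) \<and> c \<le> dist (v k) b" for k
      proof -
        obtain b where "b \<in> nearest (u k)" "contact_dist (u k) (v k) = dist (v k) b" using contact_dist_attained by blast
        moreover have "c \<le> contact_dist (u k) (v k)" using z(1)[rule_format, of k] by (simp add: u_def v_def case_prod_beta)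
        ultimately show ?thesis by auto
      qed
      then obtain b where b: "\<And>k. b k \<in> S" "\<And>k. dist (u k) (b k) = d (u k)" "\<And>k. c \<le> dist (v k) (b k)"
        unfolding nearest_def by (metis (mono_tags, lifting) mem_Collect_eq)
      have du: "(\<lambda>k. d (u k)) \<longlonglongrightarrow> d x" by (intro tendsto_infdist u)
      have "bounded (range b)"
      proof -
        have "Bseq (\<lambda>k. d (u k))" using du by (intro convergent_imp_Bseq convergentI)
        moreover have "Bseq u" using u by (intro convergent_imp_Bseq convergentI)
        ultimately obtain K1 K2 where K: "\<And>k. norm (d (u k)) \<le> K1" "\<And>k. norm (u k) \<le> K2" unfolding Bseq_def by metis
        have "norm (b k) \<le> K1 + K2" for k
        proof -
          have "norm (b k) \<le> norm (u k) + dist (u k) (b k)" by (metis dist_commute dist_norm norm_triangle_sub)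
          then show ?thesis using K[of k] b(2)[of k] by simp
        qed
        then show ?thesis by (auto intro!: boundedI)
      qed
      then obtain b' r where r: "strict_mono r" and b': "(b \<circ> r) \<longlonglongrightarrow> b'"
        using bounded_imp_convergent_subsequence by metis
      have "b' \<in> S" by (rule closed_sequentially[OF closed _ b']) (simp add: b(1))
      moreover have "dist x b' = d x"
      proof (rule LIMSEQ_unique)
        show "(\<lambda>k. dist ((u \<circ> r) k) ((b \<circ> r) k)) \<longlonglongrightarrow> dist x b'"
          by (intro tendsto_dist b' LIMSEQ_subseq_LIMSEQ[OF u r])
        show "(\<lambda>k. dist ((u \<circ> r) k) ((b \<circ> r) k)) \<longlonglongrightarrow> d x"
          using LIMSEQ_subseq_LIMSEQ[OF du r] b(2) by (simp add: comp_def)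
      qed
      ultimately have "b' \<in> nearest x" unfolding nearest_def by simp
      moreover have "c \<le> dist y b'"
      proof (rule Lim_bounded2)
        show "(\<lambda>k. dist ((v \<circ> r) k) ((b \<circ> r) k)) \<longlonglongrightarrow> dist y b'"
          by (intro tendsto_dist b' LIMSEQ_subseq_LIMSEQ[OF v r])
        show "\<forall>k\<ge>0. c \<le> dist ((v \<circ> r) k) ((b \<circ> r) k)" using b(3) by simp
      qed
      ultimately show "c \<le> contact_dist x y" using contact_dist_upper order_trans by blast
    qed
    then show "{z \<in> space borel. c \<le> case_prod contact_dist z} \<in> sets borel" by simp
  qed
  then show ?thesis by (simp add: borel_prod)
qed

section \<open>Thickness of the crescent and the row integrals of Schur's test\<close>

lemma crescent_dist:
  assumes "y \<in> crescent e x"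
  shows "d x \<le> dist y x" "dist y x \<le> d x + 2 * norm e"
proof -
  have "dist y x \<le> dist y (x + e) + norm e" using dist_triangle[of y x "x + e"] by (simp add: dist_norm)
  moreover have "d (x + e) \<le> d x + norm e" using infdist_triangle[of "x + e" S x] by (simp add: dist_norm)
  ultimately show "dist y x \<le> d x + 2 * norm e" "d x \<le> dist y x" using assms unfolding crescent_def by auto
qed

text \<open>Two comparisons, squared and expanded about b. Since b lies in S, y is nearer to x + e
  than b is; since y is outside the maximal ball at x, it is no nearer to x than b is. They pinch
  \<open>2 * ((y - b) \<bullet> (x - b))\<close> near \<open>(norm (y - b))\<^sup>2\<close> and show
  that at y the crescent has thickness about \<open>dist y b * norm e / d x\<close>.\<close>

lemma crescent_inner:
  assumes "y \<in> crescent e x" "b \<in> nearest x"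
  shows "(norm (y - b))\<^sup>2 < 2 * ((y - b) \<bullet> (x - b)) + 2 * ((y - b) \<bullet> e)" "0 < dist y b" "dist y b \<le> 2 * (d x + norm e)"
    "(dist y x)\<^sup>2 < (d x)\<^sup>2 + 2 * dist y b * norm e" "2 * ((y - b) \<bullet> (x - b)) \<le> (norm (y - b))\<^sup>2"
proof -
  have b: "b \<in> S" "dist x b = d x" using assms(2) unfolding nearest_def by auto
  have lt: "dist y (x + e) < dist (x + e) b" using assms(1) infdist_le[OF b(1), of "x + e"] unfolding crescent_def by simp
  then have "(norm (y - (x + e)))\<^sup>2 < (norm (x + e - b))\<^sup>2" by (simp add: dist_norm norm_lt power2_norm_eq_inner)
  moreover have "y - (x + e) = (y - b) - (x + e - b)" by simp
  ultimately have "(norm ((y - b) - (x + e - b)))\<^sup>2 < (norm (x + e - b))\<^sup>2" by metis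
  then show 1: "(norm (y - b))\<^sup>2 < 2 * ((y - b) \<bullet> (x - b)) + 2 * ((y - b) \<bullet> e)"
    unfolding power2_norm_eq_inner by (simp add: algebra_simps inner_commute)
  show "0 < dist y b" using lt by (metis dist_commute less_irrefl zero_less_dist_iff)
  have "dist (x + e) b \<le> d x + norm e" using dist_triangle[of "x + e" b x] b by (simp add: dist_norm)
  then show "dist y b \<le> 2 * (d x + norm e)" using dist_triangle[of y b "x + e"] lt by simp
  have e: "(dist y x)\<^sup>2 = (norm (y - b))\<^sup>2 - 2 * ((y - b) \<bullet> (x - b)) + (d x)\<^sup>2"
  proof -
    have "y - x = (y - b) - (x - b)" by simp
    then have "(dist y x)\<^sup>2 = (norm ((y - b) - (x - b)))\<^sup>2" by (simp add: dist_norm)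
    also have "\<dots> = (norm (y - b))\<^sup>2 - 2 * ((y - b) \<bullet> (x - b)) + (norm (x - b))\<^sup>2"
      unfolding power2_norm_eq_inner by (simp add: algebra_simps inner_commute)
    finally show ?thesis using b by (simp add: dist_norm)
  qed
  have "(y - b) \<bullet> e \<le> dist y b * norm e" using norm_cauchy_schwarz[of "y - b" e] by (simp add: dist_norm)
  then show "(dist y x)\<^sup>2 < (d x)\<^sup>2 + 2 * dist y b * norm e" using e 1 by simp
  have "(d x)\<^sup>2 \<le> (dist y x)\<^sup>2" using crescent_dist(1)[OF assms(1)] infdist_nonneg by (intro power_mono) auto
  then show "2 * ((y - b) \<bullet> (x - b)) \<le> (norm (y - b))\<^sup>2" using e by simp
qed

lemma contact_dist_crescent:
  assumes "y \<in> crescent e x"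
  shows "0 < contact_dist x y" "contact_dist x y \<le> 2 * (d x + norm e)"
  using contact_dist_attained[of x y] crescent_inner[OF assms] by auto

lemma sets_crescent [measurable]: "crescent e x \<in> sets borel"
  unfolding crescent_def by measurable

text \<open>Within distance r of b the crescent lies in a shell of thickness \<tau> = r |e| / d x,
  so it has measure of order \<open>|e| r^n / d x\<close> there, and s below the dimension makes the
  sum over the scales r geometric.\<close>

lemma crescent_weight_le:
  assumes e: "0 < norm e" "10 * norm e \<le> d x" and s: "0 \<le> s" "s < real DIM('a)"
  defines "C \<equiv> unit_ball_vol DIM('a) * 2 ^ DIM('a) * 6 * (2 powr s * 3 powr (real DIM('a) - s) / (1 - 2 powr (- (real DIM('a) - s))))"
  shows "(\<integral>\<^sup>+y\<in>crescent e x. ennreal (contact_dist x y powr (- s)) \<partial>lborel) \<le> ennreal (C * norm e * d x powr (real DIM('a) - 1 - s))"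
proof -
  \<comment> \<open>A single nearest point is enough:
    \<open>dist y b \<le> contact_dist x y\<close>, and the power is negative.\<close>
  obtain b where b: "b \<in> nearest x" using nearest_nonempty by blast
  define A where "A = unit_ball_vol DIM('a) * 2 ^ DIM('a) * 6 * (norm e / d x)"
  have dx: "d x > 0" using e by linarith
  have "(\<integral>\<^sup>+y\<in>crescent e x. ennreal (contact_dist x y powr (- s)) \<partial>lborel) \<le> (\<integral>\<^sup>+y\<in>crescent e x. ennreal (dist y b powr (- s)) \<partial>lborel)"
    using crescent_inner(2)[OF _ b] contact_dist_upper[OF b] s
    by (intro nn_integral_mono) (auto simp: indicator_def intro!: ennreal_leI powr_mono2')
  also have "\<dots> \<le> ennreal (A * (2 powr s * (3 * d x) powr (real DIM('a) - s) / (1 - 2 powr (- (real DIM('a) - s)))))"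
  proof (rule nn_integral_powr_neg_near_le)
    show "0 < dist y b \<and> dist y b \<le> 3 * d x" if "y \<in> crescent e x" for y
    proof
      have "norm e \<le> d x / 10" using e by simp
      then show "dist y b \<le> 3 * d x" using crescent_inner(3)[OF that b] dx by argo
    qed (rule crescent_inner(2)[OF that b])
    fix r assume r: "0 < r" "r \<le> 3 * d x"
    \<comment> \<open>Chosen so that \<open>2 * d x * \<tau> = 2 * r * norm e\<close>; completing
      the square then gives \<open>dist y x < d x + \<tau>\<close>.\<close>
    define \<tau> where "\<tau> = r * norm e / d x"
    have t: "0 < \<tau>" "\<tau> \<le> d x"
    proof -
      have "\<tau> \<le> 3 * d x * norm e / d x"
        unfolding \<tau>_def using r dx by (intro divide_right_mono mult_right_mono) auto
      also have "\<dots> = 3 * norm e" using dx by simp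
      also have "\<dots> \<le> d x" using e norm_ge_zero[of e] by argo
      finally show "\<tau> \<le> d x" .
    qed (use r e dx in \<open>simp add: \<tau>_def\<close>)
    have "emeasure lborel {y \<in> crescent e x. dist y b \<le> r} \<le> ennreal (unit_ball_vol DIM('a) * 2 ^ DIM('a) * (6 * \<tau>) * r powr (real DIM('a) - 1))"
    proof (rule emeasure_shell_piece_le[OF _ _ _ t r])
      have "{y \<in> crescent e x. dist y b \<le> r} = crescent e x \<inter> cball b r" by (auto simp: dist_commute)
      then show "{y \<in> crescent e x. dist y b \<le> r} \<in> sets borel" "{y \<in> crescent e x. dist y b \<le> r} \<subseteq> cball b r" by auto
      fix y assume y: "y \<in> {y \<in> crescent e x. dist y b \<le> r}"
      have "(dist y x)\<^sup>2 < (d x)\<^sup>2 + 2 * dist y b * norm e" using crescent_inner(4)[OF _ b] y by auto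
      also have "\<dots> \<le> (d x)\<^sup>2 + 2 * r * norm e" using y by (intro add_left_mono mult_right_mono) auto
      also have "\<dots> = (d x)\<^sup>2 + 2 * d x * \<tau>" unfolding \<tau>_def using dx by simp
      also have "\<dots> \<le> (d x + \<tau>)\<^sup>2" by (simp add: power2_sum)
      finally have "dist y x < d x + \<tau>" using t dx by (intro power2_less_imp_less[of "dist y x"]) auto
      then show "d x \<le> dist y x \<and> dist y x < d x + \<tau>" using crescent_dist(1) y by auto
    qed
    also have "unit_ball_vol DIM('a) * 2 ^ DIM('a) * (6 * \<tau>) * r powr (real DIM('a) - 1) = A * r powr real DIM('a)"
      unfolding A_def \<tau>_def using r dx powr_add[of r 1 "real DIM('a) - 1"] by (simp add: field_simps)
    finally show "emeasure lborel {y \<in> crescent e x. dist y b \<le> r} \<le> ennreal (A * r powr real DIM('a))" .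
  qed (use s dx in \<open>auto simp: A_def\<close>)
  also have "A * (2 powr s * (3 * d x) powr (real DIM('a) - s) / (1 - 2 powr (- (real DIM('a) - s)))) = C * norm e * d x powr (real DIM('a) - 1 - s)"
  proof -
    have "d x powr (real DIM('a) - s) = d x * d x powr (real DIM('a) - 1 - s)"
      using powr_add[of "d x" 1 "real DIM('a) - 1 - s"] dx by simp
    then show ?thesis unfolding A_def C_def using dx by (simp add: powr_mult)
  qed
  finally show ?thesis .
qed

section \<open>The layer of centres whose crescent contains a given point\<close>

definition shadow :: "'a \<Rightarrow> real \<Rightarrow> 'a \<Rightarrow> 'a set" where
  "shadow e \<tau> y = {x. \<tau> < d x \<and> y \<in> crescent e x}"

lemma sets_shadow [measurable]: "shadow e \<tau> y \<in> sets borel"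
  unfolding shadow_def crescent_def by measurable

text \<open>The Voronoi cell of y against the points of S: an intersection of half-spaces bounded by
  the perpendicular bisectors of y and b. Since the distance to S is attained, strict inequality
  against each b gives strict inequality against the distance.\<close>

lemma convex_closer: "convex {x. dist y x < d x}"
proof -
  have "dist y x < d x \<longleftrightarrow> (\<forall>b\<in>S. (2 *\<^sub>R (b - y)) \<bullet> x < b \<bullet> b - y \<bullet> y)" for x
  proof -
    have "dist y x < d x \<longleftrightarrow> (\<forall>b\<in>S. dist x y < dist x b)"
    proof
      assume "\<forall>b\<in>S. dist x y < dist x b"
      then show "dist y x < d x" using infdist_attains_inf[OF closed ne, of x] by (metis dist_commute)
    qed (use infdist_le[of _ S x] in \<open>fastforce simp: dist_commute\<close>)
    moreover have "dist x y < dist x b \<longleftrightarrow> (2 *\<^sub>R (b - y)) \<bullet> x < b \<bullet> b - y \<bullet> y" for b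
    proof -
      have "dist x y < dist x b \<longleftrightarrow> (norm (x - y))\<^sup>2 < (norm (x - b))\<^sup>2" by (simp add: dist_norm norm_lt power2_norm_eq_inner)
      also have "\<dots> \<longleftrightarrow> (2 *\<^sub>R (b - y)) \<bullet> x < b \<bullet> b - y \<bullet> y"
        unfolding power2_norm_eq_inner by (simp add: algebra_simps inner_commute)
      finally show ?thesis .
    qed
    ultimately show ?thesis by simp
  qed
  then have "{x. dist y x < d x} = (\<Inter>b\<in>S. {x. (2 *\<^sub>R (b - y)) \<bullet> x < b \<bullet> b - y \<bullet> y})" by auto
  then show ?thesis by (simp only:) (intro convex_INT convex_halfspace_lt)
qed

text \<open>A crescent is at most 2 |e| wide and \<open>d x\<close> exceeds 10 |e|, so
  \<open>d x\<close> and \<open>dist y x\<close> may be exchanged at the cost of the factor 12 /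
  10.\<close>

lemma shadow_dist:
  assumes "x \<in> shadow e \<tau> y" "10 * norm e \<le> \<tau>"
  shows "\<tau> < dist y x" "d x \<le> dist y x" "dist y x \<le> 12 / 10 * d x" "norm e \<le> dist y x / 10"
  using crescent_dist[of y e x] assms unfolding shadow_def by auto

lemma emeasure_shadow_le:
  assumes e: "0 < norm e" "10 * norm e \<le> \<tau>" and r: "r > 0"
  shows "emeasure lborel {x \<in> shadow e \<tau> y. dist y x \<le> r} \<le>
    ennreal (unit_ball_vol DIM('a) * 2 ^ (DIM('a) + 1) * norm e * r powr (real DIM('a) - 1))"
proof (cases "norm e \<le> r")
  case True
  have eq: "{x \<in> shadow e \<tau> y. dist y x \<le> r} = shadow e \<tau> y \<inter> cball y r" by auto
  show ?thesis unfolding eq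
  proof (rule emeasure_convex_layer_le[OF convex_closer[of y] _ _ _ e(1) True])
    show "x \<notin> {x. dist y x < d x} \<and> x + e \<in> {x. dist y x < d x}" if "x \<in> shadow e \<tau> y \<inter> cball y r" for x
      using that unfolding shadow_def crescent_def by auto
  qed auto
next
  \<comment> \<open>Below the scale |e| the set is empty, as \<open>dist y x\<close> is at least 10
    |e| in the shadow.\<close>
  case False
  have "x \<notin> shadow e \<tau> y" if "dist y x \<le> r" for x
    using shadow_dist(4)[of x e \<tau> y] False that e by auto
  then have "{x \<in> shadow e \<tau> y. dist y x \<le> r} = {}" by auto
  then show ?thesis by (simp only: emeasure_empty zero_le)
qed

section \<open>The kernel of the crescent operator and its column integrals\<close>

definition kern :: "real \<Rightarrow> 'a \<Rightarrow> real \<Rightarrow> 'a \<Rightarrow> 'a \<Rightarrow> real" where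
  "kern \<alpha> e \<tau> x y = d x powr (\<alpha> - real DIM('a)) * indicator (shadow e \<tau> y) x"

lemma borel_measurable_kern [measurable]: "case_prod (kern \<alpha> e \<tau>) \<in> borel_measurable (borel \<Otimes>\<^sub>M borel)"
  unfolding kern_def shadow_def crescent_def indicator_def by measurable

lemma kern_nonneg: "kern \<alpha> e \<tau> x y \<ge> 0"
  unfolding kern_def by simp

lemma kern_le:
  assumes "10 * norm e \<le> \<tau>" "\<alpha> \<le> real DIM('a)" "0 < norm e"
  shows "kern \<alpha> e \<tau> x y \<le> (12 / 10) powr (real DIM('a) - \<alpha>) * dist y x powr (- (real DIM('a) - \<alpha>)) * indicator (shadow e \<tau> y) x"
proof (cases "x \<in> shadow e \<tau> y")
  case True
  have s: "dist y x \<le> 12 / 10 * d x" "0 < dist y x" using shadow_dist[OF True assms(1)] assms by linarith+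
  have "d x powr (\<alpha> - real DIM('a)) \<le> (dist y x / (12 / 10)) powr (\<alpha> - real DIM('a))"
    using s assms by (intro powr_mono2') auto
  also have "\<dots> = (12 / 10) powr (real DIM('a) - \<alpha>) * dist y x powr (- (real DIM('a) - \<alpha>))"
  proof -
    have "(r / q) powr (- t) = q powr t * r powr (- t)" if "r > 0" "q > 0" for r q t :: real
      using that by (simp add: powr_divide powr_minus field_simps)
    from this[OF s(2), of "12 / 10" "real DIM('a) - \<alpha>"] show ?thesis by simp
  qed
  finally show ?thesis using True by (simp add: kern_def)
qed (simp add: kern_def)

text \<open>The layer within r of y has measure of order \<open>|e| r^(n-1)\<close> and the kernel
  is of order \<open>r^(\<alpha>-n)\<close>. The exponent n - \<alpha> is below n - 1 because
  \<alpha> > 1, so the scales below R sum to a multiple of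
  \<open>|e| R^(\<alpha>-1)\<close>.\<close>

lemma kern_column_subcritical:
  assumes e: "0 < norm e" "10 * norm e \<le> \<tau>" and \<alpha>: "1 < \<alpha>" "\<alpha> < real DIM('a)"
    and R: "R > 0" "\<And>x. x \<in> shadow e \<tau> y \<Longrightarrow> dist y x \<le> R"
  shows "(\<integral>\<^sup>+x. ennreal (kern \<alpha> e \<tau> x y) \<partial>lborel) \<le>
    ennreal (2 ^ DIM('a) * (unit_ball_vol DIM('a) * 2 ^ (DIM('a) + 1) * norm e * (2 ^ DIM('a) * R powr (\<alpha> - 1) / (1 - 2 powr (- (\<alpha> - 1))))))"
proof -
  let ?s = "real DIM('a) - \<alpha>"
  define A where "A = unit_ball_vol DIM('a) * 2 ^ (DIM('a) + 1) * norm e"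
  have c: "(12 / 10) powr ?s \<le> 2 ^ DIM('a)" "2 powr ?s \<le> 2 ^ DIM('a)"
  proof -
    have "(12 / 10) powr ?s \<le> 2 powr ?s" using \<alpha> by (intro powr_mono2) auto
    moreover have "2 powr ?s \<le> 2 powr real DIM('a)" using \<alpha> by (intro powr_mono) auto
    ultimately show "(12 / 10) powr ?s \<le> 2 ^ DIM('a)" "2 powr ?s \<le> 2 ^ DIM('a)" by (auto simp: powr_realpow)
  qed
  have "(\<integral>\<^sup>+x. ennreal (kern \<alpha> e \<tau> x y) \<partial>lborel) \<le>
    (\<integral>\<^sup>+x. ennreal (2 ^ DIM('a)) * (ennreal (dist y x powr (- ?s)) * indicator (shadow e \<tau> y) x) \<partial>lborel)"
  proof (rule nn_integral_mono)
    fix x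
    have "kern \<alpha> e \<tau> x y \<le> (12 / 10) powr ?s * dist y x powr (- ?s) * indicator (shadow e \<tau> y) x"
      by (rule kern_le) (use e \<alpha> in auto)
    also have "\<dots> \<le> 2 ^ DIM('a) * dist y x powr (- ?s) * indicator (shadow e \<tau> y) x"
      using c by (intro mult_right_mono) auto
    finally show "ennreal (kern \<alpha> e \<tau> x y) \<le> ennreal (2 ^ DIM('a)) * (ennreal (dist y x powr (- ?s)) * indicator (shadow e \<tau> y) x)"
      by (auto simp: ennreal_mult[symmetric] indicator_def ennreal_neg split: if_splits intro: ennreal_leI)
  qed
  also have "\<dots> = ennreal (2 ^ DIM('a)) * (\<integral>\<^sup>+x\<in>shadow e \<tau> y. ennreal (dist y x powr (- ?s)) \<partial>lborel)"
    by (subst nn_integral_cmult) auto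
  also have "\<dots> \<le> ennreal (2 ^ DIM('a)) * ennreal (A * (2 powr ?s * R powr (real DIM('a) - 1 - ?s) / (1 - 2 powr (- (real DIM('a) - 1 - ?s)))))"
  proof (intro mult_left_mono nn_integral_powr_neg_near_le)
    show "0 < dist y x \<and> dist y x \<le> R" if "x \<in> shadow e \<tau> y" for x
      using R(2)[OF that] shadow_dist(1)[OF that e(2)] e by linarith
    show "emeasure lborel {x \<in> shadow e \<tau> y. dist y x \<le> r} \<le> ennreal (A * r powr (real DIM('a) - 1))" if "0 < r" for r
      unfolding A_def by (rule emeasure_shadow_le[OF e that])
  qed (use R \<alpha> in \<open>auto simp: A_def\<close>)
  also have "\<dots> \<le> ennreal (2 ^ DIM('a)) * ennreal (A * (2 ^ DIM('a) * R powr (\<alpha> - 1) / (1 - 2 powr (- (\<alpha> - 1)))))"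
  proof -
    have "1 - 2 powr (- (\<alpha> - 1)) > 0" using \<alpha> powr_less_mono[of "- (\<alpha> - 1)" 0 2] by simp
    moreover have "real DIM('a) - 1 - ?s = \<alpha> - 1" by simp
    ultimately show ?thesis unfolding A_def using c(2)
      by (intro mult_left_mono ennreal_leI) (auto intro!: divide_right_mono mult_right_mono)
  qed
  also have "\<dots> = ennreal (2 ^ DIM('a) * (A * (2 ^ DIM('a) * R powr (\<alpha> - 1) / (1 - 2 powr (- (\<alpha> - 1))))))"
    by (rule ennreal_mult'[symmetric]) simp
  finally show ?thesis unfolding A_def .
qed

lemma powr_contact_ratio_le:
  assumes "x \<in> shadow e \<tau> y" "0 < norm e" "10 * norm e \<le> \<tau>" "s \<ge> 0"
  shows "(contact_dist x y / d x) powr s \<le> 3 powr s"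
proof -
  have x: "y \<in> crescent e x" "\<tau> < d x" using assms unfolding shadow_def by auto
  then have "contact_dist x y \<le> 3 * d x" "0 < d x" using contact_dist_crescent[OF x(1)] assms by auto
  then show ?thesis using contact_dist_nonneg[of x y] assms by (intro powr_mono2) (auto simp: field_simps)
qed

text \<open>Away from the boundary only boundedly many scales of \<open>\<bar>x - y\<bar>\<close> occur, so that the sum over them
  does not produce a logarithm.\<close>

lemma kern_column_bounded_scales:
  assumes e: "0 < norm e" "10 * norm e \<le> \<tau>" and R: "0 < R" "R \<le> R'" and s: "s \<ge> 0"
    and x: "\<And>x. x \<in> shadow e \<tau> y \<Longrightarrow> dist y x \<le> R'"
  shows "(\<integral>\<^sup>+x\<in>{x. R \<le> d x}. ennreal (kern 1 e \<tau> x y * (contact_dist x y / d x) powr s) \<partial>lborel) \<le>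
    ennreal (3 powr s * R powr (1 - real DIM('a)) * (unit_ball_vol DIM('a) * 2 ^ (DIM('a) + 1) * norm e * R' powr (real DIM('a) - 1)))"
proof -
  have "(\<integral>\<^sup>+x\<in>{x. R \<le> d x}. ennreal (kern 1 e \<tau> x y * (contact_dist x y / d x) powr s) \<partial>lborel) \<le>
     (\<integral>\<^sup>+x. ennreal (3 powr s * R powr (1 - real DIM('a))) * indicator {x \<in> shadow e \<tau> y. dist y x \<le> R'} x \<partial>lborel)"
  proof (rule nn_integral_mono)
    fix x
    show "ennreal (kern 1 e \<tau> x y * (contact_dist x y / d x) powr s) * indicator {x. R \<le> d x} x \<le>
      ennreal (3 powr s * R powr (1 - real DIM('a))) * indicator {x \<in> shadow e \<tau> y. dist y x \<le> R'} x"
    proof (cases "x \<in> shadow e \<tau> y \<and> R \<le> d x")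
      case True
      have "d x powr (1 - real DIM('a)) * (contact_dist x y / d x) powr s \<le> R powr (1 - real DIM('a)) * 3 powr s"
        using True R powr_contact_ratio_le[of x e \<tau> y s] e s powr_mono2'[of "1 - real DIM('a)" R "d x"] by (intro mult_mono) auto
      then show ?thesis using True x by (simp add: kern_def mult.commute ennreal_leI)
    qed (auto simp: kern_def)
  qed
  also have "\<dots> = ennreal (3 powr s * R powr (1 - real DIM('a))) * emeasure lborel {x \<in> shadow e \<tau> y. dist y x \<le> R'}"
  proof (rule nn_integral_cmult_indicator)
    have "{x \<in> shadow e \<tau> y. dist y x \<le> R'} = shadow e \<tau> y \<inter> cball y R'" by auto
    then show "{x \<in> shadow e \<tau> y. dist y x \<le> R'} \<in> sets lborel" by simp
  qed
  also have "\<dots> \<le> ennreal (3 powr s * R powr (1 - real DIM('a))) * ennreal (unit_ball_vol DIM('a) * 2 ^ (DIM('a) + 1) * norm e * R' powr (real DIM('a) - 1))"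
    using R by (intro mult_left_mono emeasure_shadow_le e) auto
  finally show ?thesis by (simp add: ennreal_mult'[symmetric])
qed

text \<open>The critical case when nearest points are tangential: \<open>\<bar>y - b\<bar>\<^sup>2 \<lesssim> d x (d y + \<bar>e\<bar>)\<close> makes the sum
  over the scales of \<open>\<bar>x - y\<bar>\<close> geometric.\<close>

lemma kern_column_tangential:
  assumes e: "0 < norm e" "10 * norm e \<le> \<tau>" and s: "s > 0" and c: "c > 0"
    and x: "\<And>x. x \<in> shadow e \<tau> y \<Longrightarrow> x \<in> G \<Longrightarrow> (contact_dist x y)\<^sup>2 \<le> c * d x * (d y + norm e)"
  shows "(\<integral>\<^sup>+x\<in>G. ennreal (kern 1 e \<tau> x y * (contact_dist x y / d x) powr (2 * s)) \<partial>lborel) \<le>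
    ennreal (2 powr (real DIM('a) - 1) * (2 * c) powr s * 3 powr s * (unit_ball_vol DIM('a) * 2 ^ (DIM('a) + 1) * (2 powr (real DIM('a) - 1) / (1 - 2 powr (- s)))) * norm e)"
proof -
  define n where "n = real DIM('a)"
  have n: "n \<ge> 1" unfolding n_def by simp
  define w where "w = d y + norm e"
  have w: "w > 0" unfolding w_def using e infdist_nonneg[of y S] by linarith
  define A where "A = unit_ball_vol n * 2 ^ (DIM('a) + 1) * norm e"
  have A: "A \<ge> 0" unfolding A_def n_def by simp
  have "(\<integral>\<^sup>+x\<in>G. ennreal (kern 1 e \<tau> x y * (contact_dist x y / d x) powr (2 * s)) \<partial>lborel) \<le>
     (\<integral>\<^sup>+x. ennreal (2 powr (n - 1) * (2 * c * w) powr s) * (ennreal (dist y x powr (- (n - 1 + s))) * indicator (shadow e \<tau> y) x) \<partial>lborel)"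
  proof (rule nn_integral_mono)
    fix x
    show "ennreal (kern 1 e \<tau> x y * (contact_dist x y / d x) powr (2 * s)) * indicator G x \<le>
      ennreal (2 powr (n - 1) * (2 * c * w) powr s) * (ennreal (dist y x powr (- (n - 1 + s))) * indicator (shadow e \<tau> y) x)"
    proof (cases "x \<in> shadow e \<tau> y \<and> x \<in> G")
      case True
      then have x1: "x \<in> shadow e \<tau> y" by simp
      note sd = shadow_dist[OF x1 e(2)]
      let ?r = "dist y x"
      have r: "?r > 0" "d x > 0" "?r \<le> 2 * d x" using sd e by linarith+
      \<comment> \<open>The squared ratio is at most c w / d x, which is of order w / dist y x. The
        weight thus contributes an extra decay of order s in \<open>dist y x\<close>.\<close>
      have "(contact_dist x y / d x) powr (2 * s) = ((contact_dist x y / d x) powr 2) powr s"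
        by (simp add: powr_powr)
      also have "(contact_dist x y / d x) powr 2 = (contact_dist x y)\<^sup>2 / (d x)\<^sup>2"
        using contact_dist_nonneg[of x y] r by (simp add: powr_numeral power_divide)
      also have "((contact_dist x y)\<^sup>2 / (d x)\<^sup>2) powr s \<le> (2 * c * w / ?r) powr s"
      proof (rule powr_mono2)
        have "(contact_dist x y)\<^sup>2 / (d x)\<^sup>2 \<le> c * d x * w / (d x)\<^sup>2"
          using x[OF x1] True unfolding w_def by (intro divide_right_mono) auto
        also have "\<dots> = c * w / d x" using r by (simp add: power2_eq_square)
        also have "\<dots> \<le> c * w / (?r / 2)" using r c w by (intro divide_left_mono) auto
        finally show "(contact_dist x y)\<^sup>2 / (d x)\<^sup>2 \<le> 2 * c * w / ?r" by (simp add: mult_ac)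
      qed (use s in auto)
      finally have 1: "(contact_dist x y / d x) powr (2 * s) \<le> (2 * c * w / ?r) powr s" .
      have "kern 1 e \<tau> x y = d x powr (1 - n)" using x1 by (simp add: kern_def n_def)
      also have "\<dots> \<le> (?r / 2) powr (1 - n)" using r n by (intro powr_mono2') auto
      finally have "kern 1 e \<tau> x y * (contact_dist x y / d x) powr (2 * s) \<le> (?r / 2) powr (1 - n) * (2 * c * w / ?r) powr s"
        using 1 by (intro mult_mono) auto
      also have "\<dots> = 2 powr (n - 1) * (2 * c * w) powr s * ?r powr (- (n - 1 + s))"
        using r c w by (simp add: powr_divide powr_diff powr_minus powr_add field_simps)
      finally show ?thesis using True by (simp add: ennreal_mult[symmetric] ennreal_leI)
    qed (auto simp: kern_def)
  qed
  also have "\<dots> = ennreal (2 powr (n - 1) * (2 * c * w) powr s) * (\<integral>\<^sup>+x\<in>shadow e \<tau> y. ennreal (dist y x powr (- (n - 1 + s))) \<partial>lborel)"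
    by (subst nn_integral_cmult) auto
  also have "\<dots> \<le> ennreal (2 powr (n - 1) * (2 * c * w) powr s) * ennreal (A * (2 powr (n - 1) * (w / 3) powr (n - 1 - (n - 1 + s)) / (1 - 2 powr (- (n - 1 + s - (n - 1))))))"
  proof (intro mult_left_mono nn_integral_powr_neg_far_le)
    \<comment> \<open>From \<open>d y \<le> d x + dist y x \<le> 2 * dist y x\<close> and
      \<open>norm e \<le> dist y x / 10\<close>: no scale below w / 3 occurs. The power
      \<open>(w / 3) powr (- s)\<close> of the smallest scale cancels \<open>w powr s\<close>, and
      the bound becomes independent of y.\<close>
    show "w / 3 \<le> dist y x" if "x \<in> shadow e \<tau> y" for x
      using shadow_dist[OF that e(2)] infdist_triangle[of y S x] unfolding w_def by simp
    show "emeasure lborel {x \<in> shadow e \<tau> y. dist y x \<le> r} \<le> ennreal (A * r powr (n - 1))" if "w / 3 \<le> r" for r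
      unfolding A_def n_def by (rule emeasure_shadow_le[OF e]) (use w that in linarith)
  qed (use w A s n in auto)
  also have "\<dots> = ennreal (2 powr (n - 1) * (2 * c * w) powr s * (A * (2 powr (n - 1) * (w / 3) powr (n - 1 - (n - 1 + s)) / (1 - 2 powr (- (n - 1 + s - (n - 1)))))))"
    by (rule ennreal_mult'[symmetric]) simp
  also have "2 powr (n - 1) * (2 * c * w) powr s * (A * (2 powr (n - 1) * (w / 3) powr (n - 1 - (n - 1 + s)) / (1 - 2 powr (- (n - 1 + s - (n - 1))))))
     = 2 powr (n - 1) * (2 * c) powr s * 3 powr s * (unit_ball_vol n * 2 ^ (DIM('a) + 1) * (2 powr (n - 1) / (1 - 2 powr (- s)))) * norm e"
  proof -
    have "(2 * c * w) powr s * (w / 3) powr (- s) = (2 * c) powr s * 3 powr s"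
      using w c by (simp add: powr_mult powr_divide powr_minus field_simps)
    moreover have "n - 1 - (n - 1 + s) = - s" "n - 1 + s - (n - 1) = s" by auto
    ultimately show ?thesis unfolding A_def by (simp add: mult_ac)
  qed
  finally show ?thesis unfolding n_def .
qed

end

lemma nn_integral_lborel_translate:
  fixes f :: "'a::euclidean_space \<Rightarrow> ennreal"
  assumes [measurable]: "f \<in> borel_measurable borel"
  shows "(\<integral>\<^sup>+x. f (c + x) \<partial>lborel) = (\<integral>\<^sup>+x. f x \<partial>lborel)"
proof -
  have "(\<integral>\<^sup>+x. f x \<partial>lborel) = (\<integral>\<^sup>+x. f x \<partial>distr lborel borel ((+) c))"
    by (simp add: lborel_distr_plus)
  also have "\<dots> = (\<integral>\<^sup>+x. f (c + x) \<partial>lborel)" by (subst nn_integral_distr) auto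
  finally show ?thesis ..
qed

context closed_complement
begin

text \<open>Let b be nearest to the earlier point y + t \<theta> and \<beta> = b - y. The maximal
  ball at that point leaves y outside, which gives
  \<open>|\<beta>|^2 \<le> 2 t (\<theta> \<bullet> \<beta>)\<close>. At the later point b still
  obstructs: y must be nearer to the shifted centre than b, which gives \<open>2 t' (\<theta>
  \<bullet> \<beta>) + 2 (e \<bullet> \<beta>) < |\<beta>|^2\<close>. Eliminating the inner product
  bounds \<open>(t' - t) |\<beta>|\<close> by \<open>2 t |e|\<close>, and the lower bound on the
  weight means \<open>|\<beta>| \<ge> \<mu> t\<close>.\<close>

lemma shadow_ray_gap:
  assumes t: "0 < t" "t < t'" and \<theta>: "1 \<le> norm \<theta>" and \<mu>: "0 < \<mu>" "\<mu> \<le> contact_dist (y + t *\<^sub>R \<theta>) y / norm (t *\<^sub>R \<theta>)"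
    and sh: "y + t *\<^sub>R \<theta> \<in> shadow e \<tau> y" "y + t' *\<^sub>R \<theta> \<in> shadow e \<tau> y"
  shows "t' - t \<le> 2 * norm e / \<mu>"
proof -
  define x where "x = y + t *\<^sub>R \<theta>"
  obtain b where b: "b \<in> nearest x" "contact_dist x y = dist y b" using contact_dist_attained by blast
  have bS: "b \<in> S" "dist x b = d x" using b unfolding nearest_def by auto
  define \<beta> where "\<beta> = b - y"
  have "d x \<le> dist y x" using sh(1) unfolding shadow_def crescent_def x_def by simp
  then have "dist x b \<le> dist x y" using bS by (simp add: dist_commute)
  then have "norm (t *\<^sub>R \<theta> - \<beta>) \<le> norm (t *\<^sub>R \<theta>)"
    unfolding x_def \<beta>_def dist_norm by (simp add: algebra_simps)
  then have 1: "\<beta> \<bullet> \<beta> \<le> 2 * t * (\<theta> \<bullet> \<beta>)"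
    unfolding norm_le by (simp add: algebra_simps inner_commute)
  have "dist y (y + t' *\<^sub>R \<theta> + e) < d (y + t' *\<^sub>R \<theta> + e)" using sh(2) unfolding shadow_def crescent_def by simp
  also have "\<dots> \<le> dist (y + t' *\<^sub>R \<theta> + e) b" by (rule infdist_le[OF bS(1)])
  finally have "dist y (y + t' *\<^sub>R \<theta> + e) < dist (y + t' *\<^sub>R \<theta> + e) b" .
  moreover have "y - (y + t' *\<^sub>R \<theta> + e) = - (t' *\<^sub>R \<theta> + e)" "y + t' *\<^sub>R \<theta> + e - b = t' *\<^sub>R \<theta> + e - \<beta>"
    unfolding \<beta>_def by auto
  ultimately have "norm (t' *\<^sub>R \<theta> + e) < norm (t' *\<^sub>R \<theta> + e - \<beta>)"
    by (simp only: dist_norm norm_minus_cancel)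
  then have 2: "2 * t' * (\<theta> \<bullet> \<beta>) + 2 * (e \<bullet> \<beta>) < \<beta> \<bullet> \<beta>"
    unfolding norm_lt by (simp add: algebra_simps inner_commute)
  have eb: "- (e \<bullet> \<beta>) \<le> norm e * norm \<beta>" using Cauchy_Schwarz_ineq2[of e \<beta>] by linarith
  have nb: "\<mu> * t \<le> norm \<beta>"
  proof -
    have t1: "t \<le> norm (t *\<^sub>R \<theta>)" using t \<theta> by simp
    then have pos: "0 < norm (t *\<^sub>R \<theta>)" using t by linarith
    have "\<mu> * t \<le> \<mu> * norm (t *\<^sub>R \<theta>)" using t1 \<mu>(1) by (intro mult_left_mono) auto
    also have "\<dots> \<le> contact_dist x y" using \<mu>(2) unfolding x_def[symmetric] pos_le_divide_eq[OF pos] .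
    also have "\<dots> = norm \<beta>" unfolding b(2) \<beta>_def by (simp add: dist_norm norm_minus_commute)
    finally show ?thesis .
  qed
  have pos: "norm \<beta> > 0" using nb \<mu>(1) t(1) by (smt (verit) mult_pos_pos)
  have "(t' - t) * (\<beta> \<bullet> \<beta>) \<le> (t' - t) * (2 * t * (\<theta> \<bullet> \<beta>))" using 1 t by (intro mult_left_mono) auto
  also have "\<dots> = t * (2 * t' * (\<theta> \<bullet> \<beta>) - 2 * t * (\<theta> \<bullet> \<beta>))" by (simp add: algebra_simps)
  also have "\<dots> \<le> t * (2 * norm e * norm \<beta>)" using 1 2 eb t by (intro mult_left_mono) auto
  finally have "((t' - t) * norm \<beta>) * norm \<beta> \<le> (t * (2 * norm e)) * norm \<beta>"
    by (simp add: dot_square_norm power2_eq_square mult_ac)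
  then have "(t' - t) * norm \<beta> \<le> t * (2 * norm e)" using pos by (simp only: mult_le_cancel_right_pos)
  moreover have "(t' - t) * (\<mu> * t) \<le> (t' - t) * norm \<beta>" using nb t by (intro mult_left_mono) auto
  ultimately have "t * ((t' - t) * \<mu>) \<le> t * (2 * norm e)" by (simp add: mult_ac)
  then have "(t' - t) * \<mu> \<le> 2 * norm e" using t by simp
  then show ?thesis using \<mu>(1) by (simp add: pos_le_divide_eq)
qed

text \<open>The set of t with weight at least l has diameter at most 2 |e| / l, so its measure times
  \<open>l^s\<close> is of order \<open>|e| l^(s-1)\<close>, summable over dyadic l because s >
  1.\<close>

lemma shadow_ray_integral_le:
  assumes e: "0 < norm e" "10 * norm e \<le> \<tau>" and s: "s > 1" and \<theta>: "1 \<le> norm \<theta>"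
  shows "(\<integral>\<^sup>+t\<in>{0<..}. ennreal (indicator (shadow e \<tau> y) (y + t *\<^sub>R \<theta>) * (contact_dist (y + t *\<^sub>R \<theta>) y / norm (t *\<^sub>R \<theta>)) powr s) \<partial>lborel)
    \<le> ennreal (4 * norm e * 2 powr (2 * s - 1) / (1 - 2 powr (- (s - 1))))"
proof -
  define v where "v t = contact_dist (y + t *\<^sub>R \<theta>) y / norm (t *\<^sub>R \<theta>)" for t
  \<comment> \<open>The levels start at 2 because the weight never exceeds 4; for some j it lies
    between \<open>l j\<close> and \<open>2 * l j\<close>.\<close>
  define l where "l k = 2 powr (1 - real k)" for k :: nat
  define E where "E k = {t. 0 < t \<and> y + t *\<^sub>R \<theta> \<in> shadow e \<tau> y \<and> l k \<le> v t}" for k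
  have [measurable]: "v \<in> borel_measurable borel" unfolding v_def by measurable
  have l: "l k > 0" for k unfolding l_def by simp
  show ?thesis unfolding v_def[symmetric]
  proof (rule nn_integral_le_suminf[where E = E and c = "\<lambda>k. (2 * l k) powr s" and d = "\<lambda>k. 2 * (2 * norm e / l k)"])
    show "E k \<in> sets lborel" for k unfolding E_def by measurable
    show "emeasure lborel (E k) \<le> ennreal (2 * (2 * norm e / l k))" for k
      using l[of k] by (intro emeasure_le_of_diameter) (auto simp: E_def v_def intro!: shadow_ray_gap[OF _ _ \<theta> l])
    show "(2 * l k) powr s * (2 * (2 * norm e / l k)) = 4 * norm e * 2 powr (2 * s - 1) * 2 powr (- (s - 1) * real k)" for k
    proof -
      have "2 * l k = 2 powr (2 - real k)" unfolding l_def using powr_add[of 2 1 "1 - real k"] by simp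
      then have A: "(2 * l k) powr s = 2 powr ((2 - real k) * s)" by (simp only: powr_powr)
      have "(2 * l k) powr s / l k = 2 powr ((2 - real k) * s - (1 - real k))"
        unfolding A by (simp only: l_def powr_diff)
      also have "(2 - real k) * s - (1 - real k) = (2 * s - 1) + - (s - 1) * real k" by (simp add: algebra_simps)
      finally have "(2 * l k) powr s / l k = 2 powr (2 * s - 1) * 2 powr (- (s - 1) * real k)"
        by (simp only: powr_add)
      moreover have "(2 * l k) powr s * (2 * (2 * norm e / l k)) = 4 * norm e * ((2 * l k) powr s / l k)" by simp
      ultimately show ?thesis by (simp only: mult.assoc)
    qed
    show "ennreal (indicator (shadow e \<tau> y) (y + t *\<^sub>R \<theta>) * v t powr s) * indicator {0<..} t
       \<le> (\<Sum>k. ennreal ((2 * l k) powr s) * indicator (E k) t)" for t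
    proof (cases "0 < t \<and> y + t *\<^sub>R \<theta> \<in> shadow e \<tau> y")
      case True
      define x where "x = y + t *\<^sub>R \<theta>"
      have xs: "x \<in> shadow e \<tau> y" using True unfolding x_def by simp
      have r: "dist y x = norm (t *\<^sub>R \<theta>)" unfolding x_def by (simp add: dist_norm)
      note sd = shadow_dist[OF xs e(2)]
      have yc: "y \<in> crescent e x" using xs unfolding shadow_def by simp
      have "0 < contact_dist x y" "contact_dist x y \<le> 4 * dist y x" using contact_dist_crescent[OF yc] sd e by auto
      moreover have "v t = contact_dist x y / dist y x" unfolding v_def r by (simp only: x_def)
      moreover have "0 < dist y x" using sd e by linarith
      ultimately have v: "0 < v t" "v t \<le> 4" by (auto simp: pos_divide_le_eq)
      obtain j where j: "2 ^ j * v t \<le> 4" "4 \<le> 2 ^ Suc j * v t" using dyadic_exists[OF v] by blast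
      have lj: "l j = 2 / 2 ^ j" unfolding l_def by (simp add: powr_diff powr_realpow)
      have "l j \<le> v t" "v t \<le> 2 * l j" using j unfolding lj by (simp_all add: field_simps)
      then show ?thesis using True s v
        by (intro le_suminf_indicator[of _ _ j]) (auto simp: E_def intro!: ennreal_leI powr_mono2)
    qed auto
  qed (use e s l in \<open>auto simp: less_imp_le\<close>)
qed

text \<open>Grazing directions are damped by the weight: along a ray from \<open>y\<close> the weight \<open>\<bar>y - b\<bar> / \<bar>y - x\<bar>\<close> can
  exceed \<open>\<lambda>\<close> only on a set of diameter \<open>2 \<bar>e\<bar> / \<lambda>\<close>, hence an exponent \<open>s > 1\<close> suffices.\<close>

lemma kern_column_rays:
  assumes e: "0 < norm e" "10 * norm e \<le> \<tau>" and s: "s > 1"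
  shows "(\<integral>\<^sup>+x. ennreal (kern 1 e \<tau> x y * (contact_dist x y / d x) powr s) \<partial>lborel) \<le>
    ennreal (2 powr (real DIM('a) - 1 + s) * (2 * (4 * 2 powr (2 * s - 1) / (1 - 2 powr (- (s - 1)))) * unit_ball_vol DIM('a) * 2 ^ DIM('a)) * norm e)"
proof -
  define n where "n = real DIM('a)"
  define H where "H z = ennreal (indicator (shadow e \<tau> y) (y + z) * (contact_dist (y + z) y / norm z) powr s)" for z
  have [measurable]: "H \<in> borel_measurable borel" unfolding H_def by measurable
  define c where "c = 4 * norm e * 2 powr (2 * s - 1) / (1 - 2 powr (- (s - 1)))"
  have "(\<integral>\<^sup>+x. ennreal (kern 1 e \<tau> x y * (contact_dist x y / d x) powr s) \<partial>lborel) =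
     (\<integral>\<^sup>+z. ennreal (kern 1 e \<tau> (y + z) y * (contact_dist (y + z) y / d (y + z)) powr s) \<partial>lborel)"
    by (rule nn_integral_lborel_translate[symmetric]) measurable
  also have "\<dots> \<le> (\<integral>\<^sup>+z. ennreal (2 powr (n - 1 + s)) * (H z * ennreal (norm z powr (1 - n))) \<partial>lborel)"
  proof (rule nn_integral_mono)
    fix z
    show "ennreal (kern 1 e \<tau> (y + z) y * (contact_dist (y + z) y / d (y + z)) powr s) \<le> ennreal (2 powr (n - 1 + s)) * (H z * ennreal (norm z powr (1 - n)))"
    proof (cases "y + z \<in> shadow e \<tau> y")
      case True
      note sd = shadow_dist[OF True e(2)]
      have r: "dist y (y + z) = norm z" by (simp add: dist_norm)
      have z: "norm z > 0" "norm z / 2 \<le> d (y + z)" "d (y + z) > 0" using sd e unfolding r by linarith+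
      have mn: "contact_dist (y + z) y \<ge> 0" by (rule contact_dist_nonneg)
      have "kern 1 e \<tau> (y + z) y * (contact_dist (y + z) y / d (y + z)) powr s = d (y + z) powr (1 - n - s) * contact_dist (y + z) y powr s"
        using True z mn powr_diff[of "d (y + z)" "1 - n" s] unfolding kern_def n_def by (simp add: powr_divide)
      also have "\<dots> \<le> (norm z / 2) powr (1 - n - s) * contact_dist (y + z) y powr s"
        using z s by (intro mult_right_mono powr_mono2') (auto simp: n_def)
      also have "\<dots> = 2 powr (n - 1 + s) * ((contact_dist (y + z) y / norm z) powr s * norm z powr (1 - n))"
        using z mn by (simp add: powr_divide powr_diff powr_minus powr_add field_simps)
      finally show ?thesis using True unfolding H_def by (simp add: ennreal_mult[symmetric] ennreal_leI)
    qed (simp add: kern_def)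
  qed
  also have "\<dots> = ennreal (2 powr (n - 1 + s)) * (\<integral>\<^sup>+z. H z * ennreal (norm z powr (1 - n)) \<partial>lborel)"
    by (rule nn_integral_cmult) measurable
  also have "\<dots> \<le> ennreal (2 powr (n - 1 + s)) * ennreal (2 * c * unit_ball_vol DIM('a) * 2 ^ DIM('a))"
    unfolding n_def
  proof (intro mult_left_mono nn_integral_le_rays)
    show "(\<integral>\<^sup>+t\<in>{0<..}. H (t *\<^sub>R \<theta>) \<partial>lborel) \<le> ennreal c" if "1 \<le> norm \<theta>" for \<theta>
      unfolding H_def c_def by (rule shadow_ray_integral_le[OF e s that])
  qed auto
  also have "\<dots> = ennreal (2 powr (n - 1 + s) * (2 * c * unit_ball_vol DIM('a) * 2 ^ DIM('a)))"
    by (rule ennreal_mult'[symmetric]) simp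
  also have "2 powr (n - 1 + s) * (2 * c * unit_ball_vol DIM('a) * 2 ^ DIM('a)) =
     2 powr (n - 1 + s) * (2 * (4 * 2 powr (2 * s - 1) / (1 - 2 powr (- (s - 1)))) * unit_ball_vol DIM('a) * 2 ^ DIM('a)) * norm e"
    unfolding c_def by (simp add: field_simps)
  finally show ?thesis unfolding n_def .
qed

section \<open>Tangential nearest points\<close>

text \<open>Convexity puts S in the half-space behind the hyperplane through b orthogonal to x - b.
  As y is within \<open>d y\<close> of S, it follows that
  \<open>(y - b) \<bullet> (x - b) \<le> d y * d x\<close>, which enters the first estimate of
  \<open>crescent_inner\<close>. The 5 dominates both 2 and 2 * 22 / 10, the latter from
  \<open>dist y b \<le> 22 / 10 * d x\<close>.\<close>

lemma crescent_tangential_convex: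
  assumes "convex S" "y \<in> crescent e x" "10 * norm e \<le> d x" "0 < norm e"
  shows "(contact_dist x y)\<^sup>2 \<le> 5 * d x * (d y + norm e)"
proof -
  obtain b where b: "b \<in> nearest x" "contact_dist x y = dist y b" using contact_dist_attained by blast
  have bS: "b \<in> S" "dist x b = d x" using b unfolding nearest_def by auto
  have dx: "d x > 0" using assms by linarith
  note ci = crescent_inner[OF assms(2) b(1)]
  have half: "(z - b) \<bullet> (x - b) \<le> 0" if "z \<in> S" for z
  proof -
    have "(x - b) \<bullet> (z - b) \<le> 0"
    proof (rule any_closest_point_dot[OF assms(1) closed bS(1) that])
      show "\<forall>z\<in>S. dist x b \<le> dist x z" using bS infdist_le by metis
    qed
    then show ?thesis by (simp add: inner_commute)
  qed
  obtain z where z: "z \<in> S" "d y = dist y z" by (rule infdist_attains_inf[OF closed ne])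
  have "(y - b) \<bullet> (x - b) = (y - z) \<bullet> (x - b) + (z - b) \<bullet> (x - b)" by (simp add: inner_diff_left)
  also have "\<dots> \<le> norm (y - z) * norm (x - b) + 0" by (intro add_mono norm_cauchy_schwarz half z)
  finally have 1: "(y - b) \<bullet> (x - b) \<le> d y * d x" using z bS by (simp add: dist_norm)
  have 2: "(y - b) \<bullet> e \<le> 22 / 10 * d x * norm e"
  proof -
    have "(y - b) \<bullet> e \<le> dist y b * norm e" using norm_cauchy_schwarz[of "y - b" e] by (simp add: dist_norm)
    also have "\<dots> \<le> 22 / 10 * d x * norm e" using ci(3) assms by (intro mult_right_mono) auto
    finally show ?thesis .
  qed
  have "(contact_dist x y)\<^sup>2 \<le> 2 * (d y * d x) + 2 * (22 / 10 * d x * norm e)"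
    using ci(1) 1 2 unfolding b(2) dist_norm by linarith
  also have "\<dots> \<le> 5 * (d y * d x) + 5 * (d x * norm e)"
  proof -
    have "0 \<le> d y * d x" "0 \<le> d x * norm e" using dx infdist_nonneg[of y S] by auto
    then show ?thesis by linarith
  qed
  finally show ?thesis by (simp add: algebra_simps)
qed

text \<open>With u = x - b and v = b' - b, minimality at the inner point gives
  \<open>|v|^2 \<le> 2 t (u \<bullet> v)\<close> and minimality at x gives
  \<open>2 (u \<bullet> v) \<le> |v|^2\<close>; since t < 1, only v = 0 is left. Moving from x
  towards b thus singles out b among the nearest points.\<close>

lemma nearest_unique_inner:
  assumes "b \<in> nearest x" "0 < t" "t < 1" "b' \<in> nearest (b + t *\<^sub>R (x - b))"
  shows "b' = b"
proof -
  have b: "b \<in> S" "dist x b = d x" and b': "b' \<in> S" "dist (b + t *\<^sub>R (x - b)) b' = d (b + t *\<^sub>R (x - b))"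
    using assms unfolding nearest_def by auto
  define u v where "u = x - b" and "v = b' - b"
  have "dist (b + t *\<^sub>R (x - b)) b' \<le> dist (b + t *\<^sub>R (x - b)) b" unfolding b' by (rule infdist_le[OF b(1)])
  then have "norm (t *\<^sub>R u - v) \<le> norm (t *\<^sub>R u)" unfolding u_def v_def dist_norm by (simp add: algebra_simps)
  then have 1: "v \<bullet> v \<le> 2 * t * (u \<bullet> v)" unfolding norm_le by (simp add: algebra_simps inner_commute)
  have "dist x b \<le> dist x b'" unfolding b by (rule infdist_le[OF b'(1)])
  then have "norm u \<le> norm (u - v)" unfolding u_def v_def dist_norm by (simp add: algebra_simps)
  then have 2: "2 * (u \<bullet> v) \<le> v \<bullet> v" unfolding norm_le by (simp add: algebra_simps inner_commute)
  have "u \<bullet> v \<le> 0"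
  proof (rule ccontr)
    assume "\<not> u \<bullet> v \<le> 0"
    then have "2 * t * (u \<bullet> v) < 2 * 1 * (u \<bullet> v)" using assms by (intro mult_strict_right_mono) auto
    then show False using 1 2 by linarith
  qed
  then have "2 * t * (u \<bullet> v) \<le> 0" using assms by (intro mult_nonneg_nonpos) auto
  then have "v \<bullet> v \<le> 0" using 1 by linarith
  then have "v \<bullet> v = 0" using inner_ge_zero[of v] by linarith
  then show ?thesis unfolding v_def by simp
qed

text \<open>The ball of radius R touching S at b avoids S, so its centre w satisfies
  \<open>dist y w \<ge> R - d y\<close>. Expanding the square bounds
  \<open>(y - b) \<bullet> (x - b)\<close> by \<open>d y * d x\<close> and a multiple of
  \<open>(norm (y - b))\<^sup>2\<close> that can be absorbed because
  \<open>d x \<le> R / 2\<close>.\<close>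

lemma crescent_tangential_curvature:
  assumes R: "R > 0" and curv: "\<And>x. x \<notin> S \<Longrightarrow> \<exists>b\<in>S. dist x b = d x \<and> ball (b + (R / d x) *\<^sub>R (x - b)) R \<subseteq> - S"
    and y: "y \<in> crescent e x" "10 * norm e \<le> d x" "0 < norm e" "d x \<le> R / 2"
  shows "(contact_dist x y)\<^sup>2 \<le> 9 * d x * (d y + norm e)"
proof -
  obtain b where b: "b \<in> nearest x" "contact_dist x y = dist y b" using contact_dist_attained by blast
  have bS: "b \<in> S" "dist x b = d x" using b unfolding nearest_def by auto
  have dx: "d x > 0" using y by linarith
  define w where "w = b + (R / d x) *\<^sub>R (x - b)"
  have ball: "ball w R \<subseteq> - S"
  proof -
    \<comment> \<open>The hypothesis provides a ball for some nearest point, perhaps not for the b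
      that realises \<open>contact_dist\<close>. At the midpoint x' the only nearest point is b, and
      the ball determined there is the one about w.\<close>
    define x' where "x' = b + (1/2) *\<^sub>R (x - b)"
    obtain b'' where "b'' \<in> nearest x'" using nearest_nonempty by blast
    then have bx': "b \<in> nearest x'" using nearest_unique_inner[OF b(1), of "1/2" b''] unfolding x'_def by simp
    then have dx': "d x' = d x / 2" using bS unfolding nearest_def x'_def by (simp add: dist_norm)
    have "x' \<notin> S"
    proof
      assume "x' \<in> S" then have "d x' = 0" by simp
      then show False using dx dx' by simp
    qed
    then obtain b' where b': "b' \<in> S" "dist x' b' = d x'" "ball (b' + (R / d x') *\<^sub>R (x' - b')) R \<subseteq> - S"
      using curv by blast
    then have "b' = b" using nearest_unique_inner[OF b(1), of "1/2" b'] unfolding nearest_def x'_def by simp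
    moreover have "b + (R / d x') *\<^sub>R (x' - b) = w"
    proof -
      have "x' - b = (1/2) *\<^sub>R (x - b)" unfolding x'_def by simp
      then show ?thesis unfolding dx' w_def by simp
    qed
    ultimately show ?thesis using b'(3) by simp
  qed
  have dw: "R - dist y w \<le> d y"
  proof -
    obtain z where z: "z \<in> S" "d y = dist y z" by (rule infdist_attains_inf[OF closed ne])
    then have "R \<le> dist w z" using ball by (auto simp: subset_iff not_less[symmetric])
    then show ?thesis using z dist_triangle[of w z y] by (simp add: dist_commute)
  qed
  note ci = crescent_inner[OF y(1) b(1)]
  define N where "N = dist y b"
  have N: "N > 0" "N \<le> 22 / 10 * d x" using ci(2,3) y unfolding N_def by auto
  have ye: "(y - b) \<bullet> e \<le> 22 / 10 * d x * norm e"
  proof -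
    have "(y - b) \<bullet> e \<le> N * norm e" using norm_cauchy_schwarz[of "y - b" e] by (simp add: N_def dist_norm)
    also have "\<dots> \<le> 22 / 10 * d x * norm e" using N y by (intro mult_right_mono) auto
    finally show ?thesis .
  qed
  have dyn: "d y \<ge> 0" by (rule infdist_nonneg)
  have "N\<^sup>2 \<le> 9 * d x * (d y + norm e)"
  \<comment> \<open>If \<open>d y\<close> exceeds R, then \<open>d x \<le> R / 2 < d y\<close>, and
    \<open>dist y b \<le> 3 * d x\<close> is enough. Otherwise R - d y is nonnegative, so the lower
    bound on \<open>dist y w\<close> may be squared.\<close>
  proof (cases "d y \<le> R")
    case True
    then have "(R - d y)\<^sup>2 \<le> (dist y w)\<^sup>2" using dw by (intro power_mono) auto
    also have "(dist y w)\<^sup>2 = N\<^sup>2 - 2 * (R / d x) * ((y - b) \<bullet> (x - b)) + R\<^sup>2"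
    proof -
      have "y - w = (y - b) - (R / d x) *\<^sub>R (x - b)" unfolding w_def by simp
      then have "(dist y w)\<^sup>2 = (norm ((y - b) - (R / d x) *\<^sub>R (x - b)))\<^sup>2" by (simp only: dist_norm)
      also have "\<dots> = N\<^sup>2 - 2 * (R / d x) * ((y - b) \<bullet> (x - b)) + (R / d x)\<^sup>2 * (norm (x - b))\<^sup>2"
      proof -
        have "(norm (u - c *\<^sub>R v))\<^sup>2 = (norm u)\<^sup>2 - 2 * c * (u \<bullet> v) + c\<^sup>2 * (norm v)\<^sup>2" for c and u v :: 'a
          unfolding power2_norm_eq_inner by (simp add: algebra_simps inner_commute power2_eq_square)
        then show ?thesis unfolding N_def dist_norm .
      qed
      also have "(R / d x)\<^sup>2 * (norm (x - b))\<^sup>2 = R\<^sup>2"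
        using bS dx by (simp add: dist_norm[symmetric] power_divide)
      finally show ?thesis .
    qed
    finally have "2 * (R / d x) * ((y - b) \<bullet> (x - b)) \<le> N\<^sup>2 + 2 * R * d y - (d y)\<^sup>2"
      by (simp add: power2_diff)
    then have "2 * (R / d x) * ((y - b) \<bullet> (x - b)) \<le> N\<^sup>2 + 2 * R * d y"
      using zero_le_power2[of "d y"] by linarith
    then have "2 * ((y - b) \<bullet> (x - b)) * R \<le> (N\<^sup>2 + 2 * R * d y) * d x"
      using dx by (simp add: field_simps)
    moreover have "N\<^sup>2 * d x \<le> N\<^sup>2 * (R / 2)" using y by (intro mult_left_mono) auto
    ultimately have "2 * ((y - b) \<bullet> (x - b)) * R \<le> (N\<^sup>2 / 2 + 2 * d y * d x) * R"
      by (simp add: algebra_simps)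
    then have "2 * ((y - b) \<bullet> (x - b)) \<le> N\<^sup>2 / 2 + 2 * d y * d x" using R by (simp only: mult_le_cancel_right_pos)
    moreover have "N\<^sup>2 < 2 * ((y - b) \<bullet> (x - b)) + 2 * ((y - b) \<bullet> e)" using ci(1) unfolding N_def dist_norm .
    ultimately have "N\<^sup>2 \<le> 4 * (d y * d x) + 88 / 10 * (d x * norm e)" using ye by argo
    also have "\<dots> \<le> 9 * (d y * d x) + 9 * (d x * norm e)"
    proof -
      have "0 \<le> d y * d x" "0 \<le> d x * norm e" using dx dyn by auto
      then show ?thesis by linarith
    qed
    finally show ?thesis by (simp add: algebra_simps)
  next
    case False
    have "N\<^sup>2 \<le> (3 * d x)\<^sup>2" using N dx by (intro power_mono) auto
    also have "\<dots> = 9 * d x * d x" by (simp add: power2_eq_square)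
    also have "\<dots> \<le> 9 * d x * (d y + norm e)"
    proof (rule mult_left_mono)
      show "d x \<le> d y + norm e" using False y norm_ge_zero[of e] dx by linarith
    qed (use dx in simp)
    finally show ?thesis .
  qed
  then show ?thesis unfolding b(2) N_def .
qed

section \<open>Lebesgue space bounds for the crescent operator\<close>

definition crescent_const :: "real \<Rightarrow> real" where
  "crescent_const s = unit_ball_vol DIM('a) * 2 ^ DIM('a) * 6 * (2 powr s * 3 powr (real DIM('a) - s) / (1 - 2 powr (- (real DIM('a) - s))))"

lemma crescent_const_pos:
  assumes "s < real DIM('a)"
  shows "crescent_const s > 0"
proof -
  have "2 powr (- (real DIM('a) - s)) < 2 powr 0" using assms by (intro powr_less_mono) auto
  then show ?thesis unfolding crescent_const_def by simp
qed

text \<open>Schur's test with the weight \<open>(contact_dist x y / d x) powr (- \<gamma>)\<close>.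
  Rows cost a multiple of |e| by \<open>crescent_weight_le\<close> with s = \<gamma> p / (p - 1),
  columns cost \<open>Y * norm e\<close>; the row bound enters with the power p - 1, so the total
  power of |e| is p.\<close>

lemma crescent_operator_Lp:
  fixes F :: "'a \<Rightarrow> real"
  assumes p: "p > 1" and [measurable]: "F \<in> borel_measurable borel" and F: "\<And>y. F y \<ge> 0"
    and e: "0 < norm e" "10 * norm e \<le> \<tau>" and \<gamma>: "\<gamma> \<ge> 0" "\<gamma> * (p / (p - 1)) < real DIM('a)"
    and D: "D > 0" "\<And>x. \<tau> < d x \<Longrightarrow> d x powr (\<alpha> - 1) \<le> D"
    and Y: "Y \<ge> 0" "\<And>y. F y \<noteq> 0 \<Longrightarrow> (\<integral>\<^sup>+x. ennreal (kern \<alpha> e \<tau> x y * (contact_dist x y / d x) powr (\<gamma> * p)) \<partial>lborel) \<le> ennreal (Y * norm e)"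
  shows "(\<integral>\<^sup>+x. ennreal (enn2real (\<integral>\<^sup>+y. ennreal (kern \<alpha> e \<tau> x y * F y) \<partial>lborel) powr p) \<partial>lborel) \<le>
    ennreal ((crescent_const (\<gamma> * (p / (p - 1))) * D) powr (p - 1) * Y * norm e powr p) * (\<integral>\<^sup>+y. ennreal (F y powr p) \<partial>lborel)"
proof -
  define s where "s = \<gamma> * (p / (p - 1))"
  define n where "n = real DIM('a)"
  have s: "0 \<le> s" "s < n" using \<gamma> p unfolding s_def n_def by auto
  define C where "C = crescent_const s"
  have C: "C > 0" unfolding C_def using crescent_const_pos s n_def by simp
  have shd: "y \<in> crescent e x \<and> \<tau> < d x \<and> 0 < d x \<and> 0 < contact_dist x y" if "x \<in> shadow e \<tau> y" for x y
  proof -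
    have "y \<in> crescent e x" "\<tau> < d x" using that unfolding shadow_def by auto
    moreover from this have "0 < d x" using e by linarith
    ultimately show ?thesis using contact_dist_crescent(1)[of y e x] by auto
  qed
  have "(\<integral>\<^sup>+x. ennreal (enn2real (\<integral>\<^sup>+y. ennreal (kern \<alpha> e \<tau> x y * F y) \<partial>lborel) powr p) \<partial>lborel) \<le>
     ennreal ((C * D * norm e) powr (p - 1)) * (ennreal (Y * norm e) * (\<integral>\<^sup>+y. ennreal (F y powr p) \<partial>lborel))"
  proof (rule schur_test[where a = "\<lambda>x y. (contact_dist x y / d x) powr (- \<gamma>)", OF p])
    show "(contact_dist x y / d x) powr (- \<gamma>) > 0" if "kern \<alpha> e \<tau> x y \<noteq> 0" for x y
      using that shd[of x y] unfolding kern_def by (auto simp: indicator_def split: if_splits)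
    show "(\<integral>\<^sup>+x. ennreal (kern \<alpha> e \<tau> x y * ((contact_dist x y / d x) powr - \<gamma>) powr - p) \<partial>lborel) \<le> ennreal (Y * norm e)" if "F y \<noteq> 0" for y
      using Y(2)[OF that] by (simp add: powr_powr)
    show "(\<integral>\<^sup>+y. ennreal (kern \<alpha> e \<tau> x y * ((contact_dist x y / d x) powr - \<gamma>) powr (p / (p - 1))) \<partial>lborel) \<le> ennreal (C * D * norm e)" for x
    proof (cases "\<tau> < d x")
      case True
      then have dx: "d x > 0" "10 * norm e \<le> d x" using e by linarith+
      have "(\<integral>\<^sup>+y. ennreal (kern \<alpha> e \<tau> x y * ((contact_dist x y / d x) powr - \<gamma>) powr (p / (p - 1))) \<partial>lborel) \<le>
        (\<integral>\<^sup>+y. ennreal (d x powr (\<alpha> - n + s)) * (ennreal (contact_dist x y powr (- s)) * indicator (crescent e x) y) \<partial>lborel)"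
      proof (rule nn_integral_mono)
        fix y
        show "ennreal (kern \<alpha> e \<tau> x y * ((contact_dist x y / d x) powr - \<gamma>) powr (p / (p - 1))) \<le> ennreal (d x powr (\<alpha> - n + s)) * (ennreal (contact_dist x y powr (- s)) * indicator (crescent e x) y)"
        proof (cases "x \<in> shadow e \<tau> y")
          case sh: True
          have "kern \<alpha> e \<tau> x y * ((contact_dist x y / d x) powr - \<gamma>) powr (p / (p - 1)) = d x powr (\<alpha> - n) * (contact_dist x y / d x) powr (- s)"
            using sh unfolding kern_def powr_powr s_def n_def by simp
          also have "\<dots> = d x powr (\<alpha> - n + s) * contact_dist x y powr (- s)"
          proof -
            have "(contact_dist x y / d x) powr (- s) = contact_dist x y powr (- s) * d x powr s"
              using shd[OF sh] by (simp add: powr_divide powr_minus field_simps)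
            then show ?thesis by (simp add: powr_add)
          qed
          finally show ?thesis using shd[OF sh] by (simp add: ennreal_mult)
        qed (simp add: kern_def)
      qed
      also have "\<dots> = ennreal (d x powr (\<alpha> - n + s)) * (\<integral>\<^sup>+y\<in>crescent e x. ennreal (contact_dist x y powr (- s)) \<partial>lborel)"
        by (rule nn_integral_cmult) measurable
      also have "\<dots> \<le> ennreal (d x powr (\<alpha> - n + s)) * ennreal (C * norm e * d x powr (n - 1 - s))"
        using crescent_weight_le[OF e(1) dx(2) s(1) s(2)[unfolded n_def]] unfolding C_def crescent_const_def n_def
        by (intro mult_left_mono) auto
      also have "\<dots> = ennreal (C * norm e * d x powr (\<alpha> - 1))"
        using C dx by (simp add: ennreal_mult[symmetric] powr_add[symmetric] mult_ac)
      also have "\<dots> \<le> ennreal (C * D * norm e)"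
      proof (rule ennreal_leI)
        have "(C * norm e) * d x powr (\<alpha> - 1) \<le> (C * norm e) * D" using D(2)[OF True] C by (intro mult_left_mono) auto
        then show "C * norm e * d x powr (\<alpha> - 1) \<le> C * D * norm e" by (simp only: mult_ac)
      qed
      finally show ?thesis .
    next
      case False
      then have "kern \<alpha> e \<tau> x y = 0" for y unfolding kern_def shadow_def by simp
      then show ?thesis by simp
    qed
    show "0 < C * D * norm e" using C D e by simp
  qed (use F kern_nonneg in \<open>auto intro!: kern_nonneg\<close>)
  also have "\<dots> = ennreal ((C * D) powr (p - 1) * Y * norm e powr p) * (\<integral>\<^sup>+y. ennreal (F y powr p) \<partial>lborel)"
  proof -
    have *: "(C * D * norm e) powr (p - 1) * (Y * norm e) = (C * D) powr (p - 1) * Y * norm e powr p"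
      using e C D powr_add[of "norm e" 1 "p - 1"] by (simp add: powr_mult mult_ac)
    show ?thesis unfolding *[symmetric] using Y(1) e by (subst ennreal_mult) (auto simp: mult.assoc)
  qed
  finally show ?thesis unfolding C_def s_def .
qed

end

text \<open>Where the inner integral is infinite, \<open>enn2real\<close> replaces it by 0; for \<open>F\<close> in \<open>L\<^sup>p\<close> this does not
  happen.\<close>

definition crescent_bounded :: "real \<Rightarrow> real \<Rightarrow> real \<Rightarrow> 'a::euclidean_space set \<Rightarrow> bool" where
  "crescent_bounded p \<alpha> C S \<longleftrightarrow> (\<forall>e \<tau> F. 0 < norm e \<longrightarrow> 10 * norm e \<le> \<tau> \<longrightarrow> F \<in> borel_measurable borel \<longrightarrow>
     (\<forall>y. 0 \<le> F y) \<longrightarrow> (\<forall>y\<in>S. F y = 0) \<longrightarrow>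
     (\<integral>\<^sup>+x. ennreal (enn2real (\<integral>\<^sup>+y. ennreal (closed_complement.kern S \<alpha> e \<tau> x y * F y) \<partial>lborel) powr p) \<partial>lborel)
       \<le> ennreal (C * norm e powr p) * (\<integral>\<^sup>+y. ennreal (F y powr p) \<partial>lborel))"

lemma (in closed_complement) crescent_boundedI:
  assumes p: "p > 1" and \<gamma>: "\<gamma> \<ge> 0" "\<gamma> * (p / (p - 1)) < real DIM('a)"
    and D: "D > 0" "\<And>x. x \<notin> S \<Longrightarrow> d x powr (\<alpha> - 1) \<le> D" and "Y \<ge> 0"
    and Y: "\<And>e \<tau> y. 0 < norm e \<Longrightarrow> 10 * norm e \<le> \<tau> \<Longrightarrow> y \<notin> S \<Longrightarrow>
       (\<integral>\<^sup>+x. ennreal (kern \<alpha> e \<tau> x y * (contact_dist x y / d x) powr (\<gamma> * p)) \<partial>lborel) \<le> ennreal (Y * norm e)"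
  shows "crescent_bounded p \<alpha> ((crescent_const (\<gamma> * (p / (p - 1))) * D) powr (p - 1) * Y) S"
  unfolding crescent_bounded_def
proof (intro allI impI)
  fix e :: 'a and \<tau> and F :: "'a \<Rightarrow> real"
  assume e: "0 < norm e" "10 * norm e \<le> \<tau>" and F: "F \<in> borel_measurable borel" "\<forall>y. 0 \<le> F y" "\<forall>y\<in>S. F y = 0"
  show "(\<integral>\<^sup>+x. ennreal (enn2real (\<integral>\<^sup>+y. ennreal (kern \<alpha> e \<tau> x y * F y) \<partial>lborel) powr p) \<partial>lborel)
    \<le> ennreal ((crescent_const (\<gamma> * (p / (p - 1))) * D) powr (p - 1) * Y * norm e powr p) * (\<integral>\<^sup>+y. ennreal (F y powr p) \<partial>lborel)"
  proof (rule crescent_operator_Lp[OF p F(1) _ e \<gamma> D(1) _ \<open>Y \<ge> 0\<close>])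
    show "d x powr (\<alpha> - 1) \<le> D" if "\<tau> < d x" for x
    proof (rule D(2))
      have "d x > 0" using that e by linarith
      then show "x \<notin> S" by auto
    qed
    show "(\<integral>\<^sup>+x. ennreal (kern \<alpha> e \<tau> x y * (contact_dist x y / d x) powr (\<gamma> * p)) \<partial>lborel) \<le> ennreal (Y * norm e)" if "F y \<noteq> 0" for y
      using that F(3) Y[OF e, of y] by blast
  qed (use F in auto)
qed

lemma one_minus_two_powr_pos: "s > 0 \<Longrightarrow> 1 - 2 powr (- s) > 0" for s :: real
  using powr_less_mono[of "- s" 0 2] by simp

lemma crescent_bounded_convex:
  assumes p: "p > 1"
  shows "\<exists>C\<ge>0. \<forall>S::'a::euclidean_space set. closed S \<longrightarrow> S \<noteq> {} \<longrightarrow> convex S \<longrightarrow> crescent_bounded p 1 C S"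
proof -
  \<comment> \<open>As \<gamma> p = 2 s, the row exponent \<gamma> p / (p - 1) equals 2 s / (p - 1).
    This choice of s makes it 1 / 2, which is below every dimension.\<close>
  define s where "s = (p - 1) / 4"
  define \<gamma> where "\<gamma> = 2 * s / p"
  have s: "s > 0" unfolding s_def using p by simp
  have \<gamma>: "\<gamma> \<ge> 0" "\<gamma> * (p / (p - 1)) < real DIM('a)" "\<gamma> * p = 2 * s"
  proof -
    show "\<gamma> \<ge> 0" "\<gamma> * p = 2 * s" unfolding \<gamma>_def using p s by auto
    have *: "\<gamma> * (p / (p - 1)) = 1 / 2" unfolding \<gamma>_def s_def using p by (simp add: field_simps)
    have "1 \<le> real DIM('a)" using DIM_positive[where 'a='a] by linarith
    then show "\<gamma> * (p / (p - 1)) < real DIM('a)" unfolding * by linarith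
  qed
  define Y where "Y = 2 powr (real DIM('a) - 1) * (2 * 5) powr s * 3 powr s * (unit_ball_vol DIM('a) * 2 ^ (DIM('a) + 1) * (2 powr (real DIM('a) - 1) / (1 - 2 powr (- s))))"
  have Y: "Y \<ge> 0" unfolding Y_def using one_minus_two_powr_pos[OF s] by simp
  have "crescent_bounded p 1 ((closed_complement.crescent_const TYPE('a) (\<gamma> * (p / (p - 1))) * 1) powr (p - 1) * Y) S"
    if S: "closed S" "S \<noteq> {}" "convex S" for S :: "'a set"
  proof -
    interpret closed_complement S using S by unfold_locales
    show ?thesis
    proof (rule crescent_boundedI[OF p \<gamma>(1,2) _ _ Y])
      fix e y :: 'a and \<tau> assume e: "0 < norm e" "10 * norm e \<le> \<tau>"
      have "(\<integral>\<^sup>+x\<in>UNIV. ennreal (kern 1 e \<tau> x y * (contact_dist x y / d x) powr (2 * s)) \<partial>lborel) \<le> ennreal (Y * norm e)"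
        unfolding Y_def
      proof (rule kern_column_tangential[OF e s])
        show "(contact_dist x y)\<^sup>2 \<le> 5 * d x * (d y + norm e)" if "x \<in> shadow e \<tau> y" for x
          using that e unfolding shadow_def by (intro crescent_tangential_convex S) auto
      qed auto
      then show "(\<integral>\<^sup>+x. ennreal (kern 1 e \<tau> x y * (contact_dist x y / d x) powr (\<gamma> * p)) \<partial>lborel) \<le> ennreal (Y * norm e)"
        unfolding \<gamma>(3) by simp
    qed auto
  qed
  then show ?thesis using Y by (intro exI[of _ "(closed_complement.crescent_const TYPE('a) (\<gamma> * (p / (p - 1))) * 1) powr (p - 1) * Y"]) auto
qed

lemma crescent_bounded_large_p:
  assumes p: "p > 1 + 1 / real DIM('a::euclidean_space)"
  shows "\<exists>C\<ge>0. \<forall>S::'a set. closed S \<longrightarrow> S \<noteq> {} \<longrightarrow> crescent_bounded p 1 C S"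
proof -
  define n where "n = real DIM('a)"
  have n: "n > 0" unfolding n_def by simp
  have p0: "1 / n < p - 1" using p unfolding n_def by linarith
  have p1: "p > 1" "n * (p - 1) > 1"
  proof -
    show "p > 1" using p0 n by (meson diff_gt_0_iff_gt divide_pos_pos less_trans zero_less_one)
    show "n * (p - 1) > 1" using p0 n by (simp add: pos_divide_less_eq mult.commute)
  qed
  \<comment> \<open>The midpoint of the interval between 1, the threshold along rays, and n (p - 1),
    the threshold for the rows; the hypothesis on p makes it nonempty.\<close>
  define s where "s = (1 + n * (p - 1)) / 2"
  define \<gamma> where "\<gamma> = s / p"
  have s: "s > 1" "s < n * (p - 1)" unfolding s_def using p1 by auto
  have \<gamma>: "\<gamma> \<ge> 0" "\<gamma> * (p / (p - 1)) < real DIM('a)" "\<gamma> * p = s"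
    unfolding \<gamma>_def n_def[symmetric] using p1 s by (auto simp: field_simps)
  define Y where "Y = 2 powr (real DIM('a) - 1 + s) * (2 * (4 * 2 powr (2 * s - 1) / (1 - 2 powr (- (s - 1)))) * unit_ball_vol DIM('a) * 2 ^ DIM('a))"
  have Y: "Y \<ge> 0" unfolding Y_def using one_minus_two_powr_pos[of "s - 1"] s by simp
  have "crescent_bounded p 1 ((closed_complement.crescent_const TYPE('a) (\<gamma> * (p / (p - 1))) * 1) powr (p - 1) * Y) S"
    if S: "closed S" "S \<noteq> {}" for S :: "'a set"
  proof -
    interpret closed_complement S using S by unfold_locales
    show ?thesis
    proof (rule crescent_boundedI[OF p1(1) \<gamma>(1,2) _ _ Y])
      fix e y :: 'a and \<tau> assume e: "0 < norm e" "10 * norm e \<le> \<tau>"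
      show "(\<integral>\<^sup>+x. ennreal (kern 1 e \<tau> x y * (contact_dist x y / d x) powr (\<gamma> * p)) \<partial>lborel) \<le> ennreal (Y * norm e)"
        unfolding \<gamma>(3) Y_def by (rule kern_column_rays[OF e s(1)])
    qed auto
  qed
  then show ?thesis using Y by (intro exI[of _ "(closed_complement.crescent_const TYPE('a) (\<gamma> * (p / (p - 1))) * 1) powr (p - 1) * Y"]) auto
qed

lemma bounded_complement_dist:
  fixes S :: "'a::euclidean_space set"
  assumes "bounded (- S)" "S \<noteq> {}"
  obtains R where "R > 0" "\<And>x. x \<notin> S \<Longrightarrow> infdist x S \<le> R" "\<And>x y. x \<notin> S \<Longrightarrow> y \<notin> S \<Longrightarrow> dist x y \<le> R"
proof -
  obtain B where B: "B > 0" "\<And>x. x \<in> - S \<Longrightarrow> norm x \<le> B" using assms(1) bounded_pos by metis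
  obtain b where b: "b \<in> S" using assms(2) by blast
  show thesis
  proof (rule that[of "2 * B + norm b"])
    show "infdist x S \<le> 2 * B + norm b" if "x \<notin> S" for x
      using infdist_le[OF b, of x] norm_triangle_ineq4[of x b] B(2)[of x] that B(1) by (simp add: dist_norm)
    show "dist x y \<le> 2 * B + norm b" if "x \<notin> S" "y \<notin> S" for x y
      using norm_triangle_ineq4[of x y] B(2)[of x] B(2)[of y] that norm_ge_zero[of b] unfolding dist_norm Compl_iff by argo
    show "2 * B + norm b > 0" using B by (simp add: add_pos_nonneg)
  qed
qed

lemma crescent_bounded_subcritical:
  fixes S :: "'a::euclidean_space set"
  assumes p: "p > 1" and S: "closed S" "S \<noteq> {}" "bounded (- S)" and \<alpha>: "1 < \<alpha>" "\<alpha> < real DIM('a)"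
  shows "\<exists>C\<ge>0. crescent_bounded p \<alpha> C S"
proof -
  interpret closed_complement S using S by unfold_locales
  obtain R where R: "R > 0" "\<And>x. x \<notin> S \<Longrightarrow> d x \<le> R" "\<And>x y. x \<notin> S \<Longrightarrow> y \<notin> S \<Longrightarrow> dist x y \<le> R"
    using bounded_complement_dist[OF S(3,2)] by metis
  define Y where "Y = 2 ^ DIM('a) * (unit_ball_vol DIM('a) * 2 ^ (DIM('a) + 1) * (2 ^ DIM('a) * R powr (\<alpha> - 1) / (1 - 2 powr (- (\<alpha> - 1)))))"
  have Y: "Y \<ge> 0" unfolding Y_def using one_minus_two_powr_pos[of "\<alpha> - 1"] \<alpha> by simp
  \<comment> \<open>Schur's test without weight, that is \<gamma> = 0. Boundedness enters twice,
    through \<open>D = R powr (\<alpha> - 1)\<close> and through the largest scale R of the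
    columns.\<close>
  have "crescent_bounded p \<alpha> ((crescent_const (0 * (p / (p - 1))) * R powr (\<alpha> - 1)) powr (p - 1) * Y) S"
  proof (rule crescent_boundedI[OF p _ _ _ _ Y])
    show "d x powr (\<alpha> - 1) \<le> R powr (\<alpha> - 1)" if "x \<notin> S" for x
      using R(2)[OF that] \<alpha> infdist_nonneg by (intro powr_mono2) auto
    fix e y :: 'a and \<tau> assume e: "0 < norm e" "10 * norm e \<le> \<tau>" and y: "y \<notin> S"
    have "(\<integral>\<^sup>+x. ennreal (kern \<alpha> e \<tau> x y * (contact_dist x y / d x) powr (0 * p)) \<partial>lborel) \<le> (\<integral>\<^sup>+x. ennreal (kern \<alpha> e \<tau> x y) \<partial>lborel)"
      using kern_nonneg by (intro nn_integral_mono ennreal_leI) auto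
    also have "\<dots> \<le> ennreal (2 ^ DIM('a) * (unit_ball_vol DIM('a) * 2 ^ (DIM('a) + 1) * norm e * (2 ^ DIM('a) * R powr (\<alpha> - 1) / (1 - 2 powr (- (\<alpha> - 1))))))"
    proof (rule kern_column_subcritical[OF e \<alpha> R(1)])
      show "dist y x \<le> R" if "x \<in> shadow e \<tau> y" for x
      proof (rule R(3)[OF y])
        have "d x > 0" using that e unfolding shadow_def mem_Collect_eq by linarith
        then show "x \<notin> S" by auto
      qed
    qed
    also have "\<dots> = ennreal (Y * norm e)" unfolding Y_def by (simp add: mult_ac)
    finally show "(\<integral>\<^sup>+x. ennreal (kern \<alpha> e \<tau> x y * (contact_dist x y / d x) powr (0 * p)) \<partial>lborel) \<le> ennreal (Y * norm e)" .
  qed (use R in auto)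
  then show ?thesis using Y by (intro exI[of _ "(crescent_const (0 * (p / (p - 1))) * R powr (\<alpha> - 1)) powr (p - 1) * Y"]) auto
qed

text \<open>Centres within R / 2 of S obey the tangential estimate. For the others
  \<open>d x \<ge> R / 2\<close>, while the diameter bounds \<open>dist y x\<close>, so that only a
  bounded range of scales is left.\<close>

lemma crescent_bounded_curvature:
  fixes S :: "'a::euclidean_space set"
  assumes p: "p > 1" and S: "closed S" "S \<noteq> {}" "bounded (- S)"
    and R: "R > 0" "\<And>x. x \<notin> S \<Longrightarrow> \<exists>b\<in>S. dist x b = infdist x S \<and> ball (b + (R / infdist x S) *\<^sub>R (x - b)) R \<subseteq> - S"
  shows "\<exists>C\<ge>0. crescent_bounded p 1 C S"
proof -
  interpret closed_complement S using S by unfold_locales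
  obtain R' where R': "R' > 0" "\<And>x y. x \<notin> S \<Longrightarrow> y \<notin> S \<Longrightarrow> dist x y \<le> R'"
    using bounded_complement_dist[OF S(3,2)] by metis
  \<comment> \<open>The maximum ensures that the range of scales from R / 2 to R'' has its ends in
    the right order.\<close>
  define R'' where "R'' = max R' (R / 2)"
  define s where "s = (p - 1) / 4"
  define \<gamma> where "\<gamma> = 2 * s / p"
  have s: "s > 0" unfolding s_def using p by simp
  have \<gamma>: "\<gamma> \<ge> 0" "\<gamma> * (p / (p - 1)) < real DIM('a)" "\<gamma> * p = 2 * s"
  proof -
    show "\<gamma> \<ge> 0" "\<gamma> * p = 2 * s" unfolding \<gamma>_def using p s by auto
    have *: "\<gamma> * (p / (p - 1)) = 1 / 2" unfolding \<gamma>_def s_def using p by (simp add: field_simps)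
    have "1 \<le> real DIM('a)" using DIM_positive[where 'a='a] by linarith
    then show "\<gamma> * (p / (p - 1)) < real DIM('a)" unfolding * by linarith
  qed
  define Y1 where "Y1 = 2 powr (real DIM('a) - 1) * (2 * 9) powr s * 3 powr s * (unit_ball_vol DIM('a) * 2 ^ (DIM('a) + 1) * (2 powr (real DIM('a) - 1) / (1 - 2 powr (- s))))"
  define Y2 where "Y2 = 3 powr (2 * s) * (R / 2) powr (1 - real DIM('a)) * (unit_ball_vol DIM('a) * 2 ^ (DIM('a) + 1) * R'' powr (real DIM('a) - 1))"
  have Y: "Y1 \<ge> 0" "Y2 \<ge> 0" unfolding Y1_def Y2_def using one_minus_two_powr_pos[OF s] by auto
  have "crescent_bounded p 1 ((crescent_const (\<gamma> * (p / (p - 1))) * 1) powr (p - 1) * (Y1 + Y2)) S"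
  proof (rule crescent_boundedI[OF p \<gamma>(1,2)])
    fix e y :: 'a and \<tau> assume e: "0 < norm e" "10 * norm e \<le> \<tau>" and y: "y \<notin> S"
    let ?f = "\<lambda>x. ennreal (kern 1 e \<tau> x y * (contact_dist x y / d x) powr (2 * s))"
    have [measurable]: "?f \<in> borel_measurable borel" by measurable
    have 1: "(\<integral>\<^sup>+x\<in>{x. d x \<le> R / 2}. ?f x \<partial>lborel) \<le> ennreal (Y1 * norm e)"
      unfolding Y1_def
    proof (rule kern_column_tangential[OF e s])
      show "(contact_dist x y)\<^sup>2 \<le> 9 * d x * (d y + norm e)" if "x \<in> shadow e \<tau> y" "x \<in> {x. d x \<le> R / 2}" for x
        using that e unfolding shadow_def by (intro crescent_tangential_curvature[OF R]) auto
    qed auto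
    have 2: "(\<integral>\<^sup>+x\<in>{x. R / 2 \<le> d x}. ?f x \<partial>lborel) \<le> ennreal (Y2 * norm e)"
    proof -
      have "(\<integral>\<^sup>+x\<in>{x. R / 2 \<le> d x}. ?f x \<partial>lborel) \<le> ennreal (3 powr (2 * s) * (R / 2) powr (1 - real DIM('a)) * (unit_ball_vol DIM('a) * 2 ^ (DIM('a) + 1) * norm e * R'' powr (real DIM('a) - 1)))"
      proof (rule kern_column_bounded_scales[OF e])
        show "dist y x \<le> R''" if "x \<in> shadow e \<tau> y" for x
        proof -
          have "d x > 0" using that e unfolding shadow_def mem_Collect_eq by linarith
          then have "x \<notin> S" by auto
          then show ?thesis using R'(2)[OF y, of x] unfolding R''_def by simp
        qed
      qed (use R s in \<open>auto simp: R''_def\<close>)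
      then show ?thesis unfolding Y2_def by (simp add: mult_ac)
    qed
    have "(\<integral>\<^sup>+x. ?f x \<partial>lborel) \<le> (\<integral>\<^sup>+x. ?f x * indicator {x. d x \<le> R / 2} x + ?f x * indicator {x. R / 2 \<le> d x} x \<partial>lborel)"
      by (intro nn_integral_mono) (auto simp: indicator_def)
    also have "\<dots> = (\<integral>\<^sup>+x\<in>{x. d x \<le> R / 2}. ?f x \<partial>lborel) + (\<integral>\<^sup>+x\<in>{x. R / 2 \<le> d x}. ?f x \<partial>lborel)"
      by (rule nn_integral_add) measurable
    also have "\<dots> \<le> ennreal (Y1 * norm e) + ennreal (Y2 * norm e)" by (rule add_mono[OF 1 2])
    also have "\<dots> = ennreal ((Y1 + Y2) * norm e)"
      using Y by (simp add: distrib_right)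
    finally show "(\<integral>\<^sup>+x. ennreal (kern 1 e \<tau> x y * (contact_dist x y / d x) powr (\<gamma> * p)) \<partial>lborel) \<le> ennreal ((Y1 + Y2) * norm e)"
      unfolding \<gamma>(3) .
  qed (use Y in auto)
  then show ?thesis using Y by (intro exI[of _ "(crescent_const (\<gamma> * (p / (p - 1))) * 1) powr (p - 1) * (Y1 + Y2)"]) auto
qed

section \<open>Difference quotients of the maximal function\<close>

text \<open>Here \<open>S\<close> is the complement of \<open>\<Omega>\<close> and \<open>F\<close> is a Borel representative of \<open>\<bar>f\<bar>\<close>, extended by
  zero, so that only \<open>lborel\<close> is involved.\<close>

definition frac_max :: "real \<Rightarrow> 'a::euclidean_space set \<Rightarrow> ('a \<Rightarrow> real) \<Rightarrow> 'a \<Rightarrow> ennreal" where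
  "frac_max \<alpha> S F x = (SUP r\<in>{0<..<infdist x S}.
     ennreal (r powr \<alpha> / measure lborel (ball x r)) * (\<integral>\<^sup>+y\<in>ball x r. ennreal (F y) \<partial>lborel))"

text \<open>The normalising factor in front of the integral over a ball of radius r. It does not
  involve the centre; the type argument supplies the dimension.\<close>

definition frac_coeff :: "real \<Rightarrow> 'a::euclidean_space itself \<Rightarrow> real \<Rightarrow> real" where
  "frac_coeff \<alpha> _ r = r powr (\<alpha> - real DIM('a)) / unit_ball_vol (real DIM('a))"

lemma frac_coeff_eq:
  fixes x :: "'a::euclidean_space"
  assumes "r > 0"
  shows "r powr \<alpha> / measure lborel (ball x r) = frac_coeff \<alpha> TYPE('a) r"
  using assms by (simp add: frac_coeff_def content_ball powr_diff powr_realpow)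

lemma frac_coeff_pos: "r > 0 \<Longrightarrow> frac_coeff \<alpha> TYPE('a::euclidean_space) r > 0"
  by (simp add: frac_coeff_def)

lemma frac_coeff_antimono:
  assumes "0 < r" "r \<le> s" "\<alpha> \<le> real DIM('a::euclidean_space)"
  shows "frac_coeff \<alpha> TYPE('a) s \<le> frac_coeff \<alpha> TYPE('a) r"
  unfolding frac_coeff_def using assms by (intro divide_right_mono powr_mono2') auto

text \<open>The ratio of the coefficients at r + h and r is \<open>t powr (n - \<alpha>)\<close>
  with t = r / (r + h), hence at least \<open>t ^ n\<close>, and Bernoulli's inequality bounds this
  below by \<open>1 - n * h / r\<close>.\<close>

lemma frac_coeff_diff_le:
  assumes "0 < r" "0 \<le> h" "0 \<le> \<alpha>" "\<alpha> \<le> real DIM('a::euclidean_space)"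
  shows "frac_coeff \<alpha> TYPE('a) r \<le> frac_coeff \<alpha> TYPE('a) (r + h) + real DIM('a) * h / r * frac_coeff \<alpha> TYPE('a) r"
proof -
  define t where "t = r / (r + h)"
  have t: "0 < t" "t \<le> 1" unfolding t_def using assms by auto
  have "1 - real DIM('a) * h / r \<le> 1 + real DIM('a) * (t - 1)"
  proof -
    have "1 - t = h / (r + h)" unfolding t_def using assms by (simp add: field_simps)
    also have "\<dots> \<le> h / r" using assms by (intro divide_left_mono) auto
    finally have "real DIM('a) * (1 - t) \<le> real DIM('a) * (h / r)" by (intro mult_left_mono) auto
    then show ?thesis by (simp add: algebra_simps)
  qed
  also have "\<dots> \<le> (1 + (t - 1)) ^ DIM('a)" using t by (intro Bernoulli_inequality) auto
  also have "\<dots> = t powr real DIM('a)" using t by (simp add: powr_realpow)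
  also have "\<dots> \<le> t powr (real DIM('a) - \<alpha>)" using t assms by (intro powr_mono') auto
  finally have 1: "1 - real DIM('a) * h / r \<le> t powr (real DIM('a) - \<alpha>)" .
  have "frac_coeff \<alpha> TYPE('a) (r + h) = t powr (real DIM('a) - \<alpha>) * frac_coeff \<alpha> TYPE('a) r"
    unfolding frac_coeff_def t_def using assms by (simp add: powr_divide powr_diff field_simps)
  then have "(1 - real DIM('a) * h / r) * frac_coeff \<alpha> TYPE('a) r \<le> frac_coeff \<alpha> TYPE('a) (r + h)"
    using 1 frac_coeff_pos[OF assms(1), of \<alpha>, where 'a='a] by (simp add: mult_right_mono)
  then show ?thesis by (simp add: algebra_simps)
qed

lemma frac_max_upper:
  assumes "0 < r" "r < infdist x S"
  shows "ennreal (frac_coeff \<alpha> TYPE('a) r) * (\<integral>\<^sup>+y\<in>ball x r. ennreal (F y) \<partial>lborel) \<le> frac_max \<alpha> S F (x::'a::euclidean_space)"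
  unfolding frac_max_def frac_coeff_eq[OF assms(1), of \<alpha> x, symmetric] using assms by (intro SUP_upper) auto

lemma hl_max_upper:
  "0 < r \<Longrightarrow> (\<integral>\<^sup>+y\<in>ball x r. g y \<partial>lborel) / emeasure lborel (ball x r) \<le> hl_max g x"
  unfolding hl_max_def by (intro SUP_upper) auto

lemma ennreal_coeff_times_average:
  fixes x :: "'a::euclidean_space"
  assumes "0 < r" "0 \<le> a"
  shows "ennreal (a / (unit_ball_vol (real DIM('a)) * r ^ DIM('a))) * I = ennreal a * (I / emeasure lborel (ball x r))"
proof -
  have pos: "unit_ball_vol (real DIM('a)) * r ^ DIM('a) > 0" using assms by simp
  then have "ennreal (a / (unit_ball_vol (real DIM('a)) * r ^ DIM('a))) = ennreal a / ennreal (unit_ball_vol (real DIM('a)) * r ^ DIM('a))"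
    using assms by (intro divide_ennreal[symmetric]) auto
  then show ?thesis using assms by (simp add: emeasure_ball ennreal_times_divide ennreal_divide_times)
qed

lemma frac_max_le_hl_max:
  fixes x :: "'a::euclidean_space"
  assumes "\<alpha> \<ge> 0"
  shows "frac_max \<alpha> S F x \<le> ennreal (infdist x S powr \<alpha>) * hl_max (\<lambda>y. ennreal (F y)) x"
  unfolding frac_max_def
proof (rule SUP_least)
  fix r assume "r \<in> {0<..<infdist x S}"
  then have r: "0 < r" "r < infdist x S" by auto
  have "ennreal (r powr \<alpha> / measure lborel (ball x r)) * (\<integral>\<^sup>+y\<in>ball x r. ennreal (F y) \<partial>lborel) =
    ennreal (r powr \<alpha>) * ((\<integral>\<^sup>+y\<in>ball x r. ennreal (F y) \<partial>lborel) / emeasure lborel (ball x r))"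
    using ennreal_coeff_times_average[of r "r powr \<alpha>" _ x] r by (simp add: content_ball)
  also have "\<dots> \<le> ennreal (infdist x S powr \<alpha>) * hl_max (\<lambda>y. ennreal (F y)) x"
    using r assms by (intro mult_mono ennreal_leI powr_mono2 hl_max_upper) auto
  finally show "ennreal (r powr \<alpha> / measure lborel (ball x r)) * (\<integral>\<^sup>+y\<in>ball x r. ennreal (F y) \<partial>lborel) \<le> \<dots>" .
qed

text \<open>Lower semicontinuity as for \<open>hl_max\<close>: a single competing radius is enlarged
  slightly. An infinite integral is treated separately, because then only the positivity of the
  coefficient matters.\<close>

lemma open_less_frac_max:
  fixes F :: "'a::euclidean_space \<Rightarrow> real"
  shows "open {x. c < frac_max \<alpha> S F x}"
proof (subst open_dist, clarify)
  fix x :: 'a assume "c < frac_max \<alpha> S F x"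
  then obtain r where r: "0 < r" "r < infdist x S"
    and c: "c < ennreal (frac_coeff \<alpha> TYPE('a) r) * (\<integral>\<^sup>+y\<in>ball x r. ennreal (F y) \<partial>lborel)"
  proof -
    obtain r where "r \<in> {0<..<infdist x S}"
      "c < ennreal (r powr \<alpha> / measure lborel (ball x r)) * (\<integral>\<^sup>+y\<in>ball x r. ennreal (F y) \<partial>lborel)"
      using \<open>c < frac_max \<alpha> S F x\<close> unfolding frac_max_def less_SUP_iff by blast
    then show ?thesis using that[of r] frac_coeff_eq[of r \<alpha> x] by simp
  qed
  define V where "V = (\<integral>\<^sup>+y\<in>ball x r. ennreal (F y) \<partial>lborel)"
  have "\<forall>\<^sub>F s in at_right r. c < ennreal (frac_coeff \<alpha> TYPE('a) s) * V"
  proof (cases "V = top")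
    case True
    have "c < top" using c by (metis linorder_not_le top.extremum order_le_less_trans)
    show ?thesis unfolding eventually_at_right_field
    proof (intro exI[of _ "r + 1"] conjI allI impI)
      fix s assume "r < s"
      then have "frac_coeff \<alpha> TYPE('a) s > 0" using r by (intro frac_coeff_pos) linarith
      then show "c < ennreal (frac_coeff \<alpha> TYPE('a) s) * V"
        using \<open>c < top\<close> unfolding True by (simp add: ennreal_mult_top)
    qed simp
  next
    case False
    then obtain v where v: "V = ennreal v" "v \<ge> 0" by (metis ennreal_cases infinity_ennreal_def)
    have "((\<lambda>s. ennreal (frac_coeff \<alpha> TYPE('a) s * v)) \<longlongrightarrow> ennreal (frac_coeff \<alpha> TYPE('a) r * v)) (at_right r)"
    proof -
      have "unit_ball_vol (real DIM('a)) \<noteq> 0" using unit_ball_vol_pos[of "real DIM('a)"] by linarith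
      then show ?thesis unfolding frac_coeff_def using r by (intro tendsto_ennrealI tendsto_intros) auto
    qed
    moreover have "c < ennreal (frac_coeff \<alpha> TYPE('a) r * v)"
      using c frac_coeff_pos[OF r(1), of \<alpha>, where 'a='a] v unfolding V_def[symmetric] by (simp add: ennreal_mult)
    ultimately have "\<forall>\<^sub>F s in at_right r. c < ennreal (frac_coeff \<alpha> TYPE('a) s * v)" by (rule order_tendstoD)
    then show ?thesis using eventually_at_right_less[of r]
    proof eventually_elim
      case (elim s)
      then have "frac_coeff \<alpha> TYPE('a) s > 0" using r by (intro frac_coeff_pos) linarith
      then show ?case using elim v by (simp add: ennreal_mult)
    qed
  qed
  then obtain b where b: "b > r" "\<And>s. r < s \<Longrightarrow> s < b \<Longrightarrow> c < ennreal (frac_coeff \<alpha> TYPE('a) s) * V"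
    unfolding eventually_at_right_field by blast
  \<comment> \<open>The third of the gap leaves \<open>r + 2 * \<eta>\<close> below the distance at
    x. Moving the centre by less than \<eta> loses less than \<eta> of that distance, so the radius
    r + \<eta> is admissible at the new centre.\<close>
  define \<eta> where "\<eta> = min ((b - r) / 2) ((infdist x S - r) / 3)"
  have \<eta>: "\<eta> > 0" "r + \<eta> < b" "r + 2 * \<eta> < infdist x S"
    using b(1) r unfolding \<eta>_def by (auto simp: min_def field_simps)
  show "\<exists>\<epsilon>>0. \<forall>y. dist y x < \<epsilon> \<longrightarrow> y \<in> {x. c < frac_max \<alpha> S F x}"
  proof (intro exI[of _ \<eta>] conjI allI impI)
    fix y assume y: "dist y x < \<eta>"
    have "infdist x S \<le> infdist y S + dist x y" by (rule infdist_triangle)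
    then have ry: "0 < r + \<eta>" "r + \<eta> < infdist y S" using y \<eta> r by (auto simp: dist_commute)
    have "c < ennreal (frac_coeff \<alpha> TYPE('a) (r + \<eta>)) * V" using \<eta> by (intro b(2)) auto
    also have "\<dots> \<le> ennreal (frac_coeff \<alpha> TYPE('a) (r + \<eta>)) * (\<integral>\<^sup>+z\<in>ball y (r + \<eta>). ennreal (F z) \<partial>lborel)"
      unfolding V_def
    proof (rule mult_left_mono[OF nn_integral_mono])
      fix z
      have "z \<in> ball x r \<Longrightarrow> z \<in> ball y (r + \<eta>)"
        using y dist_triangle[of y z x] by simp
      then show "ennreal (F z) * indicator (ball x r) z \<le> ennreal (F z) * indicator (ball y (r + \<eta>)) z"
        by (auto simp: indicator_def)
    qed simp
    also have "\<dots> \<le> frac_max \<alpha> S F y" by (rule frac_max_upper[OF ry])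
    finally show "y \<in> {x. c < frac_max \<alpha> S F x}" by simp
  qed (use \<eta> in auto)
qed

lemma borel_measurable_frac_max [measurable]: "frac_max \<alpha> S F \<in> borel_measurable borel"
  by (rule borel_measurableI_greater) (auto intro: borel_open open_less_frac_max)

context closed_complement
begin

text \<open>The supremum runs over radii strictly below \<open>d x\<close>. The ball of radius
  \<open>d x\<close> itself is reached by monotone convergence, since the coefficients of the
  smaller balls are even larger.\<close>

lemma frac_max_closed_ball:
  fixes F :: "'a \<Rightarrow> real"
  assumes [measurable]: "F \<in> borel_measurable borel" and "x \<notin> S" "\<alpha> \<le> real DIM('a)"
  shows "ennreal (frac_coeff \<alpha> TYPE('a) (d x)) * (\<integral>\<^sup>+y\<in>ball x (d x). ennreal (F y) \<partial>lborel) \<le> frac_max \<alpha> S F x"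
proof -
  have dx: "d x > 0" using \<open>x \<notin> S\<close> closed ne by (metis in_closed_iff_infdist_zero infdist_nonneg less_eq_real_def)
  \<comment> \<open>The shift by 2 keeps \<open>s 0\<close> positive.\<close>
  define s where "s k = d x * (1 - 1 / (real k + 2))" for k :: nat
  have s: "0 < s k" "s k < d x" for k unfolding s_def using dx by (auto simp: field_simps add_pos_nonneg)
  have mono: "s k \<le> s l" if "k \<le> l" for k l
    unfolding s_def using dx that by (intro mult_left_mono diff_left_mono divide_left_mono) auto
  have lim: "s \<longlonglongrightarrow> d x"
  proof -
    have "(\<lambda>k. 1 / (real k + 2)) \<longlonglongrightarrow> 0" by real_asymp
    then have "s \<longlonglongrightarrow> d x * (1 - 0)" unfolding s_def by (intro tendsto_intros)
    then show ?thesis by simp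
  qed
  have "(\<integral>\<^sup>+y\<in>ball x (d x). ennreal (F y) \<partial>lborel) = (\<integral>\<^sup>+y. (SUP k. ennreal (F y) * indicator (ball x (s k)) y) \<partial>lborel)"
  proof (rule nn_integral_cong)
    fix y
    show "ennreal (F y) * indicator (ball x (d x)) y = (SUP k. ennreal (F y) * indicator (ball x (s k)) y)"
    proof (cases "y \<in> ball x (d x)")
      case True
      then have "\<forall>\<^sub>F k in sequentially. dist x y < s k" using lim by (intro order_tendstoD) auto
      then obtain k where k: "dist x y < s k" by (auto simp: eventually_sequentially)
      show ?thesis
      proof (rule antisym)
        show "ennreal (F y) * indicator (ball x (d x)) y \<le> (SUP k. ennreal (F y) * indicator (ball x (s k)) y)"
          using True k by (intro SUP_upper2[of k]) auto
      qed (use True in \<open>auto intro!: SUP_least simp: indicator_def\<close>)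
    next
      case False
      then have "indicator (ball x (s k)) y = (0::ennreal)" for k using s[of k] by (auto simp: indicator_def)
      then show ?thesis using False by simp
    qed
  qed
  also have "\<dots> = (SUP k. \<integral>\<^sup>+y\<in>ball x (s k). ennreal (F y) \<partial>lborel)"
  proof (rule nn_integral_monotone_convergence_SUP)
    show "incseq (\<lambda>k y. ennreal (F y) * indicator (ball x (s k)) y)"
      unfolding incseq_def le_fun_def using mono by (auto simp: indicator_def dest: less_le_trans)
  qed measurable
  finally have "ennreal (frac_coeff \<alpha> TYPE('a) (d x)) * (\<integral>\<^sup>+y\<in>ball x (d x). ennreal (F y) \<partial>lborel) =
    (SUP k. ennreal (frac_coeff \<alpha> TYPE('a) (d x)) * (\<integral>\<^sup>+y\<in>ball x (s k). ennreal (F y) \<partial>lborel))"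
    by (simp add: SUP_mult_left_ennreal)
  also have "\<dots> \<le> frac_max \<alpha> S F x"
  proof (rule SUP_least)
    fix k
    have "ennreal (frac_coeff \<alpha> TYPE('a) (d x)) * (\<integral>\<^sup>+y\<in>ball x (s k). ennreal (F y) \<partial>lborel) \<le>
      ennreal (frac_coeff \<alpha> TYPE('a) (s k)) * (\<integral>\<^sup>+y\<in>ball x (s k). ennreal (F y) \<partial>lborel)"
      using s[of k] assms by (intro mult_right_mono ennreal_leI frac_coeff_antimono) auto
    also have "\<dots> \<le> frac_max \<alpha> S F x" by (rule frac_max_upper[OF s])
    finally show "ennreal (frac_coeff \<alpha> TYPE('a) (d x)) * (\<integral>\<^sup>+y\<in>ball x (s k). ennreal (F y) \<partial>lborel) \<le> frac_max \<alpha> S F x" .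
  qed
  finally show ?thesis .
qed

text \<open>Replacing the coefficient at r by the one at r + |e| costs
  \<open>n * norm e * r powr (\<alpha> - 1)\<close> times an average over a ball about x + e, hence
  the term with \<open>hl_max\<close>. After that the ball is enlarged to radius r + |e| about x if
  this is admissible, and split along the maximal ball at x if not.\<close>

lemma frac_max_translate_le:
  fixes F :: "'a \<Rightarrow> real"
  assumes [measurable]: "F \<in> borel_measurable borel" and F: "\<And>y. F y \<ge> 0" and x: "x \<notin> S"
    and \<alpha>: "1 \<le> \<alpha>" "\<alpha> \<le> real DIM('a)"
  shows "frac_max \<alpha> S F (x + e) \<le> frac_max \<alpha> S F x
    + ennreal (real DIM('a) * norm e * d (x + e) powr (\<alpha> - 1)) * hl_max (\<lambda>y. ennreal (F y)) (x + e)
    + ennreal (1 / unit_ball_vol (real DIM('a))) * (\<integral>\<^sup>+y\<in>crescent e x. ennreal (d x powr (\<alpha> - real DIM('a)) * F y) \<partial>lborel)"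
    (is "_ \<le> _ + ?A + ?B")
  unfolding frac_max_def[of _ _ _ "x + e"]
proof (rule SUP_least)
  fix r assume "r \<in> {0<..<d (x + e)}"
  then have r: "0 < r" "r < d (x + e)" by auto
  define h where "h = norm e"
  have h: "h \<ge> 0" unfolding h_def by simp
  have dx: "d x > 0" using x closed ne by (metis in_closed_iff_infdist_zero infdist_nonneg less_eq_real_def)
  define n where "n = real DIM('a)"
  let ?c = "frac_coeff \<alpha> TYPE('a)"
  define I where "I = (\<integral>\<^sup>+y\<in>ball (x + e) r. ennreal (F y) \<partial>lborel)"
  have c: "?c r > 0" "?c (r + h) > 0" using r h by (auto intro!: frac_coeff_pos)
  have 1: "ennreal (?c r) * I \<le> ennreal (?c (r + h)) * I + ?A"
  proof -
    have "ennreal (?c r) \<le> ennreal (?c (r + h)) + ennreal (n * h / r * ?c r)"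
    proof -
      have "?c r \<le> ?c (r + h) + n * h / r * ?c r"
        unfolding n_def using r h \<alpha> by (intro frac_coeff_diff_le) auto
      then have "ennreal (?c r) \<le> ennreal (?c (r + h) + n * h / r * ?c r)" by (rule ennreal_leI)
      also have "\<dots> = ennreal (?c (r + h)) + ennreal (n * h / r * ?c r)"
        using c r h unfolding n_def by (intro ennreal_plus) auto
      finally show ?thesis .
    qed
    then have "ennreal (?c r) * I \<le> ennreal (?c (r + h)) * I + ennreal (n * h / r * ?c r) * I"
      by (metis distrib_right mult_right_mono zero_le)
    also have "ennreal (n * h / r * ?c r) * I = ennreal (n * h * r powr (\<alpha> - 1)) * (I / emeasure lborel (ball (x + e) r))"
    proof -
      have "n * h / r * ?c r = (n * h * r powr (\<alpha> - 1)) / (unit_ball_vol (real DIM('a)) * r ^ DIM('a))"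
        unfolding frac_coeff_def using r by (simp add: powr_diff powr_realpow field_simps)
      then show ?thesis using ennreal_coeff_times_average[OF r(1), of "n * h * r powr (\<alpha> - 1)" I "x + e"] h by (simp add: n_def)
    qed
    also have "\<dots> \<le> ?A" unfolding I_def n_def h_def
      using r \<alpha> by (intro mult_mono ennreal_leI hl_max_upper powr_mono2) auto
    finally show ?thesis by (simp add: add_left_mono)
  qed
  have 2: "ennreal (?c (r + h)) * I \<le> frac_max \<alpha> S F x + ?B"
  proof (cases "r + h < d x")
    case True
    have "I \<le> (\<integral>\<^sup>+y\<in>ball x (r + h). ennreal (F y) \<partial>lborel)"
      unfolding I_def
    proof (rule nn_integral_mono)
      fix y
      have "y \<in> ball (x + e) r \<Longrightarrow> y \<in> ball x (r + h)"
        using dist_triangle[of x y "x + e"] by (simp add: h_def dist_norm)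
      then show "ennreal (F y) * indicator (ball (x + e) r) y \<le> ennreal (F y) * indicator (ball x (r + h)) y"
        by (auto simp: indicator_def)
    qed
    then have "ennreal (?c (r + h)) * I \<le> ennreal (?c (r + h)) * (\<integral>\<^sup>+y\<in>ball x (r + h). ennreal (F y) \<partial>lborel)"
      by (rule mult_left_mono) simp
    also have "\<dots> \<le> frac_max \<alpha> S F x" using r h True by (intro frac_max_upper) auto
    finally show ?thesis by (simp add: add_increasing2)
  next
    \<comment> \<open>Now r + |e| \<ge> d x, so the coefficient may be raised to that of the maximal
      ball at x, which competes by \<open>frac_max_closed_ball\<close>. What protrudes from that
      ball lies in the crescent because r < d (x + e).\<close>
    case False
    have "I \<le> (\<integral>\<^sup>+y. ennreal (F y) * indicator (ball x (d x)) y + ennreal (F y) * indicator (crescent e x) y \<partial>lborel)"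
      unfolding I_def using r
      by (intro nn_integral_mono) (auto simp: indicator_def crescent_def dist_commute)
    also have "\<dots> = (\<integral>\<^sup>+y\<in>ball x (d x). ennreal (F y) \<partial>lborel) + (\<integral>\<^sup>+y\<in>crescent e x. ennreal (F y) \<partial>lborel)"
      by (rule nn_integral_add) measurable
    finally have "ennreal (?c (r + h)) * I \<le> ennreal (?c (d x)) * ((\<integral>\<^sup>+y\<in>ball x (d x). ennreal (F y) \<partial>lborel) + (\<integral>\<^sup>+y\<in>crescent e x. ennreal (F y) \<partial>lborel))"
      using False dx \<alpha> by (intro mult_mono ennreal_leI frac_coeff_antimono) auto
    also have "\<dots> = ennreal (?c (d x)) * (\<integral>\<^sup>+y\<in>ball x (d x). ennreal (F y) \<partial>lborel) + ennreal (?c (d x)) * (\<integral>\<^sup>+y\<in>crescent e x. ennreal (F y) \<partial>lborel)"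
      by (rule distrib_left)
    also have "ennreal (?c (d x)) * (\<integral>\<^sup>+y\<in>crescent e x. ennreal (F y) \<partial>lborel) = ?B"
    proof -
      have "(\<integral>\<^sup>+y\<in>crescent e x. ennreal (d x powr (\<alpha> - real DIM('a)) * F y) \<partial>lborel) =
        (\<integral>\<^sup>+y. ennreal (d x powr (\<alpha> - real DIM('a))) * (ennreal (F y) * indicator (crescent e x) y) \<partial>lborel)"
        using F by (intro nn_integral_cong) (auto simp: ennreal_mult mult_ac)
      also have "\<dots> = ennreal (d x powr (\<alpha> - real DIM('a))) * (\<integral>\<^sup>+y\<in>crescent e x. ennreal (F y) \<partial>lborel)"
        by (rule nn_integral_cmult) measurable
      finally show ?thesis unfolding frac_coeff_def
        by (simp add: mult.assoc[symmetric] ennreal_mult[symmetric])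
    qed
    finally show ?thesis using frac_max_closed_ball[OF assms(1) x \<alpha>(2)] by (meson add_right_mono order_trans)
  qed
  have "ennreal (r powr \<alpha> / measure lborel (ball (x + e) r)) * I \<le> ennreal (?c (r + h)) * I + ?A"
    using 1 frac_coeff_eq[OF r(1), of \<alpha> "x + e"] by simp
  also have "\<dots> \<le> (frac_max \<alpha> S F x + ?B) + ?A" by (intro add_right_mono 2)
  finally show "ennreal (r powr \<alpha> / measure lborel (ball (x + e) r)) * (\<integral>\<^sup>+y\<in>ball (x + e) r. ennreal (F y) \<partial>lborel) \<le> frac_max \<alpha> S F x + ?A + ?B"
    unfolding I_def by (simp add: add_ac)
qed

end

section \<open>Differences of the maximal function in Lebesgue norm\<close>

lemma powr_sum4_le:
  fixes p :: real
  assumes "p \<ge> 0" "0 \<le> a" "0 \<le> b" "0 \<le> c" "0 \<le> d"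
  shows "(a + b + c + d) powr p \<le> 4 powr p * (a powr p + b powr p + c powr p + d powr p)"
proof -
  define M where "M = max (max a b) (max c d)"
  have "(a + b + c + d) powr p \<le> (4 * M) powr p" unfolding M_def using assms by (intro powr_mono2) auto
  also have "\<dots> = 4 powr p * M powr p" unfolding M_def using assms by (simp add: powr_mult)
  also have "M powr p \<le> a powr p + b powr p + c powr p + d powr p"
  proof -
    have "M = a \<or> M = b \<or> M = c \<or> M = d" unfolding M_def by linarith
    moreover have "a powr p \<ge> 0" "b powr p \<ge> 0" "c powr p \<ge> 0" "d powr p \<ge> 0" by auto
    ultimately show ?thesis by fastforce
  qed
  finally show ?thesis by simp
qed

lemma AE_lborel_translate:
  fixes e :: "'a::euclidean_space"
  assumes "AE x in lborel. P x" and [measurable]: "Measurable.pred borel P"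
  shows "AE x in lborel. P (x + e)"
proof -
  have "AE x in distr lborel borel ((+) e). P x" unfolding lborel_distr_plus by (rule assms(1))
  then have "AE x in lborel. P (e + x)" by (subst (asm) AE_distr_iff) auto
  then show ?thesis by (simp add: add.commute)
qed

lemma nn_integral_bounded_finite:
  fixes F :: "'a::euclidean_space \<Rightarrow> real"
  assumes [measurable]: "F \<in> borel_measurable borel" and F: "\<And>y. F y \<ge> 0" and p: "p > 1"
    and fin: "(\<integral>\<^sup>+y. ennreal (F y powr p) \<partial>lborel) < \<infinity>"
  shows "(\<integral>\<^sup>+y\<in>cball x R. ennreal (F y) \<partial>lborel) < \<infinity>"
proof -
  have "(\<integral>\<^sup>+y\<in>cball x R. ennreal (F y) \<partial>lborel) \<le> (\<integral>\<^sup>+y. indicator (cball x R) y + ennreal (F y powr p) \<partial>lborel)"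
  proof (rule nn_integral_mono)
    fix y
    have "ennreal (F y) \<le> ennreal (1 + F y powr p)" using abs_le_1_plus_powr[OF p, of "F y"] F[of y] by (intro ennreal_leI) simp
    then show "ennreal (F y) * indicator (cball x R) y \<le> indicator (cball x R) y + ennreal (F y powr p)"
      by (auto simp: indicator_def)
  qed
  also have "\<dots> = emeasure lborel (cball x R) + (\<integral>\<^sup>+y. ennreal (F y powr p) \<partial>lborel)"
    by (subst nn_integral_add) auto
  also have "\<dots> < \<infinity>" using fin emeasure_compact_finite[of "cball x R"] by (simp add: ennreal_add_eq_top less_top[symmetric])
  finally show ?thesis .
qed

text \<open>The one-sided comparison is used from x to x + e and, with -e, from x + e back to x;
  this bounds the absolute value by two maximal function terms and two crescent terms. The cutoff 2
  \<tau> at x keeps both points farther than \<tau> from S, and translation invariance removes the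
  shifts by e.\<close>

lemma (in closed_complement) frac_max_difference_Lp:
  fixes F :: "'a \<Rightarrow> real"
  assumes p: "p > 1" and [measurable]: "F \<in> borel_measurable borel" and F: "\<And>y. F y \<ge> 0" "\<And>y. y \<in> S \<Longrightarrow> F y = 0"
    and fin: "(\<integral>\<^sup>+y. ennreal (F y powr p) \<partial>lborel) < \<infinity>"
    and \<alpha>: "1 \<le> \<alpha>" "\<alpha> \<le> real DIM('a)" and D: "D > 0" "\<And>x. x \<notin> S \<Longrightarrow> d x powr (\<alpha> - 1) \<le> D"
    and C: "C \<ge> 0" "crescent_bounded p \<alpha> C S" and e: "0 < norm e" "10 * norm e \<le> \<tau>"
  shows "(\<integral>\<^sup>+x. ennreal ((\<bar>enn2real (frac_max \<alpha> S F (x + e)) - enn2real (frac_max \<alpha> S F x)\<bar> * indicator {x. 2 * \<tau> < d x} x) powr p) \<partial>lborel)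
    \<le> ennreal (4 powr p * (2 * ((real DIM('a) * D) powr p * (5 ^ DIM('a) * 4 powr p * p / (p - 1))) + 2 * ((1 / unit_ball_vol (real DIM('a))) powr p * C)) * norm e powr p)
       * (\<integral>\<^sup>+y. ennreal (F y powr p) \<partial>lborel)"
proof -
  define n where "n = real DIM('a)"
  define w where "w = 1 / unit_ball_vol n"
  have w: "w > 0" unfolding w_def n_def by simp
  have n: "n > 0" unfolding n_def by simp
  let ?H = "hl_max (\<lambda>y. ennreal (F y))"
  define h where "h x = enn2real (?H x)" for x
  define u where "u x = enn2real (frac_max \<alpha> S F x)" for x
  define T where "T e x = enn2real (\<integral>\<^sup>+y. ennreal (kern \<alpha> e \<tau> x y * F y) \<partial>lborel)" for e x
  have hm [measurable]: "h \<in> borel_measurable borel" unfolding h_def by measurable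
  have Tm [measurable]: "T e \<in> borel_measurable borel" for e
    unfolding T_def by measurable
  define I where "I = enn2real (\<integral>\<^sup>+y. ennreal (F y powr p) \<partial>lborel)"
  have I: "(\<integral>\<^sup>+y. ennreal (F y powr p) \<partial>lborel) = ennreal I" "I \<ge> 0"
    unfolding I_def using fin by (auto simp: less_top[symmetric])
  have Hae: "AE x in lborel. ?H x < \<infinity>" by (rule hl_max_strong_type(1)[OF assms(2) F(1) p fin])
  have Hae': "AE x in lborel. ?H (x + e) < \<infinity>" by (rule AE_lborel_translate[OF Hae]) measurable
  have tau: "\<tau> > 0" using e by linarith
  have out: "x \<notin> S" if "\<tau> < d x" for x using that tau by auto
  have step: "u (x + e) \<le> u x + n * norm e * D * h (x + e) + w * T e x"
    if x: "\<tau> < d x" and x': "\<tau> < d (x + e)" and fx: "?H x < \<infinity>" "?H (x + e) < \<infinity>" for x e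
  proof -
    \<comment> \<open>Passing to real numbers requires every term to be finite: the maximal
      functions are so by the assumption on x and x + e, the crescent integral because F is
      integrable on bounded sets.\<close>
    have ufin: "frac_max \<alpha> S F y < top" if "?H y < \<infinity>" for y
    proof (rule le_less_trans[OF frac_max_le_hl_max])
      show "ennreal (d y powr \<alpha>) * hl_max (\<lambda>y. ennreal (F y)) y < top"
        using that by (simp add: ennreal_mult_less_top)
    qed (use \<alpha> in simp)
    have fu: "frac_max \<alpha> S F x = ennreal (u x)" "frac_max \<alpha> S F (x + e) = ennreal (u (x + e))" "?H (x + e) = ennreal (h (x + e))"
      unfolding u_def h_def using ufin fx by auto
    have eqT: "(\<integral>\<^sup>+y\<in>crescent e x. ennreal (d x powr (\<alpha> - real DIM('a)) * F y) \<partial>lborel) = (\<integral>\<^sup>+y. ennreal (kern \<alpha> e \<tau> x y * F y) \<partial>lborel)"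
      using x by (intro nn_integral_cong) (auto simp: kern_def shadow_def indicator_def)
    have "(\<integral>\<^sup>+y. ennreal (kern \<alpha> e \<tau> x y * F y) \<partial>lborel) \<le> (\<integral>\<^sup>+y. ennreal (d x powr (\<alpha> - real DIM('a))) * (ennreal (F y) * indicator (cball x (d x + 2 * norm e)) y) \<partial>lborel)"
    proof (rule nn_integral_mono)
      fix y
      show "ennreal (kern \<alpha> e \<tau> x y * F y) \<le> ennreal (d x powr (\<alpha> - real DIM('a))) * (ennreal (F y) * indicator (cball x (d x + 2 * norm e)) y)"
        using crescent_dist(2)[of y e x] F(1)[of y] by (auto simp: kern_def shadow_def indicator_def ennreal_mult dist_commute)
    qed
    also have "\<dots> = ennreal (d x powr (\<alpha> - real DIM('a))) * (\<integral>\<^sup>+y\<in>cball x (d x + 2 * norm e). ennreal (F y) \<partial>lborel)"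
      by (rule nn_integral_cmult) measurable
    also have "\<dots> < \<infinity>" using nn_integral_bounded_finite[OF assms(2) F(1) p fin] by (simp add: ennreal_mult_less_top)
    finally have fT: "(\<integral>\<^sup>+y. ennreal (kern \<alpha> e \<tau> x y * F y) \<partial>lborel) = ennreal (T e x)" unfolding T_def by simp
    have "ennreal (u (x + e)) \<le> ennreal (u x) + ennreal (n * norm e * d (x + e) powr (\<alpha> - 1)) * ennreal (h (x + e)) + ennreal w * ennreal (T e x)"
      using frac_max_translate_le[OF assms(2) F(1) out[OF x] \<alpha>, of e] unfolding fu eqT fT n_def w_def .
    also have "\<dots> = ennreal (u x + n * norm e * d (x + e) powr (\<alpha> - 1) * h (x + e) + w * T e x)"
      using w n by (simp add: ennreal_mult u_def h_def T_def)
    finally have "u (x + e) \<le> u x + n * norm e * d (x + e) powr (\<alpha> - 1) * h (x + e) + w * T e x"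
      using w n by (subst (asm) ennreal_le_iff) (auto simp: u_def h_def T_def)
    also have "\<dots> \<le> u x + n * norm e * D * h (x + e) + w * T e x"
      using D(2)[OF out[OF x']] n by (intro add_right_mono add_left_mono mult_right_mono mult_left_mono) (auto simp: h_def)
    finally show ?thesis .
  qed
  define P where "P = n * norm e * D"
  have P: "P \<ge> 0" unfolding P_def using n D by simp
  have nn: "h x \<ge> 0" "T e x \<ge> 0" for e x unfolding h_def T_def by auto
  have bound: "AE x in lborel. ennreal ((\<bar>u (x + e) - u x\<bar> * indicator {x. 2 * \<tau> < d x} x) powr p) \<le>
     ennreal (4 powr p) * (ennreal (P powr p) * ennreal (h (x + e) powr p) + ennreal (P powr p) * ennreal (h x powr p)
       + ennreal (w powr p) * ennreal (T e x powr p) + ennreal (w powr p) * ennreal (T (- e) (x + e) powr p))"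
    using Hae Hae'
  proof eventually_elim
    case (elim x)
    show ?case
    proof (cases "2 * \<tau> < d x")
      case True
      have "d x \<le> d (x + e) + norm e" using infdist_triangle[of x S "x + e"] by (simp add: dist_norm)
      then have dd: "\<tau> < d x" "\<tau> < d (x + e)" using True e tau by linarith+
      have 1: "u (x + e) \<le> u x + P * h (x + e) + w * T e x" unfolding P_def by (rule step) (use dd elim in auto)
      have "u (x + e + - e) \<le> u (x + e) + n * norm (- e) * D * h (x + e + - e) + w * T (- e) (x + e)"
        by (rule step) (use dd elim in auto)
      then have 2: "u x \<le> u (x + e) + P * h x + w * T (- e) (x + e)" unfolding P_def by simp
      have nn': "0 \<le> P * h (x + e)" "0 \<le> P * h x" "0 \<le> w * T e x" "0 \<le> w * T (- e) (x + e)" using P w nn by auto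
      have "\<bar>u (x + e) - u x\<bar> \<le> P * h (x + e) + P * h x + w * T e x + w * T (- e) (x + e)"
        using 1 2 nn' unfolding abs_le_iff by linarith
      then have "\<bar>u (x + e) - u x\<bar> powr p \<le> (P * h (x + e) + P * h x + w * T e x + w * T (- e) (x + e)) powr p"
        using p by (intro powr_mono2) auto
      also have "\<dots> \<le> 4 powr p * ((P * h (x + e)) powr p + (P * h x) powr p + (w * T e x) powr p + (w * T (- e) (x + e)) powr p)"
        using p nn' by (intro powr_sum4_le) auto
      finally have "\<bar>u (x + e) - u x\<bar> powr p \<le> 4 powr p * (P powr p * h (x + e) powr p + P powr p * h x powr p + w powr p * T e x powr p + w powr p * T (- e) (x + e) powr p)"
        using P w nn by (simp add: powr_mult)
      then have "ennreal (\<bar>u (x + e) - u x\<bar> powr p) \<le> ennreal (4 powr p * (P powr p * h (x + e) powr p + P powr p * h x powr p + w powr p * T e x powr p + w powr p * T (- e) (x + e) powr p))"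
        by (rule ennreal_leI)
      then show ?thesis using True by (simp add: ennreal_mult)
    qed (use p in simp)
  qed
  have HLp: "(\<integral>\<^sup>+x. ennreal (h x powr p) \<partial>lborel) \<le> ennreal (5 ^ DIM('a) * 4 powr p * p / (p - 1)) * ennreal I"
    unfolding I(1)[symmetric] h_def by (rule hl_max_strong_type(2)[OF assms(2) F(1) p fin])
  have TLp: "(\<integral>\<^sup>+x. ennreal (T e x powr p) \<partial>lborel) \<le> ennreal (C * norm e powr p) * ennreal I"
    if "0 < norm e" "10 * norm e \<le> \<tau>" for e
    unfolding I(1)[symmetric] T_def using C(2) that F assms(2) unfolding crescent_bounded_def by blast
  have tr: "(\<integral>\<^sup>+x. ennreal (f (x + e) powr p) \<partial>lborel) = (\<integral>\<^sup>+x. ennreal (f x powr p) \<partial>lborel)"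
    if [measurable]: "f \<in> borel_measurable borel" for f :: "'a \<Rightarrow> real"
    using nn_integral_lborel_translate[of "\<lambda>x. ennreal (f x powr p)" e] by (simp add: add.commute)
  define K1 where "K1 = 5 ^ DIM('a) * 4 powr p * p / (p - 1)"
  have K1: "K1 \<ge> 0" unfolding K1_def using p by simp
  have "(\<integral>\<^sup>+x. ennreal ((\<bar>u (x + e) - u x\<bar> * indicator {x. 2 * \<tau> < d x} x) powr p) \<partial>lborel) \<le>
     (\<integral>\<^sup>+x. ennreal (4 powr p) * (ennreal (P powr p) * ennreal (h (x + e) powr p) + ennreal (P powr p) * ennreal (h x powr p)
       + ennreal (w powr p) * ennreal (T e x powr p) + ennreal (w powr p) * ennreal (T (- e) (x + e) powr p)) \<partial>lborel)"
    by (rule nn_integral_mono_AE[OF bound])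
  also have "\<dots> = ennreal (4 powr p) * (ennreal (P powr p) * (\<integral>\<^sup>+x. ennreal (h (x + e) powr p) \<partial>lborel) + ennreal (P powr p) * (\<integral>\<^sup>+x. ennreal (h x powr p) \<partial>lborel)
       + ennreal (w powr p) * (\<integral>\<^sup>+x. ennreal (T e x powr p) \<partial>lborel) + ennreal (w powr p) * (\<integral>\<^sup>+x. ennreal (T (- e) (x + e) powr p) \<partial>lborel))"
    by (simp add: nn_integral_cmult nn_integral_add)
  also have "\<dots> \<le> ennreal (4 powr p) * (ennreal (P powr p) * (ennreal K1 * ennreal I) + ennreal (P powr p) * (ennreal K1 * ennreal I)
       + ennreal (w powr p) * (ennreal (C * norm e powr p) * ennreal I) + ennreal (w powr p) * (ennreal (C * norm e powr p) * ennreal I))"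
    unfolding tr[OF hm] tr[OF Tm] using HLp TLp[OF e] TLp[of "- e"] e unfolding K1_def[symmetric]
    by (intro mult_left_mono add_mono) auto
  also have "\<dots> = ennreal (4 powr p * (2 * (P powr p * K1) + 2 * (w powr p * (C * norm e powr p)))) * ennreal I"
    using K1 C I by (simp add: ennreal_mult[symmetric] ennreal_plus[symmetric] algebra_simps del: ennreal_plus)
  also have "4 powr p * (2 * (P powr p * K1) + 2 * (w powr p * (C * norm e powr p))) = 4 powr p * (2 * ((n * D) powr p * K1) + 2 * (w powr p * C)) * norm e powr p"
    unfolding P_def using n D by (simp add: powr_mult algebra_simps)
  finally show ?thesis unfolding I(1)[symmetric] n_def w_def K1_def u_def .
qed

section \<open>Weak partial derivatives\<close>

text \<open>A concrete positive weight for \<open>Lp_weak_compactness\<close>: bounded functions of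
  bounded support are dominated by multiples of it.\<close>

lemma integrable_polynomial_weight:
  "integrable lborel (\<lambda>x::'a::euclidean_space. max 1 (norm x) powr (- (real DIM('a) + 1)))"
proof (rule integrableI_bounded)
  let ?w = "\<lambda>x::'a. max 1 (norm x) powr (- (real DIM('a) + 1))"
  let ?E = "{x::'a. 1 \<le> norm x}"
  have "(\<integral>\<^sup>+x. ennreal (norm (?w x)) \<partial>lborel) \<le>
    (\<integral>\<^sup>+x. indicator (cball 0 1) x + ennreal (norm x powr (- (real DIM('a) + 1))) * indicator ?E x \<partial>lborel)"
    by (intro nn_integral_mono) (auto simp: indicator_def max_def)
  also have "\<dots> = emeasure lborel (cball (0::'a) 1) + (\<integral>\<^sup>+x\<in>?E. ennreal (norm x powr (- (real DIM('a) + 1))) \<partial>lborel)"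
    by (subst nn_integral_add) auto
  also have "\<dots> < \<infinity>"
  proof -
    have "(\<integral>\<^sup>+x\<in>?E. ennreal (norm x powr (- (real DIM('a) + 1))) \<partial>lborel) \<le>
       ennreal (unit_ball_vol DIM('a) * (2 powr real DIM('a) * 1 powr (real DIM('a) - (real DIM('a) + 1)) / (1 - 2 powr (- (real DIM('a) + 1 - real DIM('a))))))"
    proof (rule nn_integral_powr_neg_far_le)
      show "emeasure lborel {x \<in> ?E. norm x \<le> r} \<le> ennreal (unit_ball_vol DIM('a) * r powr real DIM('a))" if "1 \<le> r" for r
      proof -
        have "emeasure lborel {x \<in> ?E. norm x \<le> r} \<le> emeasure lborel (cball (0::'a) r)"
          by (intro emeasure_mono) auto
        then show ?thesis using that by (simp add: emeasure_cball powr_realpow)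
      qed
    qed auto
    then have "(\<integral>\<^sup>+x\<in>?E. ennreal (norm x powr (- (real DIM('a) + 1))) \<partial>lborel) < \<infinity>"
      by (rule le_less_trans) simp
    moreover have "emeasure lborel (cball (0::'a) 1) < \<infinity>" using emeasure_compact_finite[of "cball (0::'a) 1"] by simp
    ultimately show ?thesis by (simp add: ennreal_add_eq_top less_top[symmetric])
  qed
  finally show "(\<integral>\<^sup>+x. ennreal (norm (?w x)) \<partial>lborel) < \<infinity>" .
next
  have "(\<lambda>x::'a. max 1 (norm x) powr (- (real DIM('a) + 1))) \<in> borel_measurable borel"
    by (intro borel_measurable_continuous_onI continuous_intros) (auto simp: max_def)
  then show "(\<lambda>x::'a. max 1 (norm x) powr (- (real DIM('a) + 1))) \<in> borel_measurable lborel" by simp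
qed

lemma bounded_support_le_weight:
  fixes \<phi> :: "'a::euclidean_space \<Rightarrow> real"
  assumes "\<And>x. \<bar>\<phi> x\<bar> \<le> M" "\<And>x. norm x > R \<Longrightarrow> \<phi> x = 0" "R \<ge> 1"
  shows "\<bar>\<phi> x\<bar> \<le> M * R powr (real DIM('a) + 1) * max 1 (norm x) powr (- (real DIM('a) + 1))"
proof -
  have M: "M \<ge> 0" using assms(1)[of 0] by linarith
  show ?thesis
  proof (cases "norm x \<le> R")
    case True
    have "1 = R powr (real DIM('a) + 1) * R powr (- (real DIM('a) + 1))" using assms(3) by (simp flip: powr_add)
    also have "\<dots> \<le> R powr (real DIM('a) + 1) * max 1 (norm x) powr (- (real DIM('a) + 1))"
      using True assms(3) by (intro mult_left_mono powr_mono2') auto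
    finally have "M * 1 \<le> M * (R powr (real DIM('a) + 1) * max 1 (norm x) powr (- (real DIM('a) + 1)))"
      using M by (rule mult_left_mono)
    then show ?thesis using assms(1)[of x] by (simp add: mult.assoc)
  qed (use assms(2)[of x] M in simp)
qed

lemma lborel_integral_translate:
  fixes f :: "'a::euclidean_space \<Rightarrow> real"
  assumes [measurable]: "f \<in> borel_measurable borel"
  shows "(LINT x|lborel. f (c + x)) = (LINT x|lborel. f x)"
    and "integrable lborel (\<lambda>x. f (c + x)) \<longleftrightarrow> integrable lborel f"
proof -
  have "(LINT x|lborel. f x) = (LINT x|distr lborel borel ((+) c). f x)" by (simp only: lborel_distr_plus)
  also have "\<dots> = (LINT x|lborel. f (c + x))" by (subst integral_distr) auto
  finally show "(LINT x|lborel. f (c + x)) = (LINT x|lborel. f x)" ..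
  have "integrable lborel f \<longleftrightarrow> integrable (distr lborel borel ((+) c)) f" by (simp only: lborel_distr_plus)
  also have "\<dots> \<longleftrightarrow> integrable lborel (\<lambda>x. f (c + x))" by (subst integrable_distr_eq) auto
  finally show "integrable lborel (\<lambda>x. f (c + x)) \<longleftrightarrow> integrable lborel f" ..
qed

lemma test_function_facts:
  fixes \<phi> :: "real^'n \<Rightarrow> real"
  assumes "\<phi> \<in> test_functions \<Omega>"
  defines "K \<equiv> closure {x. \<phi> x \<noteq> 0}"
  shows "compact K" "K \<subseteq> \<Omega>" "\<And>x. x \<notin> K \<Longrightarrow> \<phi> x = 0" "\<And>x i. x \<notin> K \<Longrightarrow> partial_deriv i \<phi> x = 0"
    "continuous_on UNIV \<phi>" "\<And>i. continuous_on UNIV (partial_deriv i \<phi>)"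
    "\<And>x i t. ((\<lambda>t. \<phi> (x + t *\<^sub>R axis i 1)) has_real_derivative partial_deriv i \<phi> (x + t *\<^sub>R axis i 1)) (at t)"
proof -
  have Ck: "\<And>k. Ck k \<phi>" and K: "compact K" "K \<subseteq> \<Omega>" using assms unfolding test_functions_def by auto
  show "compact K" "K \<subseteq> \<Omega>" by fact+
  show 0: "\<phi> x = 0" if "x \<notin> K" for x
    using that closure_subset[of "{x. \<phi> x \<noteq> 0}"] unfolding K_def by blast
  show "continuous_on UNIV \<phi>" using Ck[of 0] by simp
  have diff: "\<phi> differentiable (at x)" for x using Ck[of "Suc 0"] by simp
  show "continuous_on UNIV (partial_deriv i \<phi>)" for i using Ck[of "Suc 0"] by simp
  have fd: "(\<phi> has_derivative frechet_derivative \<phi> (at x)) (at x)" for x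
    using diff by (simp add: frechet_derivative_works)
  show "((\<lambda>t. \<phi> (x + t *\<^sub>R axis i 1)) has_real_derivative partial_deriv i \<phi> (x + t *\<^sub>R axis i 1)) (at t)" for x i t
  proof -
    let ?D = "frechet_derivative \<phi> (at (x + t *\<^sub>R axis i 1))"
    have "((\<lambda>t. x + t *\<^sub>R axis i 1) has_derivative (\<lambda>s. s *\<^sub>R axis i 1)) (at t)"
      by (auto intro!: derivative_eq_intros)
    then have "((\<lambda>t. \<phi> (x + t *\<^sub>R axis i 1)) has_derivative (\<lambda>s. ?D (s *\<^sub>R axis i 1))) (at t)"
      by (rule has_derivative_compose[OF _ fd])
    moreover have "(\<lambda>s. ?D (s *\<^sub>R axis i 1)) = (*) (partial_deriv i \<phi> (x + t *\<^sub>R axis i 1))"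
      using linear_cmul[OF has_derivative_linear[OF fd]] by (intro ext) (simp add: partial_deriv_def mult.commute)
    ultimately show ?thesis unfolding has_field_derivative_def by (simp only:)
  qed
  show "partial_deriv i \<phi> x = 0" if "x \<notin> K" for x i
  proof -
    have "open (- K)" unfolding K_def by auto
    have "((\<lambda>_. 0::real) has_derivative (\<lambda>_. 0)) (at x)" by simp
    then have "(\<phi> has_derivative (\<lambda>_. 0)) (at x)"
      by (rule has_derivative_transform_within_open[OF _ \<open>open (- K)\<close>]) (use that 0 in auto)
    then have "frechet_derivative \<phi> (at x) = (\<lambda>_. 0)" by (rule frechet_derivative_at[symmetric])
    then show ?thesis by (simp add: partial_deriv_def)
  qed
qed

lemma continuous_compact_support_bounded:
  fixes f :: "'a::euclidean_space \<Rightarrow> real"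
  assumes "continuous_on UNIV f" "compact K" "\<And>x. x \<notin> K \<Longrightarrow> f x = 0"
  obtains M where "M \<ge> 0" "\<And>x. \<bar>f x\<bar> \<le> M"
proof -
  have "bounded (f ` K)"
    using assms by (intro compact_imp_bounded compact_continuous_image) (auto intro: continuous_on_subset)
  then obtain M where M: "\<And>x. x \<in> K \<Longrightarrow> norm (f x) \<le> M" unfolding bounded_iff by auto
  show thesis
  proof (rule that[of "max M 0"])
    show "\<bar>f x\<bar> \<le> max M 0" for x using M[of x] assms(3)[of x] by (cases "x \<in> K") auto
  qed simp
qed

lemma difference_quotient_Lipschitz:
  fixes \<psi> :: "real \<Rightarrow> real"
  assumes "\<And>t. (\<psi> has_real_derivative \<psi>' t) (at t)" "\<And>t. \<bar>\<psi>' t\<bar> \<le> L"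
  shows "\<bar>\<psi> t - \<psi> 0\<bar> \<le> L * \<bar>t\<bar>"
proof -
  have "norm (\<psi> t - \<psi> 0) \<le> L * norm (t - 0)"
    by (rule field_differentiable_bound[of UNIV \<psi> \<psi>' L]) (use assms in auto)
  then show ?thesis by simp
qed

text \<open>The difference quotients of u, cut off near the complement, are bounded in L^p. Their
  weak limit is the derivative because translation invariance moves the quotient onto the test
  function, where it converges uniformly bounded.\<close>

lemma weak_partial_derivative_exists:
  fixes u :: "real^'n \<Rightarrow> real" and i :: 'n
  assumes p: "p > 1" and \<Omega>: "open \<Omega>" "- \<Omega> \<noteq> {}" and [measurable]: "u \<in> borel_measurable borel"
    and loc: "\<And>K. compact K \<Longrightarrow> K \<subseteq> \<Omega> \<Longrightarrow> integrable lborel (\<lambda>x. indicator K x * u x)"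
    and B: "B \<ge> 0" and quot: "\<And>h. h > 0 \<Longrightarrow>
      (\<integral>\<^sup>+x. ennreal ((\<bar>u (x + h *\<^sub>R axis i 1) - u x\<bar> * indicator {x. 20 * h < infdist x (- \<Omega>)} x) powr p) \<partial>lborel) \<le> ennreal (B * h powr p)"
  obtains G where "G \<in> borel_measurable borel" "(\<integral>\<^sup>+x. ennreal (\<bar>G x\<bar> powr p) \<partial>lborel) \<le> ennreal B"
    "\<And>\<phi>. \<phi> \<in> test_functions \<Omega> \<Longrightarrow> (LINT x|lborel. G x * \<phi> x) = - (LINT x|lborel. u x * partial_deriv i \<phi> x)"
proof -
  define e :: "real^'n" where "e = axis i 1"
  define h where "h k = 1 / (real k + 1)" for k :: nat
  have h: "h k > 0" for k unfolding h_def by simp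
  have hlim: "h \<longlonglongrightarrow> 0" unfolding h_def by real_asymp
  define S where "S = - \<Omega>"
  have S: "closed S" "S \<noteq> {}" unfolding S_def using \<Omega> by auto
  have [measurable]: "(\<lambda>x. infdist x S) \<in> borel_measurable borel"
    by (intro borel_measurable_continuous_onI continuous_on_infdist continuous_on_id)
  \<comment> \<open>The cutoff 20 h is 2 \<tau> with \<tau> = 10 h, the smallest value that
    \<open>frac_max_difference_Lp\<close> admits for |e| = h.\<close>
  define g where "g k x = (u (x + h k *\<^sub>R e) - u x) / h k * indicator {x. 20 * h k < infdist x S} x" for k x
  have gm [measurable]: "g k \<in> borel_measurable borel" for k unfolding g_def by measurable
  have gB: "(\<integral>\<^sup>+x. ennreal (\<bar>g k x\<bar> powr p) \<partial>lborel) \<le> ennreal B" for k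
  proof -
    have "(\<integral>\<^sup>+x. ennreal (\<bar>g k x\<bar> powr p) \<partial>lborel) =
      (\<integral>\<^sup>+x. ennreal (h k powr (- p)) * ennreal ((\<bar>u (x + h k *\<^sub>R e) - u x\<bar> * indicator {x. 20 * h k < infdist x S} x) powr p) \<partial>lborel)"
    proof (rule nn_integral_cong)
      fix x
      have "\<bar>g k x\<bar> powr p = h k powr (- p) * (\<bar>u (x + h k *\<^sub>R e) - u x\<bar> * indicator {x. 20 * h k < infdist x S} x) powr p"
        unfolding g_def using h[of k] by (auto simp: indicator_def powr_divide powr_minus field_simps)
      then show "ennreal (\<bar>g k x\<bar> powr p) = ennreal (h k powr (- p)) * ennreal ((\<bar>u (x + h k *\<^sub>R e) - u x\<bar> * indicator {x. 20 * h k < infdist x S} x) powr p)"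
        by (simp add: ennreal_mult[symmetric])
    qed
    also have "\<dots> = ennreal (h k powr (- p)) * (\<integral>\<^sup>+x. ennreal ((\<bar>u (x + h k *\<^sub>R e) - u x\<bar> * indicator {x. 20 * h k < infdist x S} x) powr p) \<partial>lborel)"
      by (rule nn_integral_cmult) measurable
    also have "\<dots> \<le> ennreal (h k powr (- p)) * ennreal (B * h k powr p)"
      unfolding e_def S_def by (intro mult_left_mono quot h) auto
    also have "\<dots> = ennreal B"
      using h[of k] B by (simp add: ennreal_mult[symmetric] powr_minus field_simps)
    finally show ?thesis .
  qed
  let ?w = "\<lambda>x::real^'n. max 1 (norm x) powr (- (real DIM(real^'n) + 1))"
  obtain G where G: "G \<in> borel_measurable borel" "(\<integral>\<^sup>+x. ennreal (\<bar>G x\<bar> powr p) \<partial>lborel) \<le> ennreal B"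
    and Glim: "\<And>\<phi> c l. \<phi> \<in> borel_measurable borel \<Longrightarrow> (\<And>x. \<bar>\<phi> x\<bar> \<le> c * ?w x) \<Longrightarrow>
       (\<lambda>k. LINT x|lborel. g k x * \<phi> x) \<longlonglongrightarrow> l \<Longrightarrow> (LINT x|lborel. G x * \<phi> x) = l"
  proof (rule Lp_weak_compactness[where g = g and p = p and B = B, OF p gm B gB integrable_polynomial_weight])
    show "?w x > 0" for x by (auto simp: max_def)
    show "?w x \<le> 1" for x using powr_mono[of "- (real DIM(real^'n) + 1)" 0 "max 1 (norm x)"] by (auto simp: max_def)
  qed blast
  show thesis
  proof (rule that[OF G])
    fix \<phi> assume \<phi>: "\<phi> \<in> test_functions \<Omega>"
    define K where "K = closure {x. \<phi> x \<noteq> 0}"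
    define \<phi>' where "\<phi>' = partial_deriv i \<phi>"
    note tf = test_function_facts[OF \<phi>, folded K_def]
    have [measurable]: "\<phi> \<in> borel_measurable borel" "\<phi>' \<in> borel_measurable borel"
      unfolding \<phi>'_def using tf(5,6) by (auto intro: borel_measurable_continuous_onI)
    obtain M where M: "M \<ge> 0" "\<And>x. \<bar>\<phi> x\<bar> \<le> M" using continuous_compact_support_bounded[OF tf(5) tf(1) tf(3)] by blast
    obtain L where L: "L \<ge> 0" "\<And>x. \<bar>\<phi>' x\<bar> \<le> L"
      unfolding \<phi>'_def using continuous_compact_support_bounded[OF tf(6) tf(1) tf(4)] by blast
    obtain R0 where R0: "\<And>x. x \<in> K \<Longrightarrow> norm x \<le> R0" using compact_imp_bounded[OF tf(1)] unfolding bounded_iff by auto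
    define R where "R = max 1 R0"
    have R: "R \<ge> 1" "\<And>x. norm x > R \<Longrightarrow> \<phi> x = 0"
      unfolding R_def using R0 tf(3) by force+
    have "K \<inter> S = {}" using tf(2) unfolding S_def by auto
    then obtain \<rho>0 where \<rho>0: "\<rho>0 > 0" "\<And>x y. x \<in> K \<Longrightarrow> y \<in> S \<Longrightarrow> \<rho>0 \<le> dist x y"
      using separate_compact_closed[OF tf(1) S(1)] by metis
    define \<rho> where "\<rho> = \<rho>0 / 2"
    have \<rho>: "0 < \<rho>" "\<rho> < \<rho>0" unfolding \<rho>_def using \<rho>0 by auto
    have dK: "\<rho>0 \<le> infdist x S" if "x \<in> K" for x
      using infdist_attains_inf[OF S, of x] \<rho>0(2)[OF that] by metis
    \<comment> \<open>A compact neighbourhood of the support inside \<Omega>. The restriction v of u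
      to it is integrable on the whole space, so that its translates can be handled freely.\<close>
    define K' where "K' = (\<lambda>(x, y). x + y) ` (K \<times> cball 0 \<rho>)"
    have K': "compact K'" unfolding K'_def
      by (intro compact_continuous_image compact_Times tf(1) compact_cball) (auto simp: case_prod_unfold intro!: continuous_intros)
    have inK': "x + y \<in> K'" if "x \<in> K" "norm y \<le> \<rho>" for x y unfolding K'_def using that by force
    have "K' \<subseteq> \<Omega>"
    proof
      fix z assume "z \<in> K'"
      then obtain x y where xy: "x \<in> K" "norm y \<le> \<rho>" "z = x + y" unfolding K'_def by auto
      then have "dist x z < \<rho>0" using \<rho> by (simp add: dist_norm)
      then show "z \<in> \<Omega>" using \<rho>0(2)[OF xy(1), of z] unfolding S_def by fastforce
    qed
    define v where "v x = indicator K' x * u x" for x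
    have v: "integrable lborel v" unfolding v_def by (rule loc[OF K' \<open>K' \<subseteq> \<Omega>\<close>])
    have [measurable]: "v \<in> borel_measurable borel" using v by auto
    have quotlim: "(\<lambda>k. (\<phi> (- (h k *\<^sub>R e) + x) - \<phi> x) / h k) \<longlonglongrightarrow> - \<phi>' x" for x
    proof -
      have "((\<lambda>t. \<phi> (x + t *\<^sub>R e)) has_real_derivative \<phi>' x) (at 0)"
        using tf(7)[of x i 0] unfolding e_def \<phi>'_def by simp
      then have "((\<lambda>t. (\<phi> (x + t *\<^sub>R e) - \<phi> x) / t) \<longlongrightarrow> \<phi>' x) (at 0)"
        unfolding has_field_derivative_iff by simp
      moreover have "filterlim (\<lambda>k. - h k) (at 0) sequentially"
        using tendsto_minus[OF hlim] h by (auto simp: filterlim_at less_imp_neq[OF h, symmetric])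
      ultimately have "(\<lambda>k. (\<phi> (x + (- h k) *\<^sub>R e) - \<phi> x) / (- h k)) \<longlonglongrightarrow> \<phi>' x"
        by (rule filterlim_compose)
      then have "(\<lambda>k. - ((\<phi> (x + (- h k) *\<^sub>R e) - \<phi> x) / (- h k))) \<longlonglongrightarrow> - \<phi>' x" by (rule tendsto_minus)
      then show ?thesis by (simp add: add.commute)
    qed
    have quotbd: "\<bar>(\<phi> (- (h k *\<^sub>R e) + x) - \<phi> x) / h k\<bar> \<le> L" for x k
    proof -
      have "\<bar>\<phi> (x + (- h k) *\<^sub>R axis i 1) - \<phi> (x + 0 *\<^sub>R axis i 1)\<bar> \<le> L * \<bar>- h k\<bar>"
        by (rule difference_quotient_Lipschitz[OF tf(7)]) (use L(2) in \<open>simp add: \<phi>'_def\<close>)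
      then show ?thesis using h[of k] unfolding e_def by (simp add: field_simps add.commute)
    qed
    have lim1: "(\<lambda>k. LINT x|lborel. v x * ((\<phi> (- (h k *\<^sub>R e) + x) - \<phi> x) / h k)) \<longlonglongrightarrow> (LINT x|lborel. v x * (- \<phi>' x))"
    proof (rule integral_dominated_convergence)
      show "integrable lborel (\<lambda>x. L * \<bar>v x\<bar>)" using v by simp
      show "AE x in lborel. (\<lambda>k. v x * ((\<phi> (- (h k *\<^sub>R e) + x) - \<phi> x) / h k)) \<longlonglongrightarrow> v x * (- \<phi>' x)"
        using quotlim by (intro AE_I2 tendsto_mult tendsto_const) auto
      show "AE x in lborel. norm (v x * ((\<phi> (- (h k *\<^sub>R e) + x) - \<phi> x) / h k)) \<le> L * \<bar>v x\<bar>" for k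
      proof (rule AE_I2)
        fix x
        have "norm (v x * ((\<phi> (- (h k *\<^sub>R e) + x) - \<phi> x) / h k)) = \<bar>v x\<bar> * \<bar>(\<phi> (- (h k *\<^sub>R e) + x) - \<phi> x) / h k\<bar>"
          by (simp only: real_norm_def abs_mult)
        also have "\<dots> \<le> \<bar>v x\<bar> * L" by (intro mult_left_mono quotbd) simp
        finally show "norm (v x * ((\<phi> (- (h k *\<^sub>R e) + x) - \<phi> x) / h k)) \<le> L * \<bar>v x\<bar>" by (simp add: mult.commute)
      qed
    qed measurable
    have vphi: "integrable lborel (\<lambda>x. v x * \<psi> x)" if [measurable]: "\<psi> \<in> borel_measurable borel" and "\<And>x. \<bar>\<psi> x\<bar> \<le> M" for \<psi>
    proof (rule Bochner_Integration.integrable_bound[where f = "\<lambda>x. M * v x"])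
      show "AE x in lborel. norm (v x * \<psi> x) \<le> norm (M * v x)"
      proof (rule AE_I2)
        fix x
        have "\<bar>v x\<bar> * \<bar>\<psi> x\<bar> \<le> \<bar>v x\<bar> * M" by (intro mult_left_mono that) simp
        then show "norm (v x * \<psi> x) \<le> norm (M * v x)" using M(1) by (simp add: abs_mult mult.commute)
      qed
    qed (use v in auto)
    \<comment> \<open>For small h the cutoff equals 1 on the support of \<phi> and the shifted
      points stay in K'. Translating by h e turns the quotient of v into a quotient of \<phi> with
      step -h, whence the minus sign in the limit.\<close>
    have eqk: "(LINT x|lborel. g k x * \<phi> x) = (LINT x|lborel. v x * ((\<phi> (- (h k *\<^sub>R e) + x) - \<phi> x) / h k))"
      if k: "20 * h k < \<rho>" for k
    proof -
      have "g k x * \<phi> x = (v (h k *\<^sub>R e + x) * \<phi> x - v x * \<phi> x) / h k" for x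
      proof (cases "x \<in> K")
        case True
        have "norm (h k *\<^sub>R e) \<le> \<rho>" using k h[of k] by (simp add: e_def)
        then have "x + h k *\<^sub>R e \<in> K'" using True by (intro inK')
        moreover have "x \<in> K'" using inK'[OF True, of 0] \<rho> by simp
        moreover have "20 * h k < infdist x S" using dK[OF True] k \<rho> by linarith
        ultimately show ?thesis unfolding g_def v_def using h[of k] by (simp add: add.commute field_simps)
      qed (use tf(3) in simp)
      then have "(LINT x|lborel. g k x * \<phi> x) = (LINT x|lborel. (v (h k *\<^sub>R e + x) * \<phi> x - v x * \<phi> x) / h k)" by simp
      also have "\<dots> = ((LINT x|lborel. v (h k *\<^sub>R e + x) * \<phi> x) - (LINT x|lborel. v x * \<phi> x)) / h k"
      proof -
        have "integrable lborel (\<lambda>x. v (h k *\<^sub>R e + x) * \<phi> (- (h k *\<^sub>R e) + (h k *\<^sub>R e + x)))"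
          by (subst lborel_integral_translate(2)[of "\<lambda>x. v x * \<phi> (- (h k *\<^sub>R e) + x)"]) (auto intro!: vphi M)
        then show ?thesis using vphi[of \<phi>] M(2) by simp
      qed
      also have "(LINT x|lborel. v (h k *\<^sub>R e + x) * \<phi> x) = (LINT x|lborel. v x * \<phi> (- (h k *\<^sub>R e) + x))"
        using lborel_integral_translate(1)[of "\<lambda>x. v x * \<phi> (- (h k *\<^sub>R e) + x)" "h k *\<^sub>R e"] by simp
      also have "((LINT x|lborel. v x * \<phi> (- (h k *\<^sub>R e) + x)) - (LINT x|lborel. v x * \<phi> x)) / h k =
         (LINT x|lborel. (v x * \<phi> (- (h k *\<^sub>R e) + x) - v x * \<phi> x) / h k)"
        using vphi[of \<phi>] vphi[of "\<lambda>x. \<phi> (- (h k *\<^sub>R e) + x)"] M(2) by simp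
      also have "\<dots> = (LINT x|lborel. v x * ((\<phi> (- (h k *\<^sub>R e) + x) - \<phi> x) / h k))"
        by (simp add: algebra_simps)
      finally show ?thesis .
    qed
    have "\<forall>\<^sub>F k in sequentially. 20 * h k < \<rho>"
    proof (rule order_tendstoD)
      have "(\<lambda>k. 20 * h k) \<longlonglongrightarrow> 20 * 0" by (intro tendsto_intros hlim)
      then show "(\<lambda>k. 20 * h k) \<longlonglongrightarrow> 0" by simp
    qed (use \<rho> in simp)
    then have "\<forall>\<^sub>F k in sequentially. (LINT x|lborel. v x * ((\<phi> (- (h k *\<^sub>R e) + x) - \<phi> x) / h k)) = (LINT x|lborel. g k x * \<phi> x)"
      by eventually_elim (simp add: eqk)
    then have "(\<lambda>k. LINT x|lborel. g k x * \<phi> x) \<longlonglongrightarrow> (LINT x|lborel. v x * (- \<phi>' x))"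
      by (rule Lim_transform_eventually[OF lim1])
    moreover have "(LINT x|lborel. v x * (- \<phi>' x)) = - (LINT x|lborel. u x * \<phi>' x)"
    proof -
      have "v x * (- \<phi>' x) = - (u x * \<phi>' x)" for x
        using inK'[of x 0] \<rho> tf(4)[of x i] unfolding v_def \<phi>'_def by (cases "x \<in> K") auto
      then show ?thesis by (simp only: Bochner_Integration.integral_minus)
    qed
    ultimately have lim2: "(\<lambda>k. LINT x|lborel. g k x * \<phi> x) \<longlonglongrightarrow> - (LINT x|lborel. u x * \<phi>' x)" by simp
    show "(LINT x|lborel. G x * \<phi> x) = - (LINT x|lborel. u x * partial_deriv i \<phi> x)"
      unfolding \<phi>'_def[symmetric]
    proof (rule Glim[OF _ _ lim2])
      show "\<bar>\<phi> x\<bar> \<le> M * R powr (real DIM(real^'n) + 1) * ?w x" for x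
        by (rule bounded_support_le_weight[of \<phi>, OF M(2) R(2) R(1)])
    qed measurable
  qed
qed

section \<open>Transfer to Lebesgue measurable functions and assembly of the gradient\<close>

lemma Lp_space_borel_representative:
  fixes f :: "real^'n \<Rightarrow> real"
  assumes "open \<Omega>" "f \<in> Lp_space p \<Omega>" "p > 0"
  obtains F where "F \<in> borel_measurable borel" "\<And>x. F x \<ge> 0" "\<And>x. x \<notin> \<Omega> \<Longrightarrow> F x = 0"
    "AE x in lborel. x \<in> \<Omega> \<longrightarrow> F x = \<bar>f x\<bar>"
    "(\<integral>\<^sup>+x. ennreal (F x powr p) \<partial>lborel) = ennreal (Lp_norm p \<Omega> f powr p)"
proof -
  have \<Omega>: "\<Omega> \<in> sets borel" "\<Omega> \<inter> space lebesgue \<in> sets lebesgue" using assms(1) by auto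
  have f: "f \<in> borel_measurable (lebesgue_on \<Omega>)" "integrable (lebesgue_on \<Omega>) (\<lambda>x. norm (f x) powr p)"
    using assms(2) unfolding Lp_space_def by auto
  have "(\<lambda>x. if x \<in> \<Omega> then f x else 0) \<in> borel_measurable lebesgue"
    using f(1) \<Omega>(2) by (subst borel_measurable_if) auto
  then obtain f' where f': "f' \<in> borel_measurable lborel" "AE x in lborel. (if x \<in> \<Omega> then f x else 0) = f' x"
    using completion_ex_borel_measurable_real by blast
  have [measurable]: "f' \<in> borel_measurable borel" "\<Omega> \<in> sets borel" using f' \<Omega> by auto
  define F where "F x = \<bar>f' x\<bar> * indicator \<Omega> x" for x
  have AEF: "AE x in lborel. x \<in> \<Omega> \<longrightarrow> F x = \<bar>f x\<bar>"
    using f'(2) by eventually_elim (auto simp: F_def)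
  have "(\<integral>\<^sup>+x. ennreal (F x powr p) \<partial>lborel) = (\<integral>\<^sup>+x. ennreal (norm (indicator \<Omega> x *\<^sub>R (norm (f x) powr p))) \<partial>lborel)"
  proof (rule nn_integral_cong_AE, use AEF in eventually_elim)
    case (elim x)
    then show ?case by (cases "x \<in> \<Omega>") (auto simp: F_def)
  qed
  also have "\<dots> = (\<integral>\<^sup>+x. ennreal (norm (indicator \<Omega> x *\<^sub>R (norm (f x) powr p))) \<partial>lebesgue)"
    by (simp only: nn_integral_completion)
  also have "\<dots> = ennreal (LINT x|lebesgue. norm (indicator \<Omega> x *\<^sub>R (norm (f x) powr p)))"
    using f(2) unfolding integrable_restrict_space[OF \<Omega>(2)] by (intro nn_integral_eq_integral integrable_norm) auto
  also have "(LINT x|lebesgue. norm (indicator \<Omega> x *\<^sub>R (norm (f x) powr p))) = (LINT x|lebesgue_on \<Omega>. norm (f x) powr p)"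
    unfolding integral_restrict_space[OF \<Omega>(2)] by (intro Bochner_Integration.integral_cong) auto
  also have "\<dots> = Lp_norm p \<Omega> f powr p"
    unfolding Lp_norm_def using assms(3) by (simp add: powr_powr integral_nonneg_AE)
  finally have "(\<integral>\<^sup>+x. ennreal (F x powr p) \<partial>lborel) = ennreal (Lp_norm p \<Omega> f powr p)" .
  moreover have "F \<in> borel_measurable borel" unfolding F_def by measurable
  ultimately show thesis using AEF by (intro that[of F]) (auto simp: F_def)
qed

text \<open>Equality holds at every x, although F represents |f| only almost everywhere: all balls
  lie in \<Omega>, and their integrals do not see null sets. For x outside \<Omega> both suprema are
  taken over the empty set.\<close>

lemma local_frac_max_eq_frac_max:
  fixes f F :: "real^'n \<Rightarrow> real"
  assumes "open \<Omega>" "- \<Omega> \<noteq> {}" "AE x in lborel. x \<in> \<Omega> \<longrightarrow> F x = \<bar>f x\<bar>"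
  shows "local_frac_max \<alpha> \<Omega> f x = frac_max \<alpha> (- \<Omega>) F x"
  unfolding local_frac_max_def frac_max_def
proof (rule SUP_cong)
  fix r assume r: "r \<in> {0<..<infdist x (- \<Omega>)}"
  have sub: "ball x r \<subseteq> \<Omega>"
  proof
    fix y assume "y \<in> ball x r"
    show "y \<in> \<Omega>"
    proof (rule ccontr)
      assume "y \<notin> \<Omega>"
      then have "infdist x (- \<Omega>) \<le> dist x y" by (intro infdist_le) auto
      then show False using r \<open>y \<in> ball x r\<close> by auto
    qed
  qed
  have "(\<integral>\<^sup>+y\<in>ball x r. ennreal \<bar>f y\<bar> \<partial>lborel) = (\<integral>\<^sup>+y\<in>ball x r. ennreal (F y) \<partial>lborel)"
  proof (rule nn_integral_cong_AE, use assms(3) in eventually_elim)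
    case (elim y)
    then show ?case using sub by (cases "y \<in> ball x r") (auto simp: indicator_def)
  qed
  then show "ennreal (r powr \<alpha> / measure lebesgue (ball x r)) * (\<integral>\<^sup>+y\<in>ball x r. ennreal \<bar>f y\<bar> \<partial>lebesgue) =
    ennreal (r powr \<alpha> / measure lborel (ball x r)) * (\<integral>\<^sup>+y\<in>ball x r. ennreal (F y) \<partial>lborel)"
    by (simp add: nn_integral_completion measure_completion)
qed (rule refl)

lemma integrable_indicator_compact_of_Lp:
  fixes G :: "'a::euclidean_space \<Rightarrow> real"
  assumes [measurable]: "G \<in> borel_measurable borel" and p: "p > 1"
    and fin: "(\<integral>\<^sup>+x. ennreal (\<bar>G x\<bar> powr p) \<partial>lborel) < \<infinity>" and K: "compact K"
  shows "integrable lborel (\<lambda>x. indicator K x * G x)"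
proof (rule integrableI_bounded)
  have [measurable]: "K \<in> sets borel" using compact_imp_closed[OF K] by simp
  show "(\<lambda>x. indicator K x * G x) \<in> borel_measurable lborel" by measurable
  obtain R where "\<forall>x\<in>K. norm x \<le> R" using compact_imp_bounded[OF K] unfolding bounded_iff by blast
  then have R: "K \<subseteq> cball 0 R" by auto
  have "(\<integral>\<^sup>+x. ennreal (norm (indicator K x * G x)) \<partial>lborel) \<le> (\<integral>\<^sup>+x\<in>cball 0 R. ennreal \<bar>G x\<bar> \<partial>lborel)"
    using R by (intro nn_integral_mono) (auto simp: indicator_def)
  also have "\<dots> < \<infinity>" by (rule nn_integral_bounded_finite[OF _ _ p fin]) auto
  finally show "(\<integral>\<^sup>+x. ennreal (norm (indicator K x * G x)) \<partial>lborel) < \<infinity>" .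
qed

lemma powr_sum_le_card:
  fixes a :: "'n::finite \<Rightarrow> real"
  assumes "\<And>i. a i \<ge> 0" "p \<ge> 0"
  shows "(\<Sum>i\<in>UNIV. a i) powr p \<le> real CARD('n) powr p * (\<Sum>i\<in>UNIV. a i powr p)"
proof -
  define M where "M = Max (range a)"
  have M: "M \<in> range a" "\<And>i. a i \<le> M" unfolding M_def by (auto intro!: Max_in)
  then obtain j where j: "M = a j" by auto
  have "(\<Sum>i\<in>UNIV. a i) \<le> real CARD('n) * M" using sum_bounded_above[of UNIV a M] M by simp
  then have "(\<Sum>i\<in>UNIV. a i) powr p \<le> (real CARD('n) * M) powr p"
    using assms by (intro powr_mono2) (auto intro: sum_nonneg)
  also have "\<dots> = real CARD('n) powr p * a j powr p" using assms j by (simp add: powr_mult)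
  also have "\<dots> \<le> real CARD('n) powr p * (\<Sum>i\<in>UNIV. a i powr p)"
    by (intro mult_left_mono member_le_sum) auto
  finally show ?thesis .
qed

lemma integrable_lborel_of_frac_max:
  fixes F :: "'a::euclidean_space \<Rightarrow> real"
  assumes p: "p > 1" and [measurable]: "F \<in> borel_measurable borel" and F: "\<And>y. F y \<ge> 0"
    and fin: "(\<integral>\<^sup>+y. ennreal (F y powr p) \<partial>lborel) < \<infinity>" and "\<alpha> \<ge> 0" and K: "compact K"
  shows "integrable lborel (\<lambda>x. indicator K x * enn2real (frac_max \<alpha> S F x))"
proof -
  let ?H = "hl_max (\<lambda>y. ennreal (F y))"
  have [measurable]: "K \<in> sets borel" using compact_imp_closed[OF K] by simp
  have "bounded ((\<lambda>x. infdist x S) ` K)"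
    by (intro compact_imp_bounded compact_continuous_image K continuous_on_infdist continuous_on_id)
  then obtain R where R: "\<And>x. x \<in> K \<Longrightarrow> norm (infdist x S) \<le> R" unfolding bounded_iff by auto
  have "integrable lborel (\<lambda>x. indicator K x * enn2real (?H x))"
  proof (rule integrable_indicator_compact_of_Lp[OF _ p _ K])
    have "(\<integral>\<^sup>+x. ennreal (enn2real (?H x) powr p) \<partial>lborel) \<le>
       ennreal (5 ^ DIM('a) * 4 powr p * p / (p - 1)) * (\<integral>\<^sup>+x. ennreal (F x powr p) \<partial>lborel)"
      by (rule hl_max_strong_type(2)[OF assms(2) F p fin])
    also have "\<dots> < \<infinity>" using fin by (simp add: ennreal_mult_less_top)
    finally show "(\<integral>\<^sup>+x. ennreal (\<bar>enn2real (?H x)\<bar> powr p) \<partial>lborel) < \<infinity>" by simp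
  qed measurable
  then have "integrable lborel (\<lambda>x. max 0 R powr \<alpha> * (indicator K x * enn2real (?H x)))" by simp
  then show ?thesis
  proof (rule Bochner_Integration.integrable_bound)
    show "AE x in lborel. norm (indicator K x * enn2real (frac_max \<alpha> S F x)) \<le> norm (max 0 R powr \<alpha> * (indicator K x * enn2real (?H x)))"
      using hl_max_strong_type(1)[OF assms(2) F p fin]
    proof eventually_elim
      case (elim x)
      show ?case
      proof (cases "x \<in> K")
        case True
        have "enn2real (frac_max \<alpha> S F x) \<le> enn2real (ennreal (infdist x S powr \<alpha>) * ?H x)"
          using elim \<open>\<alpha> \<ge> 0\<close> by (intro enn2real_mono frac_max_le_hl_max) (auto simp: ennreal_mult_less_top)
        also have "\<dots> = infdist x S powr \<alpha> * enn2real (?H x)" by (simp add: enn2real_mult)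
        also have "\<dots> \<le> max 0 R powr \<alpha> * enn2real (?H x)"
          using R[OF True] \<open>\<alpha> \<ge> 0\<close> by (intro mult_right_mono powr_mono2) (auto simp: infdist_nonneg)
        finally show ?thesis using True by simp
      qed simp
    qed
  qed measurable
qed

text \<open>The factor of \<open>norm e powr p\<close> in \<open>frac_max_difference_Lp\<close>;
  apart from p, D and C it involves only the dimension.\<close>

definition gradient_const :: "real \<Rightarrow> 'a::euclidean_space itself \<Rightarrow> real \<Rightarrow> real \<Rightarrow> real" where
  "gradient_const p _ D C = 4 powr p * (2 * ((real DIM('a) * D) powr p * (5 ^ DIM('a) * 4 powr p * p / (p - 1))) + 2 * ((1 / unit_ball_vol (real DIM('a))) powr p * C))"

text \<open>Each coordinate direction yields one weak partial derivative with the same bound. The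
  norm of the gradient is at most the sum of the absolute values of its coordinates;
  \<open>powr_sum_le_card\<close> contributes \<open>CARD('n) powr p\<close>, and summing the equal
  bounds contributes one more \<open>CARD('n)\<close>.\<close>

lemma local_frac_max_weakly_differentiable:
  fixes \<Omega> :: "(real^'n) set" and f :: "real^'n \<Rightarrow> real"
  assumes p: "p > 1" and \<Omega>: "open \<Omega>" "- \<Omega> \<noteq> {}" and f: "f \<in> Lp_space p \<Omega>"
    and \<alpha>: "1 \<le> \<alpha>" "\<alpha> \<le> real CARD('n)" and D: "D > 0" "\<And>x. x \<in> \<Omega> \<Longrightarrow> infdist x (- \<Omega>) powr (\<alpha> - 1) \<le> D"
    and C: "C \<ge> 0" "crescent_bounded p \<alpha> C (- \<Omega>)"
  shows "weakly_differentiable_with_bound p \<Omega> (local_frac_max \<alpha> \<Omega> f)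
    ((real CARD('n) powr p * real CARD('n) * gradient_const p TYPE(real^'n) D C) powr (1 / p) * Lp_norm p \<Omega> f)"
proof -
  define S where "S = - \<Omega>"
  have S: "closed S" "S \<noteq> {}" unfolding S_def using \<Omega> by auto
  interpret closed_complement S using S by unfold_locales
  obtain F where [measurable]: "F \<in> borel_measurable borel" and F0: "\<And>x. F x \<ge> 0" and FS: "\<And>x. x \<notin> \<Omega> \<Longrightarrow> F x = 0"
    and Ff: "AE x in lborel. x \<in> \<Omega> \<longrightarrow> F x = \<bar>f x\<bar>"
    and FI: "(\<integral>\<^sup>+x. ennreal (F x powr p) \<partial>lborel) = ennreal (Lp_norm p \<Omega> f powr p)"
    using Lp_space_borel_representative[OF \<Omega>(1) f] p by auto
  have fin: "(\<integral>\<^sup>+x. ennreal (F x powr p) \<partial>lborel) < \<infinity>" unfolding FI by simp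
  have eq: "local_frac_max \<alpha> \<Omega> f x = frac_max \<alpha> S F x" for x
    unfolding S_def by (rule local_frac_max_eq_frac_max[OF \<Omega> Ff])
  define u where "u x = enn2real (frac_max \<alpha> S F x)" for x
  have um [measurable]: "u \<in> borel_measurable borel" unfolding u_def by measurable
  have \<Omega>m [measurable]: "\<Omega> \<in> sets borel" using \<Omega> by simp
  have \<Omega>s: "\<Omega> \<inter> space lebesgue \<in> sets lebesgue" by simp
  have uloc: "integrable lborel (\<lambda>x. indicator K x * u x)" if "compact K" for K
    unfolding u_def by (rule integrable_lborel_of_frac_max[OF p _ F0 fin _ that]) (use \<alpha> in auto)
  define I where "I = Lp_norm p \<Omega> f powr p"
  define B where "B = gradient_const p TYPE(real^'n) D C * I"
  have gc: "gradient_const p TYPE(real^'n) D C \<ge> 0" unfolding gradient_const_def using p C by simp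
  have B: "B \<ge> 0" unfolding B_def I_def using gc by simp
  have quot: "(\<integral>\<^sup>+x. ennreal ((\<bar>u (x + h *\<^sub>R axis i 1) - u x\<bar> * indicator {x. 20 * h < infdist x (- \<Omega>)} x) powr p) \<partial>lborel) \<le> ennreal (B * h powr p)"
    if h: "h > 0" for h and i :: 'n
  proof -
    have ne: "norm (h *\<^sub>R axis i 1 :: real^'n) = h" using h by simp
    have "(\<integral>\<^sup>+x. ennreal ((\<bar>u (x + h *\<^sub>R axis i 1) - u x\<bar> * indicator {x. 2 * (10 * h) < infdist x S} x) powr p) \<partial>lborel) \<le>
      ennreal (gradient_const p TYPE(real^'n) D C * norm (h *\<^sub>R axis i 1 :: real^'n) powr p) * (\<integral>\<^sup>+x. ennreal (F x powr p) \<partial>lborel)"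
      unfolding u_def gradient_const_def
    proof (rule frac_max_difference_Lp[OF p _ F0 _ fin \<alpha>(1) _ D(1) _ C(1)])
      show "crescent_bounded p \<alpha> C S" using C(2) unfolding S_def .
      show "infdist x S powr (\<alpha> - 1) \<le> D" if "x \<notin> S" for x using D(2)[of x] that unfolding S_def by simp
    qed (use FS \<alpha> ne h in \<open>auto simp: S_def\<close>)
    also have "\<dots> = ennreal (B * h powr p)"
      unfolding ne FI using gc by (simp add: ennreal_mult[symmetric] B_def I_def mult_ac)
    finally show ?thesis unfolding S_def by simp
  qed
  have "\<exists>G. G \<in> borel_measurable borel \<and> (\<integral>\<^sup>+x. ennreal (\<bar>G x\<bar> powr p) \<partial>lborel) \<le> ennreal B \<and>
    (\<forall>\<phi>\<in>test_functions \<Omega>. (LINT x|lborel. G x * \<phi> x) = - (LINT x|lborel. u x * partial_deriv i \<phi> x))" for i :: 'n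
    by (rule weak_partial_derivative_exists[OF p \<Omega> um uloc B quot]) blast+
  then have "\<exists>G. \<forall>i::'n. G i \<in> borel_measurable borel \<and> (\<integral>\<^sup>+x. ennreal (\<bar>G i x\<bar> powr p) \<partial>lborel) \<le> ennreal B \<and>
    (\<forall>\<phi>\<in>test_functions \<Omega>. (LINT x|lborel. G i x * \<phi> x) = - (LINT x|lborel. u x * partial_deriv i \<phi> x))"
    by (intro choice allI)
  then obtain G where Gm: "\<And>i::'n. G i \<in> borel_measurable borel" and GB: "\<And>i. (\<integral>\<^sup>+x. ennreal (\<bar>G i x\<bar> powr p) \<partial>lborel) \<le> ennreal B"
    and G: "\<And>i \<phi>. \<phi> \<in> test_functions \<Omega> \<Longrightarrow> (LINT x|lborel. G i x * \<phi> x) = - (LINT x|lborel. u x * partial_deriv i \<phi> x)"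
    by blast
  note [measurable] = Gm
  define g :: "real^'n \<Rightarrow> real^'n" where "g x = (\<Sum>i\<in>UNIV. G i x *\<^sub>R axis i 1)" for x
  have gm [measurable]: "g \<in> borel_measurable borel" unfolding g_def by measurable
  have gi: "g x $ i = G i x" for x i
    unfolding g_def by (simp add: axis_def if_distrib cong: if_cong)
  have gn: "norm (g x) \<le> (\<Sum>i\<in>UNIV. \<bar>G i x\<bar>)" for x
    using norm_le_l1_cart[of "g x"] by (simp add: gi)
  have Gint: "integrable lborel (\<lambda>x. \<bar>G i x\<bar> powr p)" for i
    using GB[of i] by (intro integrableI_bounded) (auto simp: le_less_trans)
  have Gle: "(LINT x|lborel. \<bar>G i x\<bar> powr p) \<le> B" for i
  proof -
    have "ennreal (LINT x|lborel. \<bar>G i x\<bar> powr p) \<le> ennreal B"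
      using GB[of i] by (subst nn_integral_eq_integral[symmetric, OF Gint]) auto
    then show ?thesis using B by simp
  qed
  define N where "N = real CARD('n)"
  have gpow: "norm (g x) powr p \<le> N powr p * (\<Sum>i\<in>UNIV. \<bar>G i x\<bar> powr p)" for x
  proof -
    have "norm (g x) powr p \<le> (\<Sum>i\<in>UNIV. \<bar>G i x\<bar>) powr p" using gn p by (intro powr_mono2) auto
    also have "\<dots> \<le> N powr p * (\<Sum>i\<in>UNIV. \<bar>G i x\<bar> powr p)"
      unfolding N_def using p by (intro powr_sum_le_card) auto
    finally show ?thesis .
  qed
  have gint: "integrable lborel (\<lambda>x. norm (g x) powr p)"
    by (rule Bochner_Integration.integrable_bound[of lborel "\<lambda>x. N powr p * (\<Sum>i\<in>UNIV. \<bar>G i x\<bar> powr p)"])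
       (use Gint gpow in \<open>auto intro!: AE_I2 order_trans[OF gpow abs_ge_self]\<close>)
  have gle: "(LINT x|lborel. norm (g x) powr p) \<le> N powr p * N * B"
  proof -
    have "(LINT x|lborel. norm (g x) powr p) \<le> (LINT x|lborel. N powr p * (\<Sum>i\<in>UNIV. \<bar>G i x\<bar> powr p))"
      using gint Gint gpow by (intro integral_mono) auto
    also have "\<dots> = N powr p * (\<Sum>i\<in>UNIV. (LINT x|lborel. \<bar>G i x\<bar> powr p))"
      using Gint by simp
    also have "\<dots> \<le> N powr p * (\<Sum>i\<in>(UNIV::'n set). B)" by (intro mult_left_mono sum_mono Gle) auto
    finally show ?thesis by (simp add: N_def mult.assoc)
  qed
  have gint': "integrable lebesgue (\<lambda>x. indicator \<Omega> x *\<^sub>R (norm (g x) powr p))"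
  proof -
    have "integrable lborel (\<lambda>x. indicator \<Omega> x *\<^sub>R (norm (g x) powr p))"
      using gint by (rule Bochner_Integration.integrable_bound) (auto simp: indicator_def)
    then show ?thesis by (subst integrable_completion) auto
  qed
  show ?thesis unfolding weakly_differentiable_with_bound_def
  proof (intro conjI exI[of _ g])
    show "AE x in lebesgue_on \<Omega>. local_frac_max \<alpha> \<Omega> f x < \<infinity>"
    proof -
      have "AE x in lborel. hl_max (\<lambda>y. ennreal (F y)) x < \<infinity>" by (rule hl_max_strong_type(1)[OF _ F0 p fin]) measurable
      then have "AE x in lborel. local_frac_max \<alpha> \<Omega> f x < \<infinity>"
      proof eventually_elim
        case (elim x)
        have "frac_max \<alpha> S F x \<le> ennreal (infdist x S powr \<alpha>) * hl_max (\<lambda>y. ennreal (F y)) x"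
          using \<alpha> by (intro frac_max_le_hl_max) simp
        also have "\<dots> < \<infinity>" using elim by (simp add: ennreal_mult_less_top)
        finally show ?case unfolding eq .
      qed
      then have "AE x in lebesgue. local_frac_max \<alpha> \<Omega> f x < \<infinity>" by (rule AE_completion)
      then show ?thesis unfolding AE_restrict_space_iff[OF \<Omega>s] by eventually_elim simp
    qed
    show "g \<in> Lp_space p \<Omega>"
      unfolding Lp_space_def
    proof (intro CollectI conjI)
      have "g \<in> borel_measurable lebesgue" using gm by (simp add: measurable_completion)
      then show "g \<in> borel_measurable (lebesgue_on \<Omega>)" by (rule measurable_restrict_space1)
      show "integrable (lebesgue_on \<Omega>) (\<lambda>x. norm (g x) powr p)"
        unfolding integrable_restrict_space[OF \<Omega>s] by (rule gint')
    qed
    show "Lp_norm p \<Omega> g \<le> (real CARD('n) powr p * real CARD('n) * gradient_const p TYPE(real^'n) D C) powr (1 / p) * Lp_norm p \<Omega> f"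
    proof -
      have "(LINT x|lebesgue_on \<Omega>. norm (g x) powr p) = (LINT x|lebesgue. indicator \<Omega> x *\<^sub>R (norm (g x) powr p))"
        by (rule integral_restrict_space[OF \<Omega>s])
      also have "\<dots> = (LINT x|lborel. indicator \<Omega> x *\<^sub>R (norm (g x) powr p))"
        by (rule integral_completion) simp
      also have "\<dots> \<le> (LINT x|lborel. norm (g x) powr p)"
        using gint gint' by (intro integral_mono) (auto simp: integrable_completion indicator_def)
      also have "\<dots> \<le> N powr p * N * B" by (rule gle)
      finally have "Lp_norm p \<Omega> g \<le> (N powr p * N * B) powr (1 / p)"
        unfolding Lp_norm_def using p by (intro powr_mono2) (auto intro: integral_nonneg_AE)
      also have "\<dots> = (N powr p * N * gradient_const p TYPE(real^'n) D C) powr (1 / p) * I powr (1 / p)"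
        unfolding B_def using gc by (simp add: powr_mult[symmetric] N_def I_def mult.assoc)
      also have "I powr (1 / p) = Lp_norm p \<Omega> f"
        unfolding I_def using p by (simp add: powr_powr Lp_norm_def)
      finally show ?thesis unfolding N_def .
    qed
    show "has_weak_gradient \<Omega> (\<lambda>x. enn2real (local_frac_max \<alpha> \<Omega> f x)) g"
      unfolding has_weak_gradient_def eq u_def[symmetric]
    proof (intro conjI ballI allI)
      show "locally_integrable \<Omega> u"
        unfolding locally_integrable_def
      proof (intro allI impI)
        fix K assume K: "compact K \<and> K \<subseteq> \<Omega>"
        then have [measurable]: "K \<in> sets borel" by (intro borel_closed compact_imp_closed) simp
        have "integrable lebesgue (\<lambda>x. indicator K x * u x)" using uloc K by (subst integrable_completion) auto
        then show "u absolutely_integrable_on K" unfolding set_integrable_def by simp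
      qed
      show "locally_integrable \<Omega> g"
        unfolding locally_integrable_def
      proof (intro allI impI)
        fix K assume K: "compact K \<and> K \<subseteq> \<Omega>"
        then have [measurable]: "K \<in> sets borel" by (intro borel_closed compact_imp_closed) simp
        have "integrable lborel (\<lambda>x. indicator K x * G i x)" for i
          using K GB[of i] by (intro integrable_indicator_compact_of_Lp[OF _ p]) (auto simp: le_less_trans)
        then have "integrable lborel (\<lambda>x. \<Sum>i\<in>UNIV. (indicator K x * G i x) *\<^sub>R (axis i 1 :: real^'n))"
          by (intro Bochner_Integration.integrable_sum integrable_scaleR_left)
        also have "(\<lambda>x. \<Sum>i\<in>UNIV. (indicator K x * G i x) *\<^sub>R (axis i 1 :: real^'n)) = (\<lambda>x. indicator K x *\<^sub>R g x)"
          unfolding g_def by (simp add: scaleR_sum_right)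
        finally have "integrable lebesgue (\<lambda>x. indicator K x *\<^sub>R g x)" by (subst integrable_completion) auto
        then show "g absolutely_integrable_on K" unfolding set_integrable_def .
      qed
      fix \<phi> i assume \<phi>: "\<phi> \<in> test_functions \<Omega>"
      note tf = test_function_facts[OF \<phi>]
      have [measurable]: "\<phi> \<in> borel_measurable borel" "partial_deriv i \<phi> \<in> borel_measurable borel"
        using tf(5,6) by (auto intro: borel_measurable_continuous_onI)
      have sup: "(LINT x:\<Omega>|lebesgue. a x * b x) = (LINT x|lborel. a x * b x)"
        if [measurable]: "a \<in> borel_measurable borel" "b \<in> borel_measurable borel" and b: "\<And>x. x \<notin> \<Omega> \<Longrightarrow> b x = 0"
        for a b :: "real^'n \<Rightarrow> real"
      proof -
        have "(LINT x:\<Omega>|lebesgue. a x * b x) = (LINT x|lebesgue. a x * b x)"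
          unfolding set_lebesgue_integral_def using b by (intro Bochner_Integration.integral_cong) (auto simp: indicator_def)
        also have "\<dots> = (LINT x|lborel. a x * b x)" by (rule integral_completion) measurable
        finally show ?thesis .
      qed
      have "(LINT x:\<Omega>|lebesgue. u x * partial_deriv i \<phi> x) = (LINT x|lborel. u x * partial_deriv i \<phi> x)"
      proof (rule sup)
        show "partial_deriv i \<phi> x = 0" if "x \<notin> \<Omega>" for x using tf(2,4) that by blast
      qed measurable
      moreover have "(LINT x:\<Omega>|lebesgue. g x $ i * \<phi> x) = (LINT x|lborel. G i x * \<phi> x)"
        unfolding gi
      proof (rule sup)
        show "\<phi> x = 0" if "x \<notin> \<Omega>" for x using tf(2,3) that by blast
      qed measurable
      ultimately show "(LINT x:\<Omega>|lebesgue. u x * partial_deriv i \<phi> x) = - (LINT x:\<Omega>|lebesgue. g x $ i * \<phi> x)"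
        using G[OF \<phi>, of i] by simp
    qed
  qed
qed

theorem theorem1p1:
  fixes p \<alpha> :: real
  assumes "CARD('n::finite) \<ge> 2" and "p > 1" and "1 \<le> \<alpha>" and "\<alpha> < real CARD('n)"
  shows
    "(\<exists>C::real. \<forall>(\<Omega>::(real^'n) set) f.
        open \<Omega> \<and> - \<Omega> \<noteq> {} \<and> f \<in> Lp_space p \<Omega> \<and>
        (\<alpha> = 1 \<and> convex (- \<Omega>) \<or> \<alpha> = 1 \<and> p > 1 + 1 / real CARD('n)) \<longrightarrow>
        weakly_differentiable_with_bound p \<Omega> (local_frac_max \<alpha> \<Omega> f) (C * Lp_norm p \<Omega> f)) \<and>
     (\<forall>\<Omega>::(real^'n) set.
        open \<Omega> \<and> - \<Omega> \<noteq> {} \<and>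
        (\<alpha> > 1 \<and> bounded \<Omega> \<or> \<alpha> = 1 \<and> bounded \<Omega> \<and> uniform_curvature_bound \<Omega>) \<longrightarrow>
        (\<exists>C::real. \<forall>f. f \<in> Lp_space p \<Omega> \<longrightarrow>
          weakly_differentiable_with_bound p \<Omega> (local_frac_max \<alpha> \<Omega> f) (C * Lp_norm p \<Omega> f)))"
proof (intro conjI allI impI)
  have wd: "weakly_differentiable_with_bound p \<Omega> (local_frac_max \<alpha> \<Omega> f)
     ((real CARD('n) powr p * real CARD('n) * gradient_const p TYPE(real^'n) D C) powr (1 / p) * Lp_norm p \<Omega> f)"
    if "open \<Omega>" "- \<Omega> \<noteq> {}" "f \<in> Lp_space p \<Omega>" "D > 0" "\<And>x. x \<in> \<Omega> \<Longrightarrow> infdist x (- \<Omega>) powr (\<alpha> - 1) \<le> D"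
      "C \<ge> 0" "crescent_bounded p \<alpha> C (- \<Omega>)" for \<Omega> :: "(real^'n) set" and f D C
    using assms that by (intro local_frac_max_weakly_differentiable) auto
  \<comment> \<open>At \<alpha> = 1 the power is 0, so D = 1 serves all domains and the constant
    depends only on dimension and p.\<close>
  have crit: "infdist x (- \<Omega>) powr (\<alpha> - 1) \<le> 1" if "\<alpha> = 1" for x and \<Omega> :: "(real^'n) set"
    using that by simp
  show "\<exists>C::real. \<forall>(\<Omega>::(real^'n) set) f.
        open \<Omega> \<and> - \<Omega> \<noteq> {} \<and> f \<in> Lp_space p \<Omega> \<and>
        (\<alpha> = 1 \<and> convex (- \<Omega>) \<or> \<alpha> = 1 \<and> p > 1 + 1 / real CARD('n)) \<longrightarrow>
        weakly_differentiable_with_bound p \<Omega> (local_frac_max \<alpha> \<Omega> f) (C * Lp_norm p \<Omega> f)"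
  proof -
    have "\<exists>C\<ge>0. \<forall>S::(real^'n) set. closed S \<and> S \<noteq> {} \<and> (\<alpha> = 1 \<and> convex S \<or> \<alpha> = 1 \<and> p > 1 + 1 / real CARD('n)) \<longrightarrow> crescent_bounded p \<alpha> C S"
    \<comment> \<open>The constant is chosen before \<Omega>, so the distinction is on p alone: for
      large p the bound for arbitrary closed sets also covers the convex ones, and otherwise only
      the convex alternative remains.\<close>
    proof (cases "p > 1 + 1 / real CARD('n)")
      case True
      then show ?thesis using crescent_bounded_large_p[of p, where 'a="real^'n"] by auto
    next
      case False
      then show ?thesis using crescent_bounded_convex[OF assms(2), where 'a="real^'n"] by auto
    qed
    then obtain C where C: "C \<ge> 0" "\<And>S::(real^'n) set. closed S \<and> S \<noteq> {} \<and> (\<alpha> = 1 \<and> convex S \<or> \<alpha> = 1 \<and> p > 1 + 1 / real CARD('n)) \<Longrightarrow> crescent_bounded p \<alpha> C S"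
      by blast
    show ?thesis
      by (intro exI[of _ "(real CARD('n) powr p * real CARD('n) * gradient_const p TYPE(real^'n) 1 C) powr (1 / p)"] allI impI wd C crit) auto
  qed
  fix \<Omega> :: "(real^'n) set"
  assume \<Omega>: "open \<Omega> \<and> - \<Omega> \<noteq> {} \<and> (\<alpha> > 1 \<and> bounded \<Omega> \<or> \<alpha> = 1 \<and> bounded \<Omega> \<and> uniform_curvature_bound \<Omega>)"
  then have S: "closed (- \<Omega>)" "- \<Omega> \<noteq> {}" "bounded (- (- \<Omega>))" by auto
  obtain R where R: "R > 0" "\<And>x. x \<notin> - \<Omega> \<Longrightarrow> infdist x (- \<Omega>) \<le> R"
    using bounded_complement_dist[OF S(3,2)] by metis
  \<comment> \<open>The constant may depend on \<Omega> here: R comes from boundedness, and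
    \<open>D = R powr (\<alpha> - 1)\<close>.\<close>
  have D: "infdist x (- \<Omega>) powr (\<alpha> - 1) \<le> R powr (\<alpha> - 1)" if "x \<in> \<Omega>" for x
    using R(2)[of x] that assms(3) by (intro powr_mono2) (auto simp: infdist_nonneg)
  have "\<exists>C\<ge>0. crescent_bounded p \<alpha> C (- \<Omega>)"
  proof (cases "\<alpha> > 1")
    case True
    then show ?thesis using assms(2,4) by (intro crescent_bounded_subcritical S) auto
  next
    case False
    then have 1: "\<alpha> = 1" "uniform_curvature_bound \<Omega>" using \<Omega> by auto
    then obtain R' where "R' > 0" "\<forall>x\<in>\<Omega>. \<exists>b\<in>- \<Omega>. dist x b = infdist x (- \<Omega>) \<and> ball (b + (R' / infdist x (- \<Omega>)) *\<^sub>R (x - b)) R' \<subseteq> \<Omega>"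
      unfolding uniform_curvature_bound_def by auto
    then show ?thesis unfolding 1(1) using assms(2) by (intro crescent_bounded_curvature[where R = R'] S) auto
  qed
  then obtain C where C: "C \<ge> 0" "crescent_bounded p \<alpha> C (- \<Omega>)" by blast
  show "\<exists>C::real. \<forall>f. f \<in> Lp_space p \<Omega> \<longrightarrow>
          weakly_differentiable_with_bound p \<Omega> (local_frac_max \<alpha> \<Omega> f) (C * Lp_norm p \<Omega> f)"
    using \<Omega> R(1)
    by (intro exI[of _ "(real CARD('n) powr p * real CARD('n) * gradient_const p TYPE(real^'n) (R powr (\<alpha> - 1)) C) powr (1 / p)"] allI impI wd C D) auto
qed

end
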